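(* Let $\rho_1\in\mathcal P_2(\mathbb R^n)$ and let $(\rho_t)_{t\in[0,1)}$ be an averaged sliced flow (see context) with target $\rho_1$ and gain $\lambda=\lambda_{\rm SW}$, where $$\lambda_{\rm SW}(t):=\frac{r(t)^2}{D(t)(1-t)}=\frac{n}{\chi(t)(1-t)}\qquad\text{when } r(t)>0 .$$ Suppose that $D(t)>0$ whenever $r(t)>0$, and that $r(0)>0$. Then, for every $t\in[0,1)$, $$r(t)=(1-t)\,r(0).$$ The corresponding total control energy is $$\mathcal E_u(0,1)=n\,SW_2^2(\rho_0,\rho_1)\int_0^1\frac1{\chi(t)}\,\mathrm dt .$$ If $\chi(t)\ge\underline\chi>0$ for almost every $t\in(0,1)$, then $$n\,SW_2^2(\rho_0,\rho_1)\le\mathcal E_u(0,1)\le\frac{n}{\underline\chi}\,SW_2^2(\rho_0,\rho_1).$$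
   Context: $\mathcal P_2(\mathbb R^n)$: Borel probability measures with finite second moment. $\mathcal S^{n-1}$: unit sphere, $\sigma$: its uniform probability measure; $\mu_\theta$: pushforward of $\mu$ under $x\mapsto\theta^\top x$. $SW_2^2(\mu,\nu)=\int_{\mathcal S^{n-1}}W_2^2(\mu_\theta,\nu_\theta)\,\sigma(\mathrm d\theta)$. For absolutely continuous $\rho_t\in\mathcal P_2(\mathbb R^n)$, $\mathcal T_t^\theta$ is the one-dimensional monotone optimal transport map from $(\rho_t)_\theta$ to $(\rho_1)_\theta$, and $g_t(x)=\int_{\mathcal S^{n-1}}(\theta^\top x-\mathcal T_t^\theta(\theta^\top x))\theta\,\sigma(\mathrm d\theta)$ (defined $\rho_t$-a.e.). Set $$r(t)=SW_2(\rho_t,\rho_1),\quad D(t)=\int_{\mathbb R^n}\|g_t(x)\|^2\rho_t(\mathrm dx),\quad \chi(t)=\frac{n}{r(t)^2}D(t)\ \text{if } r(t)>0,\quad \chi(t)=1\ \text{if } r(t)=0 .$$ An averaged sliced flow with target $\rho_1$ and gain $\lambda\ge0$ is a narrowly continuous curve $(\rho_t)_{t\in[0,1)}$ of absolutely continuous measures in $\mathcal P_2(\mathbb R^n)$ which, with the Borel velocity field $v(t,x)=-\lambda(t)g_t(x)$, satisfies $\partial_t\rho_t+\nabla_x\cdot(\rho_tv)=0$ weakly on $(0,1)\times\mathbb R^n$ (tested against $C_c^\infty((0,1)\times\mathbb R^n)$) and $\int_0^{\bar t}\int\|v(t,x)\|^2\rho_t(\mathrm dx)\,\mathrm dt<\infty$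 for every $\bar t\in(0,1)$. When $r(t)=0$ one has $g_t=0$ $\rho_t$-a.e., so the value of the gain there is immaterial. The target $\rho_1$ is a fixed measure; the curve is only defined for $t<1$. For $X(t)\sim\rho_t$ and $u(t)=v(t,X(t))$, the control energy is $\mathcal E_u(0,\tau)=\int_0^\tau\mathbb E[\|u(t)\|^2]\,\mathrm dt$ for $0<\tau<1$, and $\mathcal E_u(0,1)=\lim_{\tau\nearrow1}\mathcal E_u(0,\tau)\in[0,\infty]$. *)

theory Defs
  imports "HOL-Probability.Probability"
begin

section \<open>Measures on Euclidean space and sliced Wasserstein distance\<close>

definition P2 :: "'a::euclidean_space measure set" where
  "P2 = {\<mu>. prob_space \<mu> \<and> sets \<mu> = sets borel \<and> (\<integral>\<^sup>+x. ennreal ((norm x)\<^sup>2) \<partial>\<mu>) < \<infinity>}"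

definition couplings :: "'a::euclidean_space measure \<Rightarrow> 'a measure \<Rightarrow> ('a \<times> 'a) measure set" where
  "couplings \<mu> \<nu> = {\<gamma>. sets \<gamma> = sets borel \<and> distr \<gamma> borel fst = \<mu> \<and> distr \<gamma> borel snd = \<nu>}"

definition W2_sq :: "'a::euclidean_space measure \<Rightarrow> 'a measure \<Rightarrow> ennreal" where
  "W2_sq \<mu> \<nu> = (INF \<gamma>\<in>couplings \<mu> \<nu>. \<integral>\<^sup>+z. ennreal ((norm (fst z - snd z))\<^sup>2) \<partial>\<gamma>)"

text \<open>The uniform probability measure on the unit sphere, as a measure on the ambient space: the
  law of the direction of a uniformly distributed point of the unit ball. The lemmas below
  show that it is a probability measure carried by the sphere and invariant under orthogonal
  maps (stated for well-ordered index types, as in the library's change of variables theory),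
  which characterises it. In dimension one it gives mass one half to each of the two
  unit vectors.\<close>

definition sphere_measure :: "'a::euclidean_space measure" where
  "sphere_measure = distr (uniform_measure lborel (ball 0 1)) borel sgn"

definition proj_measure :: "'a::euclidean_space \<Rightarrow> 'a measure \<Rightarrow> real measure" where
  "proj_measure \<theta> \<mu> = distr \<mu> borel (\<lambda>x. \<theta> \<bullet> x)"

definition SW2_sq :: "'a::euclidean_space measure \<Rightarrow> 'a measure \<Rightarrow> ennreal" where
  "SW2_sq \<mu> \<nu> = (\<integral>\<^sup>+\<theta>. W2_sq (proj_measure \<theta> \<mu>) (proj_measure \<theta> \<nu>) \<partial>sphere_measure)"

definition SW2 :: "'a::euclidean_space measure \<Rightarrow> 'a measure \<Rightarrow> real" where
  "SW2 \<mu> \<nu> = sqrt (enn2real (SW2_sq \<mu> \<nu>))"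

section \<open>Monotone optimal maps and the averaged sliced field\<close>

text \<open>Monotonicity is only required on a set of full measure: when \<open>\<mu>\<close> is bounded and \<open>\<nu>\<close> is not,
  no everywhere finite map on the whole line is monotone and transports \<open>\<mu>\<close> to \<open>\<nu>\<close>.\<close>

definition monotone_ot_map :: "real measure \<Rightarrow> real measure \<Rightarrow> (real \<Rightarrow> real) \<Rightarrow> bool" where
  "monotone_ot_map \<mu> \<nu> T \<longleftrightarrow>
     T \<in> borel_measurable borel \<and>
     (\<exists>A\<in>sets borel. (AE s in \<mu>. s \<in> A) \<and> mono_on A T) \<and>
     distr \<mu> borel T = \<nu> \<and>
     (\<integral>\<^sup>+s. ennreal ((s - T s)\<^sup>2) \<partial>\<mu>) = W2_sq \<mu> \<nu>"

text \<open>For atomless \<open>\<mu>\<close> the monotone optimal map is unique up to null sets, and a family of such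
  maps over all directions is considered in a version that is jointly Borel in direction and
  position, so that it can be integrated over the directions.\<close>

definition sliced_ot_maps ::
  "'a::euclidean_space measure \<Rightarrow> 'a measure \<Rightarrow> ('a \<Rightarrow> real \<Rightarrow> real) \<Rightarrow> bool" where
  "sliced_ot_maps \<mu> \<nu> T \<longleftrightarrow>
     (\<lambda>(\<theta>, s). T \<theta> s) \<in> borel_measurable borel \<and>
     (\<forall>\<theta>\<in>sphere 0 1. monotone_ot_map (proj_measure \<theta> \<mu>) (proj_measure \<theta> \<nu>) (T \<theta>))"

definition sliced_field :: "('a::euclidean_space \<Rightarrow> real \<Rightarrow> real) \<Rightarrow> 'a \<Rightarrow> 'a" where
  "sliced_field T x = (LINT \<theta>|sphere_measure. (\<theta> \<bullet> x - T \<theta> (\<theta> \<bullet> x)) *\<^sub>R \<theta>)"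

definition dissipation :: "('a::euclidean_space \<Rightarrow> real \<Rightarrow> real) \<Rightarrow> 'a measure \<Rightarrow> real" where
  "dissipation T \<mu> = (LINT x|\<mu>. (norm (sliced_field T x))\<^sup>2)"

definition chi :: "('a::euclidean_space \<Rightarrow> real \<Rightarrow> real) \<Rightarrow> 'a measure \<Rightarrow> 'a measure \<Rightarrow> real" where
  "chi T \<mu> \<nu> =
     (if SW2 \<mu> \<nu> > 0 then real DIM('a) / (SW2 \<mu> \<nu>)\<^sup>2 * dissipation T \<mu> else 1)"

definition lambda_SW ::
  "('a::euclidean_space \<Rightarrow> real \<Rightarrow> real) \<Rightarrow> 'a measure \<Rightarrow> 'a measure \<Rightarrow> real \<Rightarrow> real" where
  "lambda_SW T \<mu> \<nu> t = (SW2 \<mu> \<nu>)\<^sup>2 / (dissipation T \<mu> * (1 - t))"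

section \<open>Flows\<close>

primrec Ck :: "nat \<Rightarrow> ('b::euclidean_space \<Rightarrow> real) \<Rightarrow> bool" where
  "Ck 0 f \<longleftrightarrow> continuous_on UNIV f"
| "Ck (Suc k) f \<longleftrightarrow> (\<forall>x. f differentiable (at x)) \<and>
     (\<forall>w. Ck k (\<lambda>x. frechet_derivative f (at x) w))"

definition test_functions :: "(real \<times> 'a::euclidean_space \<Rightarrow> real) set" where
  "test_functions = {\<phi>. (\<forall>k. Ck k \<phi>) \<and>
     (\<exists>K. compact K \<and> K \<subseteq> {0<..<1} \<times> UNIV \<and> (\<forall>z. z \<notin> K \<longrightarrow> \<phi> z = 0))}"

definition weak_continuity_equation ::
  "(real \<Rightarrow> 'a::euclidean_space measure) \<Rightarrow> (real \<Rightarrow> 'a \<Rightarrow> 'a) \<Rightarrow> bool" where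
  "weak_continuity_equation \<rho> v \<longleftrightarrow>
     (\<forall>\<phi>\<in>test_functions.
        (LINT t:{0<..<1}|lborel. LINT x|\<rho> t.
           frechet_derivative \<phi> (at (t, x)) (1, 0) +
           frechet_derivative \<phi> (at (t, x)) (0, v t x)) = 0)"

definition narrowly_continuous_on ::
  "real set \<Rightarrow> (real \<Rightarrow> 'a::euclidean_space measure) \<Rightarrow> bool" where
  "narrowly_continuous_on I \<rho> \<longleftrightarrow>
     (\<forall>f :: 'a \<Rightarrow> real. continuous_on UNIV f \<and> bounded (range f) \<longrightarrow>
        continuous_on I (\<lambda>t. LINT x|\<rho> t. f x))"

text \<open>Since the sliced field is determined only almost everywhere, the velocity \<open>v\<close> is a Borel
  field that agrees with it almost everywhere at each time.\<close>

definition averaged_sliced_flow ::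
  "(real \<Rightarrow> 'a::euclidean_space measure) \<Rightarrow> 'a measure \<Rightarrow> (real \<Rightarrow> 'a \<Rightarrow> real \<Rightarrow> real) \<Rightarrow>
   (real \<Rightarrow> real) \<Rightarrow> (real \<Rightarrow> 'a \<Rightarrow> 'a) \<Rightarrow> bool" where
  "averaged_sliced_flow \<rho> \<rho>1 T gain v \<longleftrightarrow>
     (\<forall>t\<in>{0..<1}. \<rho> t \<in> P2 \<and> absolutely_continuous lborel (\<rho> t)) \<and>
     narrowly_continuous_on {0..<1} \<rho> \<and>
     (\<forall>t\<in>{0..<1}. 0 \<le> gain t) \<and>
     (\<forall>t\<in>{0..<1}. sliced_ot_maps (\<rho> t) \<rho>1 (T t)) \<and>
     (\<lambda>(t, x). v t x) \<in> borel_measurable (restrict_space borel ({0..<1} \<times> UNIV)) \<and>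
     (\<forall>t\<in>{0..<1}. AE x in \<rho> t. v t x = - gain t *\<^sub>R sliced_field (T t) x) \<and>
     weak_continuity_equation \<rho> v \<and>
     (\<forall>\<tau>\<in>{0<..<1}.
        (\<integral>\<^sup>+t\<in>{0..\<tau>}. (\<integral>\<^sup>+x. ennreal ((norm (v t x))\<^sup>2) \<partial>\<rho> t) \<partial>lborel) < \<infinity>)"

section \<open>Control energy\<close>

definition energy :: "'w measure \<Rightarrow> (real \<Rightarrow> 'w \<Rightarrow> 'a::euclidean_space) \<Rightarrow> real \<Rightarrow> ennreal" where
  "energy M u \<tau> = (\<integral>\<^sup>+t\<in>{0..\<tau>}. (\<integral>\<^sup>+\<omega>. ennreal ((norm (u t \<omega>))\<^sup>2) \<partial>M) \<partial>lborel)"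

definition total_energy :: "'w measure \<Rightarrow> (real \<Rightarrow> 'w \<Rightarrow> 'a::euclidean_space) \<Rightarrow> ennreal" where
  "total_energy M u = Lim (at_left 1) (energy M u)"

section \<open>Basic facts\<close>

lemma sgn_borel_measurable [measurable]:
  "(sgn :: 'a::euclidean_space \<Rightarrow> 'a) \<in> borel_measurable borel"
  unfolding sgn_div_norm by measurable

lemma emeasure_unit_ball:
  "emeasure lborel (ball (0::'a::euclidean_space) 1) \<noteq> 0"
  "emeasure lborel (ball (0::'a::euclidean_space) 1) \<noteq> \<infinity>"
  using emeasure_lborel_ball_finite[of "0::'a" 1]
    content_ball_pos[of 1 "0::'a"]
  by (auto simp: measure_def)

lemma prob_space_sphere_measure: "prob_space (sphere_measure :: 'a::euclidean_space measure)"
proof -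
  interpret prob_space "uniform_measure lborel (ball (0::'a) 1)"
    by (rule prob_space_uniform_measure) (use emeasure_unit_ball in auto)
  show ?thesis
    unfolding sphere_measure_def by (rule prob_space_distr) simp
qed

lemma AE_sphere_measure: "AE \<theta> in (sphere_measure :: 'a::euclidean_space measure). \<theta> \<in> sphere 0 1"
proof -
  have "AE x in lborel. x \<noteq> (0::'a)"
    by (rule AE_lborel_singleton)
  then have "AE x in uniform_measure lborel (ball (0::'a) 1). sgn x \<in> sphere 0 1"
    by (intro AE_uniform_measureI) (auto simp: norm_sgn)
  then show ?thesis
    unfolding sphere_measure_def by (subst AE_distr_iff) auto
qed

lemma sphere_measure_orthogonal:
  fixes f :: "real ^ 'n::{finite,wellorder} \<Rightarrow> real ^ 'n::_"
  assumes "orthogonal_transformation f"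
  shows "distr sphere_measure borel f = sphere_measure"
proof (rule measure_eqI)
  have lin: "linear f" and nf: "\<And>x. norm (f x) = norm x"
    using assms by (auto simp: orthogonal_transformation)
  have [measurable]: "f \<in> borel_measurable borel"
    using lin by (simp add: linear_continuous_on linear_conv_bounded_linear borel_measurable_continuous_onI)
  have inj: "inj f" and surj: "surj f"
    using assms by (auto simp: orthogonal_transformation_inj orthogonal_transformation_surj)
  fix A assume "A \<in> sets (distr sphere_measure borel f)"
  then have A [measurable]: "A \<in> sets borel" by simp
  let ?B = "ball (0::real^'n::{finite,wellorder}) 1"
  have sg: "sgn (f x) = f (sgn x)" for x
    using lin nf by (simp add: sgn_div_norm linear_cmul)
  define S where "S = ?B \<inter> sgn -` (f -` A)"
  define S' where "S' = ?B \<inter> sgn -` A"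
  have bS: "S \<in> sets borel" and bS': "S' \<in> sets borel"
    unfolding S_def S'_def vimage_comp by (auto intro!: sets.Int measurable_sets_borel[OF _ A])
  have im: "f ` S = S'"
  proof
    show "f ` S \<subseteq> S'" by (auto simp: S_def S'_def sg nf)
    show "S' \<subseteq> f ` S"
    proof
      fix y assume y: "y \<in> S'"
      obtain x where "y = f x" using surj by (metis surjD)
      with y show "y \<in> f ` S" by (auto simp: S_def S'_def sg[symmetric] nf)
    qed
  qed
  have lm: "S \<in> lmeasurable" "S' \<in> lmeasurable"
    using bS bS' by (auto intro!: bounded_set_imp_lmeasurable bounded_subset[OF bounded_ball[of 0 1]]
        simp: S_def S'_def)
  have "measure lebesgue S' = measure lebesgue S"
    using measure_orthogonal_image[OF assms lm(1)] im by simp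
  then have "emeasure lebesgue S = emeasure lebesgue S'"
    using lm by (simp only: emeasure_eq_measure2)
  then have eq: "emeasure lborel S = emeasure lborel S'"
    using bS bS' by simp
  have "emeasure (distr sphere_measure borel f) A
      = emeasure lborel S / emeasure lborel ?B"
  proof -
    have fA: "f -` A \<in> sets borel" and sfA: "sgn -` (f -` A) \<in> sets borel"
      by (auto intro!: measurable_sets_borel[OF _ A] simp: vimage_comp)
    then show ?thesis
      by (simp add: sphere_measure_def emeasure_distr S_def del: vimage_comp)
  qed
  moreover have "emeasure sphere_measure A = emeasure lborel S' / emeasure lborel ?B"
    using measurable_sets_borel[OF sgn_borel_measurable A]
    by (simp add: sphere_measure_def emeasure_distr S'_def)
  ultimately show "emeasure (distr sphere_measure borel f) A = emeasure sphere_measure A"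
    using eq by simp
qed (simp add: sphere_measure_def)

lemma lambda_SW_chi:
  fixes \<mu> \<nu> :: "'a::euclidean_space measure"
  assumes "SW2 \<mu> \<nu> > 0"
  shows "lambda_SW T \<mu> \<nu> t = real DIM('a) / (chi T \<mu> \<nu> * (1 - t))"
  using assms DIM_positive[where 'a = 'a]
  by (simp add: lambda_SW_def chi_def mult.assoc del: DIM_positive)

lemma energy_tendsto_total_energy: "(energy M u \<longlongrightarrow> total_energy M u) (at_left 1)"
proof -
  have mono: "energy M u s \<le> energy M u t" if "s \<le> t" for s t
    unfolding energy_def using that
    by (intro nn_integral_mono) (auto split: split_indicator)
  have "(energy M u \<longlongrightarrow> (SUP s\<in>{..<1}. energy M u s)) (at_left 1)"
  proof (rule order_tendstoI)
    fix a assume "a < (SUP s\<in>{..<1}. energy M u s)"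
    then obtain s where s: "s < 1" "a < energy M u s"
      by (auto simp: less_SUP_iff)
    show "\<forall>\<^sub>F t in at_left 1. a < energy M u t"
      using eventually_at_left_real[OF s(1)]
    proof eventually_elim
      case (elim t)
      with s mono[of s t] show ?case by (auto intro: less_le_trans)
    qed
  next
    fix a assume a: "(SUP s\<in>{..<1}. energy M u s) < a"
    show "\<forall>\<^sub>F t in at_left 1. energy M u t < a"
      using eventually_at_left_real[of 0 1, OF zero_less_one]
    proof eventually_elim
      case (elim t)
      then have "energy M u t \<le> (SUP s\<in>{..<1}. energy M u s)" by (intro SUP_upper) auto
      with a show ?case by simp
    qed
  qed
  then show ?thesis
    unfolding total_energy_def by (metis tendsto_Lim trivial_limit_at_left_real)
qed

end

theory Submission
  imports Defs
begin

text \<open>For a fixed direction \<open>\<theta>\<close>, the transport cost between the projections changes over \<open>[s, t]\<close> by at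
  least the increment of the Kantorovich potential of time \<open>s\<close>, and by at most that of the potential
  of time \<open>t\<close>. The continuity equation turns both into integrals of \<open>2 (\<theta> \<bullet> x - T (\<theta> \<bullet> x)) (\<theta> \<bullet> v)\<close> with
  \<open>T\<close> frozen at an end point, and summing over finer and finer partitions gives the exact increment;
  no differentiability of the cost and no superposition principle is needed. The maps are first
  clipped at a level \<open>R\<close>, which makes the potentials integrable at all times, and \<open>R\<close> tends to infinity
  afterwards. Convergence of the frozen maps comes from writing them as quantile functions of the
  target composed with the distribution functions of the curve.

  Averaging over \<open>\<theta>\<close>, the squared sliced distance \<open>m\<close> satisfies \<open>m' = - 2 \<lambda> D = - 2 m / (1 - t)\<close>, hence
  \<open>m t = (1 - t)\<^sup>2 m 0\<close>. The energy density is \<open>\<lambda>\<^sup>2 D = n m 0 / \<chi>\<close>, and isotropy of the sphere measure gives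
  \<open>n D \<le> m\<close>, that is \<open>\<chi> \<le> 1\<close>, which yields the lower energy bound.\<close>

section \<open>Smooth cut-off functions\<close>

text \<open>The transport map of time \<open>s\<close> is controlled in mean square under the curve
  at time \<open>s\<close> only; under the curve at another time its potential may fail to be
  integrable. A clipped map has a potential of quadratic growth, so second moments suffice, and it
  carries the projections of all times to one and the same clipped target, so that costs can be
  compared by duality. A second moment bound locally uniform in time is not part of the definition
  of a flow and is derived from the kinetic energy. The continuity equation is given for smooth
  functions of compact support, whereas the potentials depend on one linear coordinate and may have
  discontinuous derivatives; cut-offs, polynomials and dominated convergence bridge the gap. The
  maps \<open>T t\<close> are jointly Borel for each fixed \<open>t\<close> only, and the formula
  with quantile functions supplies the measurability in time that Fubini's theorem needs. Absolute
  continuity enters through the absence of atoms in the projections: distribution functions then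
  converge at every point, and the positions at which a quantile function of the target jumps form a
  null set.\<close>

lemma filterlim_real_Suc: "filterlim (\<lambda>n. real (Suc n)) at_top sequentially"
  by (rule filterlim_compose[OF filterlim_real_sequentially filterlim_Suc])

lemma divide_Suc_tendsto_0: "(\<lambda>n. c / real (Suc n)) \<longlonglongrightarrow> 0"
  by (intro tendsto_divide_0[OF tendsto_const] filterlim_at_top_imp_at_infinity filterlim_real_Suc)

lemma Ck_SucI:
  assumes "\<And>x. (f has_derivative f' x) (at x)" and "\<And>w. Ck k (\<lambda>x. f' x w)"
  shows "Ck (Suc k) f"
proof -
  have "frechet_derivative f (at x) = f' x" for x
    using frechet_derivative_at[OF assms(1)] by simp
  then show ?thesis
    using assms by (auto simp: differentiable_def)
qed

lemma Ck_Suc_has_derivative: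
  "Ck (Suc k) f \<Longrightarrow> (f has_derivative frechet_derivative f (at x)) (at x)"
  by (simp add: frechet_derivative_works)

lemma Ck_Suc_imp_Ck: "Ck (Suc k) f \<Longrightarrow> Ck k f"
proof (induction k arbitrary: f)
  case 0
  then show ?case
    by (auto intro!: differentiable_imp_continuous_on simp: differentiable_on_def intro: differentiable_at_withinI)
next
  case (Suc k)
  then show ?case by simp
qed

lemma Ck_const: "Ck k (\<lambda>x. c)"
  by (induction k arbitrary: c) (auto intro!: continuous_intros)

lemma Ck_bounded_linear:
  assumes "bounded_linear f"
  shows "Ck k f"
proof (cases k)
  case 0
  with assms show ?thesis by (simp add: linear_continuous_on)
next
  case (Suc k')
  have "Ck (Suc k') f"
    by (rule Ck_SucI[where f' = "\<lambda>_. f"]) (auto intro: bounded_linear_imp_has_derivative assms Ck_const)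
  with Suc show ?thesis by simp
qed

lemma Ck_add: "Ck k f \<Longrightarrow> Ck k g \<Longrightarrow> Ck k (\<lambda>x. f x + g x)"
proof (induction k arbitrary: f g)
  case 0
  then show ?case by (auto intro!: continuous_intros)
next
  case (Suc k)
  show ?case
    by (rule Ck_SucI[OF has_derivative_add[OF Ck_Suc_has_derivative[OF Suc.prems(1)]
            Ck_Suc_has_derivative[OF Suc.prems(2)]]])
      (use Suc in auto)
qed

lemma Ck_mult: "Ck k f \<Longrightarrow> Ck k g \<Longrightarrow> Ck k (\<lambda>x. f x * g x)"
proof (induction k arbitrary: f g)
  case 0
  then show ?case by (auto intro!: continuous_intros)
next
  case (Suc k)
  have "Ck k f" "Ck k g"
    using Suc.prems by (auto intro: Ck_Suc_imp_Ck simp del: Ck.simps)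
  then show ?case
    by (intro Ck_SucI[OF has_derivative_mult[OF Ck_Suc_has_derivative[OF Suc.prems(1)]
            Ck_Suc_has_derivative[OF Suc.prems(2)]]] Ck_add Suc.IH)
      (use Suc.prems in auto)
qed

lemma Ck_compose_linear:
  assumes "bounded_linear L"
  shows "Ck k f \<Longrightarrow> Ck k (\<lambda>x. f (L x))"
proof (induction k arbitrary: f)
  case 0
  then have "continuous_on UNIV (f \<circ> L)"
    using linear_continuous_on[OF assms, of UNIV]
      continuous_on_compose[of UNIV L f] continuous_on_subset[of UNIV f "range L"] by simp
  then show ?case by (simp add: o_def)
next
  case (Suc k)
  have "((\<lambda>x. f (L x)) has_derivative (\<lambda>w. frechet_derivative f (at (L x)) (L w))) (at x)" for x
    by (rule has_derivative_compose[OF bounded_linear_imp_has_derivative[OF assms]])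
      (rule Ck_Suc_has_derivative[OF Suc.prems])
  then show ?case
    by (rule Ck_SucI) (use Suc in auto)
qed

lemma Ck_inner_self: "Ck k (\<lambda>x. x \<bullet> x)"
proof (cases k)
  case 0
  then show ?thesis by (auto intro!: continuous_intros)
next
  case (Suc k')
  have "Ck (Suc k') (\<lambda>x::'a. x \<bullet> x)"
  proof (rule Ck_SucI)
    show "((\<lambda>x::'a. x \<bullet> x) has_derivative (\<lambda>w. x \<bullet> w + w \<bullet> x)) (at x)" for x
      by (auto intro!: derivative_eq_intros)
    show "Ck k' (\<lambda>x::'a. x \<bullet> w + w \<bullet> x)" for w
      by (intro Ck_bounded_linear bounded_linear_add bounded_linear_inner_left bounded_linear_inner_right)
  qed
  with Suc show ?thesis by simp
qed

lemma Ck_real_polynomial: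
  "real_polynomial_function p \<Longrightarrow> Ck k p" for p :: "real \<Rightarrow> real"
  by (induction rule: real_polynomial_function.induct)
    (auto intro: Ck_bounded_linear Ck_const Ck_add Ck_mult)

text \<open>The flat function exp(-1/x) divided by a power of x. The powers are included because the
  derivative of \<open>sexp n\<close> is a combination of \<open>sexp (n + 2)\<close> and
  \<open>sexp (n + 1)\<close>, so one induction over this family gives smoothness of all
  orders.\<close>

definition sexp :: "nat \<Rightarrow> real \<Rightarrow> real" where
  "sexp n x = (if x > 0 then exp (- 1 / x) / x ^ n else 0)"

lemma sexp_nonneg: "sexp n x \<ge> 0"
  by (simp add: sexp_def)

lemma sexp_nonpos [simp]: "x \<le> 0 \<Longrightarrow> sexp n x = 0"
  by (simp add: sexp_def)

lemma sexp_0_le_1: "sexp 0 x \<le> 1"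
  by (simp add: sexp_def)

lemma sexp_tendsto_0: "(sexp n \<longlongrightarrow> 0) (at 0)"
proof -
  \<comment> \<open>Substituting 1/x turns the limit at 0 from the right into the decay of a power
    against the exponential.\<close>
  have "((\<lambda>x. (inverse x) ^ n / exp (inverse x)) \<longlongrightarrow> 0) (at_right (0::real))"
    using filterlim_compose[OF tendsto_power_div_exp_0 filterlim_inverse_at_top_right] .
  then have R: "(sexp n \<longlongrightarrow> 0) (at_right 0)"
    by (rule Lim_transform_eventually)
      (auto simp: eventually_at_filter sexp_def exp_minus divide_simps power_divide inverse_eq_divide)
  have L: "(sexp n \<longlongrightarrow> 0) (at_left 0)"
    by (rule Lim_transform_eventually[OF tendsto_const]) (auto simp: eventually_at_filter)
  show ?thesis
    using L R by (simp add: filterlim_at_split)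
qed

lemma sexp_has_derivative:
  "(sexp n has_real_derivative (sexp (n + 2) x - real n * sexp (n + 1) x)) (at x)"
proof -
  consider "x > 0" | "x < 0" | "x = 0" by linarith
  then show ?thesis
  proof cases
    case 1
    have "((\<lambda>x. exp (- 1 / x) / x ^ n) has_real_derivative
        (sexp (n + 2) x - real n * sexp (n + 1) x)) (at x)"
    proof -
      have "((\<lambda>x. exp (- 1 / x) * (1 / x) ^ n) has_real_derivative
          (exp (- 1 / x) * (1 / x\<^sup>2) * (1 / x) ^ n + exp (- 1 / x) * (real n * (1 / x) ^ (n - 1) * (- 1 / x\<^sup>2)))) (at x)"
        using 1 by (auto intro!: derivative_eq_intros simp: power2_eq_square)
      moreover have e: "real n * (1 / x) ^ (n - 1) = real n * x * (1 / x) ^ n"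
        using 1 by (cases n) simp_all
      have "exp (- 1 / x) * (1 / x\<^sup>2) * (1 / x) ^ n
          + exp (- 1 / x) * (real n * (1 / x) ^ (n - 1) * (- 1 / x\<^sup>2))
          = sexp (n + 2) x - real n * sexp (n + 1) x"
        unfolding e using 1 by (simp add: sexp_def field_simps power2_eq_square)
      ultimately show ?thesis by (simp add: power_divide)
    qed
    then show ?thesis
      by (rule has_field_derivative_transform_within_open[where S = "{0<..}"])
        (use 1 in \<open>auto simp: sexp_def\<close>)
  next
    case 2
    have "((\<lambda>x. 0) has_real_derivative (sexp (n + 2) x - real n * sexp (n + 1) x)) (at x)"
      using 2 by simp
    then show ?thesis
      by (rule has_field_derivative_transform_within_open[where S = "{..<0}"]) (use 2 in auto)
  next
    case 3
    \<comment> \<open>At the origin the difference quotient of \<open>sexp n\<close> is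
      \<open>sexp (Suc n)\<close> itself, which tends to 0; the claimed derivative is 0 there as
      well.\<close>
    have "((\<lambda>h. (sexp n (0 + h) - sexp n 0) / h) \<longlongrightarrow> 0) (at 0)"
      by (rule Lim_transform_eventually[OF sexp_tendsto_0[of "Suc n"]])
        (auto simp: eventually_at_filter sexp_def field_simps)
    then show ?thesis using 3 by (simp add: DERIV_def)
  qed
qed

lemma sexp_0_has_derivative: "(sexp 0 has_real_derivative sexp 2 x) (at x)"
  using sexp_has_derivative[of 0 x] by (simp add: numeral_2_eq_2)

lemma sexp_continuous: "continuous_on A (sexp n)"
  by (meson DERIV_isCont continuous_at_imp_continuous_on sexp_has_derivative)

lemma sexp_measurable [measurable]: "sexp n \<in> borel_measurable borel"
  by (intro borel_measurable_continuous_onI sexp_continuous)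

text \<open>The half-line up to 1 is the range of the argument
  \<open>1 - (x \<bullet> x) / N\<^sup>2\<close> of the spatial cut-off.\<close>

lemma sexp_bounded: obtains C where "C > 0" "\<And>x. x \<le> 1 \<Longrightarrow> sexp n x \<le> C"
proof -
  have "compact (sexp n ` {0..1})"
    by (intro compact_continuous_image sexp_continuous) auto
  then obtain B where B: "\<And>y. y \<in> sexp n ` {0..1} \<Longrightarrow> \<bar>y\<bar> \<le> B"
    using compact_imp_bounded bounded_real by metis
  have "sexp n x \<le> max 1 B" if "x \<le> 1" for x
    using B[of "sexp n x"] that by (cases "x \<le> 0") auto
  then show ?thesis by (intro that[of "max 1 B"]) auto
qed

lemma sexp_0_scaled_tendsto:
  assumes "x > 0"
  shows "(\<lambda>n. sexp 0 (real (Suc n) * x)) \<longlonglongrightarrow> 1"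
proof -
  have "filterlim (\<lambda>n. real (Suc n) * x) at_top sequentially"
    using assms by (intro filterlim_at_top_mult_tendsto_pos[where c = x] tendsto_const
        filterlim_real_Suc) auto
  then have "(\<lambda>n. exp (- 1 / (real (Suc n) * x))) \<longlonglongrightarrow> exp 0"
    by (intro tendsto_exp tendsto_divide_0[OF tendsto_const]) (rule filterlim_at_top_imp_at_infinity)
  then show ?thesis using assms by (simp add: sexp_def)
qed

text \<open>The induction runs over \<open>k\<close> for all \<open>n\<close> at once, since
  differentiation raises the exponent.\<close>

lemma Ck_sexp_compose: "Ck k p \<Longrightarrow> Ck k (\<lambda>x. sexp n (p x))"
proof (induction k arbitrary: p n)
  case 0
  then have "continuous_on UNIV (sexp n \<circ> p)"
    by (intro continuous_on_compose sexp_continuous) auto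
  then show ?case by (simp add: o_def)
next
  case (Suc k)
  have *: "((\<lambda>x. sexp n (p x)) has_derivative
      (\<lambda>w. (sexp (n + 2) (p x) + - real n * sexp (n + 1) (p x)) * frechet_derivative p (at x) w)) (at x)" for x
    using has_derivative_compose[OF Ck_Suc_has_derivative[OF Suc.prems]
        sexp_has_derivative[unfolded has_field_derivative_def]] by simp
  show ?case
    by (rule Ck_SucI[OF *], intro Ck_mult Ck_add Ck_const Suc.IH)
      (use Suc.prems Ck_Suc_imp_Ck in \<open>auto simp del: Ck.simps(2), auto\<close>)
qed

text \<open>For every \<open>n\<close> the support stays in [a, b] while the two ramps steepen. In
  the limit the function becomes the indicator of the open interval, and its derivative acts like a
  unit mass at \<open>a\<close> minus a unit mass at \<open>b\<close>.\<close>

definition time_cutoff :: "real \<Rightarrow> real \<Rightarrow> nat \<Rightarrow> real \<Rightarrow> real" where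
  "time_cutoff a b n t = sexp 0 (real (Suc n) * (t - a)) * sexp 0 (real (Suc n) * (b - t))"

definition time_cutoff' :: "real \<Rightarrow> real \<Rightarrow> nat \<Rightarrow> real \<Rightarrow> real" where
  "time_cutoff' a b n t =
     real (Suc n) * sexp 2 (real (Suc n) * (t - a)) * sexp 0 (real (Suc n) * (b - t)) -
     real (Suc n) * sexp 2 (real (Suc n) * (b - t)) * sexp 0 (real (Suc n) * (t - a))"

lemma time_cutoff_has_derivative:
  "(time_cutoff a b n has_real_derivative time_cutoff' a b n t) (at t)"
proof -
  have 1: "((\<lambda>t. sexp 0 (real (Suc n) * (t - a))) has_real_derivative
      sexp 2 (real (Suc n) * (t - a)) * real (Suc n)) (at t)"
    by (rule DERIV_chain2[where f = "sexp 0" and g = "\<lambda>t. real (Suc n) * (t - a)", OF sexp_0_has_derivative])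
      (auto intro!: derivative_eq_intros)
  have 2: "((\<lambda>t. sexp 0 (real (Suc n) * (b - t))) has_real_derivative
      sexp 2 (real (Suc n) * (b - t)) * - real (Suc n)) (at t)"
    by (rule DERIV_chain2[where f = "sexp 0" and g = "\<lambda>t. real (Suc n) * (b - t)", OF sexp_0_has_derivative])
      (auto intro!: derivative_eq_intros)
  show ?thesis
    unfolding time_cutoff_def[abs_def] time_cutoff'_def
    by (rule DERIV_cong[OF DERIV_mult[OF 1 2]]) (simp add: algebra_simps)
qed

lemma Ck_time_cutoff: "Ck k (time_cutoff a b n)"
proof -
  have "Ck k (\<lambda>t::real. real (Suc n) * (t + (- a)))" "Ck k (\<lambda>t::real. real (Suc n) * (b + (- 1) * t))"
    by (intro Ck_mult Ck_add Ck_const Ck_bounded_linear bounded_linear_ident)+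
  then show ?thesis
    unfolding time_cutoff_def[abs_def]
    by (intro Ck_mult[where f = "\<lambda>t. sexp 0 (real (Suc n) * (t - a))"] Ck_sexp_compose) simp_all
qed

lemma time_cutoff_eq_0: "t \<notin> {a<..<b} \<Longrightarrow> time_cutoff a b n t = 0" "t \<notin> {a<..<b} \<Longrightarrow> time_cutoff' a b n t = 0"
proof -
  assume "t \<notin> {a<..<b}"
  then have "real (Suc n) * (t - a) \<le> 0 \<or> real (Suc n) * (b - t) \<le> 0"
    by (auto simp: mult_le_0_iff)
  then show "time_cutoff a b n t = 0" "time_cutoff' a b n t = 0"
    by (auto simp: time_cutoff_def time_cutoff'_def)
qed

lemma time_cutoff_bounds: "0 \<le> time_cutoff a b n t" "time_cutoff a b n t \<le> 1"
  by (auto simp: time_cutoff_def intro!: mult_nonneg_nonneg sexp_nonneg mult_le_one sexp_0_le_1)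

lemma time_cutoff_tendsto:
  "(\<lambda>n. time_cutoff a b n t) \<longlonglongrightarrow> indicator {a<..<b} t"
proof (cases "t \<in> {a<..<b}")
  case True
  then show ?thesis
    unfolding time_cutoff_def using tendsto_mult[OF sexp_0_scaled_tendsto sexp_0_scaled_tendsto, of "t - a" "b - t"]
    by simp
qed (simp add: time_cutoff_eq_0)

lemma time_cutoff_measurable [measurable]:
  "time_cutoff a b n \<in> borel_measurable borel" "time_cutoff' a b n \<in> borel_measurable borel"
  unfolding time_cutoff_def[abs_def] time_cutoff'_def[abs_def] by measurable

text \<open>The factor \<open>exp 1\<close> normalises the value at the origin to 1. Using the inner
  product instead of the norm keeps the function smooth there.\<close>

definition space_cutoff :: "real \<Rightarrow> 'a::euclidean_space \<Rightarrow> real" where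
  "space_cutoff N x = exp 1 * sexp 0 (1 - (x \<bullet> x) / N\<^sup>2)"

definition space_cutoff' :: "real \<Rightarrow> 'a::euclidean_space \<Rightarrow> 'a \<Rightarrow> real" where
  "space_cutoff' N x w = - 2 * exp 1 / N\<^sup>2 * sexp 2 (1 - (x \<bullet> x) / N\<^sup>2) * (x \<bullet> w)"

lemma Ck_space_cutoff: "Ck k (space_cutoff N)"
proof -
  have "Ck k (\<lambda>x::'a. 1 + (- 1 / N\<^sup>2) * (x \<bullet> x))"
    by (intro Ck_add Ck_mult Ck_const Ck_inner_self)
  then show ?thesis
    unfolding space_cutoff_def[abs_def] by (intro Ck_mult Ck_const Ck_sexp_compose) simp
qed

lemma space_cutoff_has_derivative:
  "(space_cutoff N has_derivative space_cutoff' N x) (at x)"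
proof -
  have 1: "((\<lambda>x::'a. 1 - (x \<bullet> x) / N\<^sup>2) has_derivative (\<lambda>w. - (x \<bullet> w + w \<bullet> x) / N\<^sup>2)) (at x)"
    unfolding divide_inverse by (auto intro!: derivative_eq_intros simp: algebra_simps)
  have "(\<lambda>w. exp 1 * (sexp 2 (1 - (x \<bullet> x) / N\<^sup>2) * (- (x \<bullet> w + w \<bullet> x) / N\<^sup>2))) = space_cutoff' N x"
  proof
    fix w
    have "w \<bullet> x = x \<bullet> w" by (rule inner_commute)
    then show "exp 1 * (sexp 2 (1 - (x \<bullet> x) / N\<^sup>2) * (- (x \<bullet> w + w \<bullet> x) / N\<^sup>2)) = space_cutoff' N x w"
      by (simp add: space_cutoff'_def)
  qed
  then show ?thesis
    using has_derivative_mult_right[OF has_derivative_compose[OF 1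
          sexp_0_has_derivative[unfolded has_field_derivative_def]], of "exp 1"]
    unfolding space_cutoff_def[abs_def] by simp
qed

lemma space_cutoff_bounds: "0 \<le> space_cutoff N x" "space_cutoff N x \<le> 1"
proof -
  show "0 \<le> space_cutoff N x" by (simp add: space_cutoff_def sexp_nonneg)
  have "sexp 0 (1 - (x \<bullet> x) / N\<^sup>2) \<le> exp (- 1)"
    by (auto simp: sexp_def divide_simps)
  then show "space_cutoff N x \<le> 1"
    using mult_left_mono[of _ "exp (-1)" "exp (1::real)"] by (fastforce simp: space_cutoff_def exp_minus)
qed

lemma space_cutoff_eq_0:
  assumes "N > 0" "norm x \<ge> N"
  shows "space_cutoff N x = 0" "space_cutoff' N x w = 0"
proof -
  have "N\<^sup>2 \<le> x \<bullet> x"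
    using assms power_mono[of N "norm x" 2] by (simp add: power2_norm_eq_inner)
  then show "space_cutoff N x = 0" "space_cutoff' N x w = 0"
    using assms by (auto simp: space_cutoff_def space_cutoff'_def)
qed

lemma space_cutoff_tendsto: "(\<lambda>n. space_cutoff (real (Suc n)) x) \<longlonglongrightarrow> 1"
proof -
  have "(\<lambda>n. 1 - (x \<bullet> x) / (real (Suc n))\<^sup>2) \<longlonglongrightarrow> 1 - 0"
    by (intro tendsto_diff tendsto_const tendsto_divide_0[OF tendsto_const] filterlim_at_top_imp_at_infinity
        filterlim_pow_at_top filterlim_real_Suc) auto
  then have "(\<lambda>n. sexp 0 (1 - (x \<bullet> x) / (real (Suc n))\<^sup>2)) \<longlonglongrightarrow> sexp 0 1"
    using continuous_on_tendsto_compose[OF sexp_continuous[of UNIV 0]] by auto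
  then have "(\<lambda>n. space_cutoff (real (Suc n)) x) \<longlonglongrightarrow> exp 1 * sexp 0 1"
    unfolding space_cutoff_def by (intro tendsto_intros)
  then show ?thesis by (simp add: sexp_def exp_minus)
qed

text \<open>The gradient is of order 1/N and vanishes outside the ball of radius \<open>N\<close>,
  so the factor \<open>norm x\<close> in the second bound only compensates the decay. That bound,
  uniform in \<open>N\<close>, is what makes cut-offs of quadratically growing functions
  admissible.\<close>

lemma space_cutoff'_bound:
  obtains C where "C > 0"
    "\<And>N (x::'a::euclidean_space) w. N > 0 \<Longrightarrow> \<bar>space_cutoff' N x w\<bar> \<le> C / N * norm w"
    "\<And>N (x::'a) w. N > 0 \<Longrightarrow> norm x * \<bar>space_cutoff' N x w\<bar> \<le> C * norm w"
proof -
  obtain B where B: "B > 0" "\<And>x. x \<le> 1 \<Longrightarrow> sexp 2 x \<le> B" using sexp_bounded by blast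
  define C where "C = 2 * exp 1 * B"
  have C: "C > 0" using B by (simp add: C_def)
  have *: "\<bar>space_cutoff' N x w\<bar> \<le> C / N * norm w" if "N > 0" for N and x w :: 'a
  proof (cases "norm x \<ge> N")
    case True
    then show ?thesis using that C by (simp add: space_cutoff_eq_0)
  next
    case False
    have "\<bar>space_cutoff' N x w\<bar> = 2 * exp 1 / N\<^sup>2 * sexp 2 (1 - (x \<bullet> x) / N\<^sup>2) * \<bar>x \<bullet> w\<bar>"
      by (simp add: space_cutoff'_def abs_mult sexp_nonneg)
    also have "\<dots> \<le> 2 * exp 1 / N\<^sup>2 * B * (N * norm w)"
    proof (intro mult_mono mult_nonneg_nonneg sexp_nonneg)
      show "\<bar>x \<bullet> w\<bar> \<le> N * norm w"
        using Cauchy_Schwarz_ineq2[of x w] False mult_right_mono[of "norm x" N "norm w"] by simp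
    qed (use B that in auto)
    also have "\<dots> = C / N * norm w"
      using that by (simp add: C_def power2_eq_square)
    finally show ?thesis .
  qed
  moreover have "norm x * \<bar>space_cutoff' N x w\<bar> \<le> C * norm w" if N: "N > 0" for N and x w :: 'a
  proof (cases "norm x \<ge> N")
    case True
    then show ?thesis using N C by (simp add: space_cutoff_eq_0)
  next
    case False
    then have "norm x * \<bar>space_cutoff' N x w\<bar> \<le> N * (C / N * norm w)"
      by (intro mult_mono *[OF N] abs_ge_zero less_imp_le[OF N]) linarith
    then show ?thesis using N by simp
  qed
  ultimately show ?thesis by (intro that[OF C])
qed

text \<open>The strict inequalities at 0 and 1 place the support in the open time strip. Increments
  that start at time 0 therefore need a separate limit in
  \<open>has_increments_smooth\<close>.\<close>

lemma test_functions_product: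
  fixes \<phi> :: "'a::euclidean_space \<Rightarrow> real"
  assumes "\<And>k. Ck k \<phi>" and "\<And>x. norm x \<ge> N \<Longrightarrow> \<phi> x = 0" and "0 < a" "b < 1"
  shows "(\<lambda>z. time_cutoff a b n (fst z) * \<phi> (snd z)) \<in> test_functions"
proof -
  have "compact ({a..b} \<times> cball (0::'a) N)" by (intro compact_Times) auto
  moreover have "{a..b} \<times> cball (0::'a) N \<subseteq> {0<..<1} \<times> UNIV" using assms by auto
  moreover have "time_cutoff a b n (fst z) * \<phi> (snd z) = 0" if "z \<notin> {a..b} \<times> cball (0::'a) N" for z
  proof -
    have "fst z \<notin> {a<..<b} \<or> norm (snd z) \<ge> N" using that by (cases z) auto
    then show ?thesis using assms(2) time_cutoff_eq_0(1) by fastforce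
  qed
  moreover have "Ck k (\<lambda>z. time_cutoff a b n (fst z) * \<phi> (snd z))" for k
    by (intro Ck_mult Ck_compose_linear[OF bounded_linear_fst] Ck_compose_linear[OF bounded_linear_snd]
        Ck_time_cutoff assms)
  ultimately show ?thesis unfolding test_functions_def by blast
qed

lemma frechet_derivative_test_product:
  fixes \<phi> :: "'a::euclidean_space \<Rightarrow> real"
  assumes "(\<phi> has_derivative \<phi>') (at x)"
  shows "frechet_derivative (\<lambda>z. time_cutoff a b n (fst z) * \<phi> (snd z)) (at (t, x)) (s, w) =
    time_cutoff' a b n t * s * \<phi> x + time_cutoff a b n t * \<phi>' w"
proof -
  have 1: "((\<lambda>z. time_cutoff a b n (fst z)) has_derivative (\<lambda>z. time_cutoff' a b n t * fst z)) (at (t, x))"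
    using has_derivative_compose[OF bounded_linear_imp_has_derivative[OF bounded_linear_fst]
       , of "time_cutoff a b n" _ "(t,x)"] time_cutoff_has_derivative[of a b n t]
    by (simp add: has_field_derivative_def)
  have 2: "((\<lambda>z. \<phi> (snd z)) has_derivative (\<lambda>z. \<phi>' (snd z))) (at (t, x))"
    using has_derivative_compose[OF bounded_linear_imp_has_derivative[OF bounded_linear_snd]
       , of \<phi> \<phi>' "(t,x)"] assms by simp
  show ?thesis
    using frechet_derivative_at[OF has_derivative_mult[OF 1 2], symmetric] by (simp add: algebra_simps)
qed

section \<open>Iterated integrals against a kernel\<close>

text \<open>Pushing \<open>\<kappa> t\<close> forward under \<open>Pair t\<close> moves the
  dependence on \<open>t\<close> from the integrand into the measure, where measurability of the
  kernel takes care of it.\<close>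

lemma integral_measurable_kernel:
  fixes f :: "'a \<Rightarrow> 'b \<Rightarrow> real"
  assumes [measurable]: "\<kappa> \<in> M \<rightarrow>\<^sub>M subprob_algebra N"
    and f [measurable]: "(\<lambda>z. f (fst z) (snd z)) \<in> borel_measurable (M \<Otimes>\<^sub>M N)"
  shows "(\<lambda>t. LINT x|\<kappa> t. f t x) \<in> borel_measurable M"
proof -
  have k: "sets (\<kappa> t) = sets N" if "t \<in> space M" for t
    using assms(1) that by (rule sets_kernel)
  have "(\<lambda>t. integral\<^sup>L (distr (\<kappa> t) (M \<Otimes>\<^sub>M N) (Pair t)) (\<lambda>z. f (fst z) (snd z))) \<in> borel_measurable M"
    by (rule measurable_compose[OF _ integral_measurable_subprob_algebra[OF f]])
      (rule measurable_distr2[where f = Pair and M = N]; simp)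
  moreover have "integral\<^sup>L (distr (\<kappa> t) (M \<Otimes>\<^sub>M N) (Pair t)) (\<lambda>z. f (fst z) (snd z)) = (LINT x|\<kappa> t. f t x)"
    if t: "t \<in> space M" for t
    using t by (subst integral_distr) (auto simp: measurable_cong_sets[OF k[OF t] refl])
  ultimately show ?thesis by (simp cong: measurable_cong)
qed

lemma nn_integral_measurable_kernel:
  fixes f :: "'a \<Rightarrow> 'b \<Rightarrow> ennreal"
  assumes "\<kappa> \<in> M \<rightarrow>\<^sub>M subprob_algebra N"
    and "(\<lambda>z. f (fst z) (snd z)) \<in> borel_measurable (M \<Otimes>\<^sub>M N)"
  shows "(\<lambda>t. \<integral>\<^sup>+x. f t x \<partial>\<kappa> t) \<in> borel_measurable M"
  by (rule nn_integral_measurable_subprob_algebra2[OF _ assms(1)]) (use assms(2) in \<open>simp add: case_prod_beta'\<close>)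

section \<open>Dominated convergence for iterated integrals over a varying measure\<close>

context
  fixes M :: "'a measure" and N :: "'b measure" and \<kappa> :: "'a \<Rightarrow> 'b measure"
    and A :: "'a set" and w :: "'a \<Rightarrow> 'b \<Rightarrow> real"
  assumes kernel [measurable]: "\<kappa> \<in> M \<rightarrow>\<^sub>M subprob_algebra N"
    and A [measurable]: "A \<in> sets M"
    and w [measurable]: "(\<lambda>z. w (fst z) (snd z)) \<in> borel_measurable (M \<Otimes>\<^sub>M N)"
    and finite_w: "(\<integral>\<^sup>+t\<in>A. (\<integral>\<^sup>+x. ennreal (w t x) \<partial>\<kappa> t) \<partial>M) < \<infinity>"
begin

lemma kernel_section_measurable:
  assumes "(\<lambda>z. f (fst z) (snd z)) \<in> borel_measurable (M \<Otimes>\<^sub>M N)" "t \<in> space M"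
  shows "f t \<in> borel_measurable (\<kappa> t)"
proof -
  have "f t \<in> borel_measurable N"
    using measurable_compose[OF measurable_Pair1'[OF assms(2)] assms(1)] by simp
  then show ?thesis
    by (simp add: measurable_cong_sets[OF sets_kernel[OF kernel assms(2)] refl])
qed

lemma AE_kernel_finite: "AE t in M. t \<in> A \<longrightarrow> (\<integral>\<^sup>+x. ennreal (w t x) \<partial>\<kappa> t) < \<infinity>"
proof -
  have [measurable]: "(\<lambda>t. \<integral>\<^sup>+x. ennreal (w t x) \<partial>\<kappa> t) \<in> borel_measurable M"
    by (rule nn_integral_measurable_kernel[OF kernel]) measurable
  have "AE t in M. (\<integral>\<^sup>+x. ennreal (w t x) \<partial>\<kappa> t) * indicator A t \<noteq> \<infinity>"
    by (rule nn_integral_PInf_AE) (use finite_w in auto)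
  then show ?thesis by eventually_elim (auto simp: less_top)
qed

lemma kernel_dominated_section:
  fixes f :: "'a \<Rightarrow> 'b \<Rightarrow> real"
  assumes f: "(\<lambda>z. f (fst z) (snd z)) \<in> borel_measurable (M \<Otimes>\<^sub>M N)"
    and t: "t \<in> space M" and le: "AE x in \<kappa> t. \<bar>f t x\<bar> \<le> w t x"
    and fin: "(\<integral>\<^sup>+x. ennreal (w t x) \<partial>\<kappa> t) < \<infinity>"
  shows "integrable (\<kappa> t) (f t)" "\<bar>LINT x|\<kappa> t. f t x\<bar> \<le> enn2real (\<integral>\<^sup>+x. ennreal (w t x) \<partial>\<kappa> t)"
proof -
  note [measurable] = kernel_section_measurable[OF f t] kernel_section_measurable[OF w t]
  have le': "(\<integral>\<^sup>+x. ennreal (norm (f t x)) \<partial>\<kappa> t) \<le> (\<integral>\<^sup>+x. ennreal (w t x) \<partial>\<kappa> t)"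
    by (rule nn_integral_mono_AE) (use le in eventually_elim, auto intro!: ennreal_leI)
  then show i: "integrable (\<kappa> t) (f t)"
    using fin by (auto simp: integrable_iff_bounded)
  have "ennreal (norm (LINT x|\<kappa> t. f t x)) \<le> (\<integral>\<^sup>+x. ennreal (w t x) \<partial>\<kappa> t)"
    using integral_norm_bound_ennreal[OF i] le' by (rule order_trans)
  then show "\<bar>LINT x|\<kappa> t. f t x\<bar> \<le> enn2real (\<integral>\<^sup>+x. ennreal (w t x) \<partial>\<kappa> t)"
    using fin by (metis enn2real_ennreal enn2real_mono norm_ge_zero real_norm_def infinity_ennreal_def)
qed

lemma integrable_kernel_bound:
  "set_integrable M A (\<lambda>t. enn2real (\<integral>\<^sup>+x. ennreal (w t x) \<partial>\<kappa> t))"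
proof -
  have [measurable]: "(\<lambda>t. \<integral>\<^sup>+x. ennreal (w t x) \<partial>\<kappa> t) \<in> borel_measurable M"
    by (rule nn_integral_measurable_kernel[OF kernel]) measurable
  have "(\<integral>\<^sup>+t. ennreal (norm (indicator A t *\<^sub>R enn2real (\<integral>\<^sup>+x. ennreal (w t x) \<partial>\<kappa> t))) \<partial>M)
    \<le> (\<integral>\<^sup>+t\<in>A. (\<integral>\<^sup>+x. ennreal (w t x) \<partial>\<kappa> t) \<partial>M)"
    by (rule nn_integral_mono) (auto split: split_indicator intro: ennreal_enn2real_if[THEN eq_refl, THEN order_trans])
  then show ?thesis
    unfolding set_integrable_def using finite_w by (auto simp: integrable_iff_bounded)
qed

lemma kernel_dominated_integrable:
  fixes f :: "'a \<Rightarrow> 'b \<Rightarrow> real"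
  assumes f: "(\<lambda>z. f (fst z) (snd z)) \<in> borel_measurable (M \<Otimes>\<^sub>M N)"
    and le: "AE t in M. t \<in> A \<longrightarrow> (AE x in \<kappa> t. \<bar>f t x\<bar> \<le> w t x)"
  shows "set_integrable M A (\<lambda>t. LINT x|\<kappa> t. f t x)"
proof -
  have [measurable]: "(\<lambda>t. LINT x|\<kappa> t. f t x) \<in> borel_measurable M"
    by (rule integral_measurable_kernel[OF kernel f])
  show ?thesis
    unfolding set_integrable_def
  proof (rule Bochner_Integration.integrable_bound[OF integrable_kernel_bound[unfolded set_integrable_def]])
    show "AE t in M. norm (indicat_real A t *\<^sub>R (LINT x|\<kappa> t. f t x))
        \<le> norm (indicat_real A t *\<^sub>R enn2real (\<integral>\<^sup>+x. ennreal (w t x) \<partial>\<kappa> t))"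
      using le AE_kernel_finite AE_space
      by eventually_elim (auto split: split_indicator intro!: kernel_dominated_section(2)[OF f])
  qed measurable
qed

text \<open>Dominated convergence is applied twice: in the second variable for almost every
  \<open>t\<close>, with majorant \<open>w t\<close>, and then in \<open>t\<close>, with the inner
  integral of \<open>w\<close> as majorant.\<close>

lemma kernel_dominated_convergence:
  fixes f :: "nat \<Rightarrow> 'a \<Rightarrow> 'b \<Rightarrow> real"
  assumes f: "\<And>n. (\<lambda>z. f n (fst z) (snd z)) \<in> borel_measurable (M \<Otimes>\<^sub>M N)"
    and f': "(\<lambda>z. f' (fst z) (snd z)) \<in> borel_measurable (M \<Otimes>\<^sub>M N)"
    and le: "\<And>n. AE t in M. t \<in> A \<longrightarrow> (AE x in \<kappa> t. \<bar>f n t x\<bar> \<le> w t x)"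
    and lim: "AE t in M. t \<in> A \<longrightarrow> (AE x in \<kappa> t. (\<lambda>n. f n t x) \<longlonglongrightarrow> f' t x)"
  shows "(\<lambda>n. LINT t:A|M. LINT x|\<kappa> t. f n t x) \<longlonglongrightarrow> (LINT t:A|M. LINT x|\<kappa> t. f' t x)"
proof -
  have [measurable]: "(\<lambda>t. LINT x|\<kappa> t. f n t x) \<in> borel_measurable M"
    "(\<lambda>t. LINT x|\<kappa> t. f' t x) \<in> borel_measurable M" for n
    by (rule integral_measurable_kernel[OF kernel f] integral_measurable_kernel[OF kernel f'])+
  have le_all: "AE t in M. \<forall>n. t \<in> A \<longrightarrow> (AE x in \<kappa> t. \<bar>f n t x\<bar> \<le> w t x)"
    by (rule AE_all_countable[THEN iffD2]) (use le in auto)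
  show ?thesis
    unfolding set_lebesgue_integral_def
  proof (rule integral_dominated_convergence[OF _ _ integrable_kernel_bound[unfolded set_integrable_def]])
    show "AE t in M. norm (indicat_real A t *\<^sub>R (LINT x|\<kappa> t. f n t x))
        \<le> indicat_real A t *\<^sub>R enn2real (\<integral>\<^sup>+x. ennreal (w t x) \<partial>\<kappa> t)" for n
      using le[of n] AE_kernel_finite AE_space
      by eventually_elim (auto split: split_indicator intro!: kernel_dominated_section(2)[OF f])
    show "AE t in M. (\<lambda>n. indicat_real A t *\<^sub>R (LINT x|\<kappa> t. f n t x))
        \<longlonglongrightarrow> indicat_real A t *\<^sub>R (LINT x|\<kappa> t. f' t x)"
      using le_all lim AE_kernel_finite AE_space
    proof eventually_elim
      case (elim t)
      show ?case
      proof (cases "t \<in> A")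
        case True
        note [measurable] = kernel_section_measurable[OF f elim(4)] kernel_section_measurable[OF f' elim(4)]
          kernel_section_measurable[OF w elim(4)]
        have ae: "AE x in \<kappa> t. \<bar>f 0 t x\<bar> \<le> w t x" using elim True by blast
        \<comment> \<open>\<open>finite_w\<close> controls the positive part of \<open>w\<close>
          only; the bound on \<open>f 0\<close> shows that \<open>w t\<close> is nonnegative almost
          everywhere.\<close>
        have "integrable (\<kappa> t) (w t)"
        proof -
          have "(\<integral>\<^sup>+x. ennreal (norm (w t x)) \<partial>\<kappa> t) = (\<integral>\<^sup>+x. ennreal (w t x) \<partial>\<kappa> t)"
            by (rule nn_integral_cong_AE) (use ae in eventually_elim, auto)
          then show ?thesis using elim True by (auto simp: integrable_iff_bounded)
        qed
        then have "(\<lambda>n. LINT x|\<kappa> t. f n t x) \<longlonglongrightarrow> (LINT x|\<kappa> t. f' t x)"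
          by (intro integral_dominated_convergence[where w = "w t"]) (use elim True in auto)
        then show ?thesis using True by simp
      qed simp
    qed
  qed measurable
qed

end

section \<open>From a weak time derivative to increments\<close>

text \<open>\<open>sexp 2\<close> is the derivative of \<open>sexp 0\<close>, which climbs from 0 to
  1, hence a probability density on the positive half-line. It serves as a one-sided
  mollifier.\<close>

lemma sexp_2_has_integral: "integrable lborel (sexp 2)" "(LINT u|lborel. sexp 2 u) = 1"
proof -
  have lim: "(sexp 0 \<longlongrightarrow> 1) at_top"
  proof (rule Lim_transform_eventually)
    have "((\<lambda>x. exp (- 1 / x :: real)) \<longlongrightarrow> exp 0) at_top"
      by (intro tendsto_exp tendsto_divide_0[OF tendsto_const] filterlim_at_top_imp_at_infinity filterlim_ident)
    then show "((\<lambda>x. exp (- 1 / x :: real)) \<longlongrightarrow> 1) at_top" by simp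
    show "eventually (\<lambda>x. exp (- 1 / x) = sexp 0 x) at_top"
      using eventually_gt_at_top[of 0] by eventually_elim (simp add: sexp_def)
  qed
  have "(\<integral>\<^sup>+u. ennreal (sexp 2 u) \<partial>lborel) = (\<integral>\<^sup>+u. ennreal (sexp 2 u) * indicator {0..} u \<partial>lborel)"
    by (rule nn_integral_cong) (auto split: split_indicator)
  also have "\<dots> = ennreal (1 - sexp 0 0)"
    by (rule nn_integral_FTC_atLeast[OF _ sexp_0_has_derivative sexp_nonneg lim]) auto
  finally have "(\<integral>\<^sup>+u. ennreal (sexp 2 u) \<partial>lborel) = ennreal 1" by simp
  then have "has_bochner_integral lborel (sexp 2) 1"
    by (intro has_bochner_integral_nn_integral) (auto simp: sexp_nonneg)
  then show "integrable lborel (sexp 2)" "(LINT u|lborel. sexp 2 u) = 1"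
    by (auto simp: has_bochner_integral_iff)
qed

text \<open>The sign \<open>e\<close> treats both ends of a time interval together: 1 averages over
  times after \<open>a\<close>, -1 over times before it. After the substitution t = a + e u / (n +
  1) the mollifier is the fixed density \<open>sexp 2\<close>, and the opposite ramp becomes
  \<open>sexp 0 (real (Suc n) * l - u)\<close>, which tends to 1 for each \<open>u\<close>.\<close>

lemma sexp_mollifier_tendsto:
  fixes m :: "real \<Rightarrow> real"
  assumes [measurable]: "m \<in> borel_measurable borel" and bound: "\<And>t. \<bar>m t\<bar> \<le> B"
    and lim: "((\<lambda>s. m (a + e * s)) \<longlongrightarrow> L) (at_right 0)" and e: "\<bar>e\<bar> = 1" and l: "l > 0"
  shows "(\<lambda>n. LINT t|lborel. real (Suc n) * sexp 2 (real (Suc n) * (e * (t - a))) *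
      sexp 0 (real (Suc n) * (l - e * (t - a))) * m t) \<longlonglongrightarrow> L"
    (is "(\<lambda>n. ?I n) \<longlonglongrightarrow> L")
proof -
  have ee: "e * e = 1" using e by (metis abs_mult_self_eq mult_1)
  have sub: "?I n = (LINT u|lborel. sexp 2 u * sexp 0 (real (Suc n) * l - u) * m (a + e * (u / real (Suc n))))" for n
  proof -
    have e': "e / real (Suc n) \<noteq> 0" using e by auto
    have ae: "\<bar>e / real (Suc n)\<bar> = 1 / real (Suc n)" using e by (simp add: abs_divide)
    have *: "e * (a + e / real (Suc n) * u - a) = u / real (Suc n)" for u
    proof -
      have "e * (a + e / real (Suc n) * u - a) = (e * e) * u / real (Suc n)" by simp
      then show ?thesis unfolding ee by simp
    qed
    have "?I n = 1 / real (Suc n) * (LINT u|lborel. real (Suc n) * sexp 2 (real (Suc n) * (u / real (Suc n))) *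
        sexp 0 (real (Suc n) * (l - u / real (Suc n))) * m (a + e / real (Suc n) * u))"
      by (subst lborel_integral_real_affine[OF e', of _ a]) (simp only: ae * real_scaleR_def)
    also have "\<dots> = (LINT u|lborel. sexp 2 u * sexp 0 (real (Suc n) * l - u) * m (a + e * (u / real (Suc n))))"
      unfolding integral_mult_right_zero[symmetric]
      by (rule Bochner_Integration.integral_cong) (auto simp: right_diff_distrib)
    finally show ?thesis .
  qed
  have "(\<lambda>n. LINT u|lborel. sexp 2 u * sexp 0 (real (Suc n) * l - u) * m (a + e * (u / real (Suc n))))
      \<longlonglongrightarrow> (LINT u|lborel. sexp 2 u * L)"
  proof (rule integral_dominated_convergence[where w = "\<lambda>u. B * sexp 2 u"])
    show "AE u in lborel. norm (sexp 2 u * sexp 0 (real (Suc n) * l - u) * m (a + e * (u / real (Suc n)))) \<le> B * sexp 2 u" for n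
    proof (rule AE_I2)
      fix u
      have "sexp 2 u * (sexp 0 (real (Suc n) * l - u) * \<bar>m (a + e * (u / real (Suc n)))\<bar>) \<le> sexp 2 u * (1 * B)"
        by (intro mult_left_mono mult_mono sexp_0_le_1 bound sexp_nonneg abs_ge_zero) auto
      then show "norm (sexp 2 u * sexp 0 (real (Suc n) * l - u) * m (a + e * (u / real (Suc n)))) \<le> B * sexp 2 u"
        by (simp add: abs_mult sexp_nonneg mult.commute mult.left_commute)
    qed
    show "AE u in lborel. (\<lambda>n. sexp 2 u * sexp 0 (real (Suc n) * l - u) * m (a + e * (u / real (Suc n)))) \<longlonglongrightarrow> sexp 2 u * L"
    proof (rule AE_I2)
      fix u
      show "(\<lambda>n. sexp 2 u * sexp 0 (real (Suc n) * l - u) * m (a + e * (u / real (Suc n)))) \<longlonglongrightarrow> sexp 2 u * L"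
      proof (cases "u > 0")
        case True
        have "filterlim (\<lambda>n. u / real (Suc n)) (at_right 0) sequentially"
          using True divide_Suc_tendsto_0[of u] by (auto simp: filterlim_at)
        then have 1: "(\<lambda>n. m (a + e * (u / real (Suc n)))) \<longlonglongrightarrow> L"
          by (rule filterlim_compose[OF lim])
        have "filterlim (\<lambda>n. - u + real (Suc n) * l) at_top sequentially"
          by (intro filterlim_tendsto_add_at_top[OF tendsto_const]
              filterlim_at_top_mult_tendsto_pos[OF tendsto_const l filterlim_real_Suc])
        then have f: "filterlim (\<lambda>n. real (Suc n) * l - u) at_top sequentially"
          by (simp add: algebra_simps)
        have "(\<lambda>n. exp (- 1 / (real (Suc n) * l - u))) \<longlonglongrightarrow> exp 0"
          by (intro tendsto_exp tendsto_divide_0[OF tendsto_const] filterlim_at_top_imp_at_infinity f)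
        then have "(\<lambda>n. exp (- 1 / (real (Suc n) * l - u))) \<longlonglongrightarrow> 1" by simp
        then have 2: "(\<lambda>n. sexp 0 (real (Suc n) * l - u)) \<longlonglongrightarrow> 1"
        proof (rule Lim_transform_eventually)
          show "\<forall>\<^sub>F n in sequentially. exp (- 1 / (real (Suc n) * l - u)) = sexp 0 (real (Suc n) * l - u)"
            using filterlim_at_top_dense[THEN iffD1, OF f, rule_format, of 0]
            by eventually_elim (simp add: sexp_def)
        qed
        show ?thesis using tendsto_mult[OF tendsto_mult[OF tendsto_const 2] 1, of "sexp 2 u"] by simp
      qed simp
    qed
    show "integrable lborel (\<lambda>u. B * sexp 2 u)" using sexp_2_has_integral by simp
  qed measurable
  then show ?thesis unfolding sub using sexp_2_has_integral by simp
qed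

text \<open>The derivative of the cut-off splits into a mollifier at each end point, so the
  left-hand side of the weak equation tends to \<open>m a - m b\<close> plus the integral of
  \<open>q\<close>.\<close>

lemma weak_derivative_increment:
  fixes m q :: "real \<Rightarrow> real"
  assumes ab: "0 \<le> a" "a < b" "b \<le> 1"
    and m: "continuous_on {a..b} m"
    and q: "set_integrable lborel {a..b} q"
    and weak: "\<And>n. (LINT t:{0<..<1}|lborel. time_cutoff' a b n t * m t + time_cutoff a b n t * q t) = 0"
  shows "m b - m a = (LINT t:{a..b}|lborel. q t)"
proof -
  define M where "M t = indicator {a..b} t * m t" for t
  define Q where "Q t = indicator {a..b} t * q t" for t
  have [measurable]: "M \<in> borel_measurable borel"
    unfolding M_def using borel_measurable_continuous_on_indicator[OF _ m] by simp
  have Q: "integrable lborel Q"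
    using q by (simp add: Q_def[abs_def] set_integrable_def)
  then have [measurable]: "Q \<in> borel_measurable borel" by auto
  obtain B where B: "\<And>t. t \<in> {a..b} \<Longrightarrow> \<bar>m t\<bar> \<le> B"
    using compact_imp_bounded[OF compact_continuous_image[OF m]] bounded_real by (metis compact_Icc imageI)
  have B0: "B \<ge> 0" using B[of a] ab by auto
  have MB: "\<bar>M t\<bar> \<le> B" for t using B B0 by (auto simp: M_def split: split_indicator)
  \<comment> \<open>With this value \<open>l - (t - a)\<close> is \<open>b - t\<close> and
    \<open>l + (t - b)\<close> is \<open>t - a\<close>, so the last \<open>sexp\<close> factor in
    \<open>?L\<close> and in \<open>?R\<close> is exactly the opposite ramp of the cut-off.\<close>
  define l where "l = b - a"
  have l: "l > 0" using ab by (simp add: l_def)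
  let ?L = "\<lambda>n t. real (Suc n) * sexp 2 (real (Suc n) * (1 * (t - a))) * sexp 0 (real (Suc n) * (l - 1 * (t - a))) * M t"
  let ?R = "\<lambda>n t. real (Suc n) * sexp 2 (real (Suc n) * (- 1 * (t - b))) * sexp 0 (real (Suc n) * (l - (- 1) * (t - b))) * M t"
  have "((\<lambda>s. M (a + 1 * s)) \<longlongrightarrow> m a) (at_right 0)"
  proof -
    have "continuous (at a within {a..b}) m" using m ab by (auto simp: continuous_on_eq_continuous_within)
    then have "(m \<longlongrightarrow> m a) (at_right a)"
      using ab by (simp add: continuous_within at_within_Icc_at_right)
    then have "((\<lambda>s. m (a + s)) \<longlongrightarrow> m a) (at_right 0)"
      by (simp add: filterlim_at_right_to_0[of m _ a] add.commute)
    then show ?thesis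
      by (rule Lim_transform_eventually)
        (use ab eventually_at_right_real[of 0 "b - a"] in \<open>auto simp: M_def elim!: eventually_mono\<close>)
  qed
  from sexp_mollifier_tendsto[OF _ MB this _ l]
  have L: "(\<lambda>n. LINT t|lborel. ?L n t) \<longlonglongrightarrow> m a" by simp
  have "((\<lambda>s. M (b + (- 1) * s)) \<longlongrightarrow> m b) (at_right 0)"
  proof -
    have "continuous (at b within {a..b}) m" using m ab by (auto simp: continuous_on_eq_continuous_within)
    then have "(m \<longlongrightarrow> m b) (at_left b)"
      using ab by (simp add: continuous_within at_within_Icc_at_left)
    then have "((\<lambda>s. m (- s)) \<longlongrightarrow> m b) (at_right (- b))"
      by (simp add: filterlim_at_left_to_right)
    then have "((\<lambda>s. m (b - s)) \<longlongrightarrow> m b) (at_right 0)"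
      by (simp add: filterlim_at_right_to_0[of "\<lambda>s. m (- s)" _ "- b"])
    then show ?thesis
      by (rule Lim_transform_eventually)
        (use ab eventually_at_right_real[of 0 "b - a"] in \<open>auto simp: M_def elim!: eventually_mono\<close>)
  qed
  from sexp_mollifier_tendsto[OF _ MB this _ l]
  have R: "(\<lambda>n. LINT t|lborel. ?R n t) \<longlonglongrightarrow> m b" by simp
  have C: "(\<lambda>n. LINT t|lborel. time_cutoff a b n t * Q t) \<longlonglongrightarrow> (LINT t|lborel. Q t)"
  proof (rule integral_dominated_convergence[where w = "\<lambda>t. \<bar>Q t\<bar>"])
    show "AE t in lborel. (\<lambda>n. time_cutoff a b n t * Q t) \<longlonglongrightarrow> Q t"
      using AE_lborel_singleton[of a] AE_lborel_singleton[of b]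
    proof eventually_elim
      case (elim t)
      then have "Q t = indicator {a<..<b} t * Q t" by (auto simp: Q_def split: split_indicator)
      then show ?case using tendsto_mult[OF time_cutoff_tendsto tendsto_const, of a b t "Q t"] by metis
    qed
    show "AE t in lborel. norm (time_cutoff a b n t * Q t) \<le> \<bar>Q t\<bar>" for n
      using time_cutoff_bounds[of a b n] by (auto simp: abs_mult intro!: mult_left_le_one_le)
  qed (use Q in auto)
  have iL: "integrable lborel (?L n)" "integrable lborel (?R n)" for n
  proof -
    obtain S where S: "S > 0" "\<And>x. x \<le> 1 \<Longrightarrow> sexp 2 x \<le> S" using sexp_bounded by blast
    \<comment> \<open>\<open>sexp_bounded\<close> stops at 1; beyond that point the exponential is
      at most 1 and the square in the denominator at least 1.\<close>
    have S': "sexp 2 x \<le> max S 1" for x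
    proof (cases "x \<le> 1")
      case False
      then have "exp (- 1 / x) \<le> 1" "x ^ 2 \<ge> 1" by auto
      then have "exp (- 1 / x) / x ^ 2 \<le> 1 / 1" by (intro frac_le) auto
      then have "sexp 2 x \<le> 1" using False by (simp add: sexp_def)
      then show ?thesis by simp
    qed (use S in fastforce)
    have *: "integrable lborel (\<lambda>t. real (Suc n) * sexp 2 (f t) * sexp 0 (g t) * M t)"
      if [measurable]: "f \<in> borel_measurable borel" "g \<in> borel_measurable borel" for f g :: "real \<Rightarrow> real"
    proof (rule Bochner_Integration.integrable_bound)
      show "integrable lborel (\<lambda>t. real (Suc n) * max S 1 * B * indicator {a..b} t)"
        by (intro integrable_mult_right, rule integrable_real_indicator) (auto simp: emeasure_lborel_Icc_eq)
      show "AE t in lborel. norm (real (Suc n) * sexp 2 (f t) * sexp 0 (g t) * M t)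
          \<le> norm (real (Suc n) * max S 1 * B * indicator {a..b} t)"
      proof (rule AE_I2)
        fix t
        show "norm (real (Suc n) * sexp 2 (f t) * sexp 0 (g t) * M t) \<le> norm (real (Suc n) * max S 1 * B * indicator {a..b} t)"
        proof (cases "t \<in> {a..b}")
          case True
          have "real (Suc n) * sexp 2 (f t) * sexp 0 (g t) * \<bar>M t\<bar> \<le> real (Suc n) * max S 1 * 1 * B"
            by (intro mult_mono mult_nonneg_nonneg S' sexp_0_le_1 MB sexp_nonneg) (auto simp: B0)
          then show ?thesis using True B0 by (simp add: abs_mult sexp_nonneg)
        qed (simp add: M_def)
      qed
    qed measurable
    show "integrable lborel (?L n)" "integrable lborel (?R n)" by (rule *; measurable)+
  qed
  have iC: "integrable lborel (\<lambda>t. time_cutoff a b n t * Q t)" for n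
    by (rule Bochner_Integration.integrable_bound[OF Q])
      (use time_cutoff_bounds[of a b n] in \<open>auto simp: abs_mult intro!: mult_left_le_one_le\<close>)
  have "(LINT t|lborel. ?L n t) - (LINT t|lborel. ?R n t) + (LINT t|lborel. time_cutoff a b n t * Q t) = 0" for n
  proof -
    have "(LINT t|lborel. ?L n t) - (LINT t|lborel. ?R n t) + (LINT t|lborel. time_cutoff a b n t * Q t) =
      (LINT t|lborel. ?L n t - ?R n t + time_cutoff a b n t * Q t)"
      using iL[of n] iC[of n] by simp
    also have "\<dots> = (LINT t:{0<..<1}|lborel. time_cutoff' a b n t * m t + time_cutoff a b n t * q t)"
      unfolding set_lebesgue_integral_def
    proof (rule Bochner_Integration.integral_cong[OF refl])
      fix t
      have e: "?L n t - ?R n t = time_cutoff' a b n t * M t"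
        by (simp add: time_cutoff'_def l_def algebra_simps)
      show "?L n t - ?R n t + time_cutoff a b n t * Q t =
        indicat_real {0<..<1} t *\<^sub>R (time_cutoff' a b n t * m t + time_cutoff a b n t * q t)"
        unfolding e using ab by (cases "t \<in> {a<..<b}") (auto simp: time_cutoff_eq_0 M_def Q_def split: split_indicator)
    qed
    finally show ?thesis using weak by simp
  qed
  then have "(\<lambda>n. 0) \<longlonglongrightarrow> m a - m b + (LINT t|lborel. Q t)"
    using tendsto_add[OF tendsto_diff[OF L R] C] by simp
  then have "m a - m b + (LINT t|lborel. Q t) = 0" by (simp add: LIMSEQ_const_iff)
  then show ?thesis by (simp add: Q_def[abs_def] set_lebesgue_integral_def)
qed

section \<open>The continuity equation for ridge functions\<close>

text \<open>It is enough to measure open sets, and the indicator of an open set is a limit of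
  bounded continuous functions, whose integrals are continuous in time. Off \<open>I\<close> the
  fixed measure \<open>\<mu>\<close> makes the kernel total.\<close>

lemma narrowly_continuous_kernel:
  fixes \<rho> :: "real \<Rightarrow> 'a::euclidean_space measure"
  assumes nc: "narrowly_continuous_on I \<rho>" and I [measurable]: "I \<in> sets borel"
    and prob: "\<And>t. t \<in> I \<Longrightarrow> prob_space (\<rho> t)" "\<And>t. t \<in> I \<Longrightarrow> sets (\<rho> t) = sets borel"
    and \<mu>: "prob_space \<mu>" "sets \<mu> = sets borel"
  shows "(\<lambda>t. if t \<in> I then \<rho> t else \<mu>) \<in> borel \<rightarrow>\<^sub>M prob_algebra borel"
proof (rule measurable_prob_algebra_generated[where G = "{S. open S}" and \<Omega> = UNIV])
  show "sets borel = sigma_sets UNIV {S::'a set. open S}"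
    by (simp add: borel_def)
  show "Int_stable {S::'a set. open S}" by (auto simp: Int_stable_def)
  show "prob_space (if t \<in> I then \<rho> t else \<mu>)" for t using prob \<mu> by auto
  show "sets (if t \<in> I then \<rho> t else \<mu>) = sets borel" for t using prob \<mu> by auto
  fix U :: "'a set" assume "U \<in> {S. open S}"
  then have U: "open U" by simp
  then have [measurable]: "U \<in> sets borel" by simp
  let ?\<kappa> = "\<lambda>t. if t \<in> I then \<rho> t else \<mu>"
  have fin: "finite_measure (?\<kappa> t)" for t
    using prob \<mu> by (auto simp: prob_space_def)
  have "(\<lambda>t. measure (?\<kappa> t) U) \<in> borel_measurable borel"
  \<comment> \<open>\<open>infdist x {}\<close> is 0 by convention, so the approximation by
    distances to the complement would give 0 for the whole space.\<close>
  proof (cases "U = UNIV")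
    case True
    have "measure (?\<kappa> t) U = 1" for t
    proof -
      have "sets (?\<kappa> t) = sets borel" using prob(2) \<mu>(2) by auto
      from sets_eq_imp_space_eq[OF this] have "space (?\<kappa> t) = UNIV" by simp
      moreover have "prob_space (?\<kappa> t)" using prob \<mu> by auto
      ultimately show ?thesis using True prob_space.prob_space by metis
    qed
    then show ?thesis by simp
  next
    case False
    define f where "f n x = min 1 (real n * infdist x (- U))" for n x
    have cf: "continuous_on UNIV (f n)" for n unfolding f_def by (intro continuous_intros)
    have bf: "0 \<le> f n x" "f n x \<le> 1" for n x by (auto simp: f_def infdist_nonneg)
    have lim: "(\<lambda>n. f n x) \<longlonglongrightarrow> indicator U x" for x
    proof (cases "x \<in> U")
      case True
      have "infdist x (- U) > 0"
        using True False U by (intro infdist_pos_not_in_closed) auto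
      then obtain n0 where n0: "1 < real n0 * infdist x (- U)" using reals_Archimedean3 by blast
      have "f n x = 1" if "n \<ge> n0" for n
      proof -
        have "real n0 * infdist x (- U) \<le> real n * infdist x (- U)"
          using that by (intro mult_right_mono) (auto simp: infdist_nonneg)
        then show ?thesis using n0 by (simp add: f_def)
      qed
      then have ev: "\<forall>\<^sub>F n in sequentially. 1 = f n x"
        by (intro eventually_sequentiallyI[of n0]) simp
      show ?thesis using True Lim_transform_eventually[OF tendsto_const ev] by simp
    qed (simp add: f_def)
    have cont: "continuous_on I (\<lambda>t. LINT x|\<rho> t. f n x)" for n
    proof -
      have "bounded (range (f n))" using bf[of n] by (intro boundedI[of _ 1]) auto
      with cf[of n] nc show ?thesis unfolding narrowly_continuous_on_def by blast
    qed
    have "(\<lambda>t. LINT x|?\<kappa> t. f n x) \<in> borel_measurable borel" for n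
    proof -
      have "(\<lambda>t. indicator I t *\<^sub>R (LINT x|\<rho> t. f n x) + indicator (- I) t * (LINT x|\<mu>. f n x)) \<in> borel_measurable borel"
        using borel_measurable_continuous_on_indicator[OF I cont[of n]] by measurable
      also have "(\<lambda>t. indicator I t *\<^sub>R (LINT x|\<rho> t. f n x) + indicator (- I) t * (LINT x|\<mu>. f n x)) =
          (\<lambda>t. LINT x|?\<kappa> t. f n x)"
        by (auto split: split_indicator)
      finally show ?thesis .
    qed
    moreover have "(\<lambda>n. LINT x|?\<kappa> t. f n x) \<longlonglongrightarrow> measure (?\<kappa> t) U" for t
    proof -
      interpret finite_measure "?\<kappa> t" by (rule fin)
      have s: "sets (?\<kappa> t) = sets borel" using prob \<mu> by auto
      have sp: "space (?\<kappa> t) = UNIV" using sets_eq_imp_space_eq[OF s] by simp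
      have "(\<lambda>n. LINT x|?\<kappa> t. f n x) \<longlonglongrightarrow> (LINT x|?\<kappa> t. indicator U x)"
      proof (rule integral_dominated_convergence[where w = "\<lambda>_. 1"])
        show "f n \<in> borel_measurable (?\<kappa> t)" for n
          using borel_measurable_continuous_onI[OF cf] by (simp add: measurable_cong_sets[OF s refl])
        show "indicator U \<in> borel_measurable (?\<kappa> t)" by (simp add: measurable_cong_sets[OF s refl])
      qed (use bf lim in auto)
      then show ?thesis by (simp add: sp)
    qed
    ultimately show ?thesis by (rule borel_measurable_LIMSEQ_real[rotated])
  qed
  then show "(\<lambda>t. emeasure (?\<kappa> t) U) \<in> borel_measurable borel"
    by (simp add: finite_measure.emeasure_eq_measure[OF fin])
qed auto

text \<open>\<open>prob_kernel\<close> and \<open>velocity_measurable\<close> speak of the whole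
  time axis so that \<open>\<rho>\<close> is a kernel without side conditions; the analytic
  assumptions are confined to [0, 1).\<close>

locale continuity_equation =
  fixes \<rho> :: "real \<Rightarrow> 'a::euclidean_space measure" and v :: "real \<Rightarrow> 'a \<Rightarrow> 'a"
  assumes prob_kernel: "\<rho> \<in> borel \<rightarrow>\<^sub>M prob_algebra borel"
    and narrow: "narrowly_continuous_on {0..<1} \<rho>"
    and second_moment: "\<And>t. t \<in> {0..<1} \<Longrightarrow> (\<integral>\<^sup>+x. ennreal ((norm x)\<^sup>2) \<partial>\<rho> t) < \<infinity>"
    and abs_cont: "\<And>t. t \<in> {0..<1} \<Longrightarrow> absolutely_continuous lborel (\<rho> t)"
    and velocity_measurable [measurable]: "(\<lambda>z. v (fst z) (snd z)) \<in> borel_measurable (borel \<Otimes>\<^sub>M borel)"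
    and weak_equation: "weak_continuity_equation \<rho> v"
    and kinetic_energy: "\<And>\<tau>. \<tau> \<in> {0<..<1} \<Longrightarrow>
      (\<integral>\<^sup>+t\<in>{0..\<tau>}. (\<integral>\<^sup>+x. ennreal ((norm (v t x))\<^sup>2) \<partial>\<rho> t) \<partial>lborel) < \<infinity>"
begin

lemma kernel [measurable]: "\<rho> \<in> borel \<rightarrow>\<^sub>M subprob_algebra borel"
  by (rule measurable_prob_algebraD[OF prob_kernel])

lemma kernel_lborel: "\<rho> \<in> lborel \<rightarrow>\<^sub>M subprob_algebra borel"
  by simp

lemma prob_rho: "prob_space (\<rho> t)"
  using measurable_space[OF prob_kernel, of t] by (auto simp: space_prob_algebra)

lemma sets_rho [simp, measurable_cong]: "sets (\<rho> t) = sets borel"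
  using sets_kernel[OF kernel, of t] by simp

lemma space_rho [simp]: "space (\<rho> t) = UNIV"
  using sets_eq_imp_space_eq[OF sets_rho] by simp

lemma measurable_rho [simp]: "f \<in> measurable (\<rho> t) N \<longleftrightarrow> f \<in> measurable borel N"
  by (rule arg_cong[of _ _ "\<lambda>A. f \<in> A"]) (auto intro: measurable_cong_sets)

lemma measurable_prod_borel:
  "f \<in> borel_measurable (lborel \<Otimes>\<^sub>M borel) \<longleftrightarrow> f \<in> borel_measurable (borel \<Otimes>\<^sub>M borel :: (real \<times> 'a) measure)"
  by (rule arg_cong[of _ _ "\<lambda>A. f \<in> A"], rule measurable_cong_sets[OF sets_pair_measure_cong]) auto

lemma v_section_measurable [measurable]: "v t \<in> borel_measurable borel"
  using measurable_compose[OF measurable_Pair1' velocity_measurable, of t] by simp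

lemma square_integrable_rho:
  "t \<in> {0..<1} \<Longrightarrow> integrable (\<rho> t) (\<lambda>x. (norm x)\<^sup>2)"
  using second_moment[of t] by (auto simp: integrable_iff_bounded)

lemma kinetic_energy': "b < 1 \<Longrightarrow> 0 \<le> a \<Longrightarrow>
    (\<integral>\<^sup>+t\<in>{a..b}. (\<integral>\<^sup>+x. ennreal ((norm (v t x))\<^sup>2) \<partial>\<rho> t) \<partial>lborel) < \<infinity>"
  by (rule le_less_trans[OF nn_integral_mono kinetic_energy[of "max b (1/2)"]]) (auto split: split_indicator)

text \<open>Most majorants below have this shape, with \<open>h\<close> equal to 0, to the squared
  norm, or to the squared norm plus the squared transport map.\<close>

lemma affine_energy_finite:
  assumes ab: "0 \<le> a" "b < 1" and K: "K \<ge> 0" and S: "\<And>t. t \<in> {a..b} \<Longrightarrow> (\<integral>\<^sup>+x. ennreal (h t x) \<partial>\<rho> t) \<le> ennreal S"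
    and [measurable]: "\<And>t. h t \<in> borel_measurable borel" and h: "\<And>t x. h t x \<ge> 0"
  shows "(\<integral>\<^sup>+t\<in>{a..b}. (\<integral>\<^sup>+x. ennreal (K * (1 + h t x + (norm (v t x))\<^sup>2)) \<partial>\<rho> t) \<partial>lborel) < \<infinity>"
proof -
  have [measurable]: "(\<lambda>t. \<integral>\<^sup>+x. ennreal ((norm (v t x))\<^sup>2) \<partial>\<rho> t) \<in> borel_measurable borel"
    by (rule nn_integral_measurable_kernel[OF kernel]) simp
  have "(\<integral>\<^sup>+t\<in>{a..b}. (\<integral>\<^sup>+x. ennreal (K * (1 + h t x + (norm (v t x))\<^sup>2)) \<partial>\<rho> t) \<partial>lborel) \<le>
    (\<integral>\<^sup>+t\<in>{a..b}. (ennreal K * (1 + ennreal S + (\<integral>\<^sup>+x. ennreal ((norm (v t x))\<^sup>2) \<partial>\<rho> t))) \<partial>lborel)"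
  proof (rule nn_integral_mono)
    fix t
    interpret prob_space "\<rho> t" by (rule prob_rho)
    have "(\<integral>\<^sup>+x. ennreal (K * (1 + h t x + (norm (v t x))\<^sup>2)) \<partial>\<rho> t) =
        (\<integral>\<^sup>+x. ennreal K * (1 + ennreal (h t x) + ennreal ((norm (v t x))\<^sup>2)) \<partial>\<rho> t)"
      using K h by (intro nn_integral_cong) (simp add: ennreal_mult)
    also have "\<dots> = ennreal K * (1 + (\<integral>\<^sup>+x. ennreal (h t x) \<partial>\<rho> t) + (\<integral>\<^sup>+x. ennreal ((norm (v t x))\<^sup>2) \<partial>\<rho> t))"
      using emeasure_space_1 by (simp add: nn_integral_cmult nn_integral_add)
    finally show "(\<integral>\<^sup>+x. ennreal (K * (1 + h t x + (norm (v t x))\<^sup>2)) \<partial>\<rho> t) * indicator {a..b} t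
        \<le> (ennreal K * (1 + ennreal S + (\<integral>\<^sup>+x. ennreal ((norm (v t x))\<^sup>2) \<partial>\<rho> t))) * indicator {a..b} t"
      using S[of t] by (auto split: split_indicator intro!: mult_left_mono add_mono)
  qed
  also have "\<dots> = (\<integral>\<^sup>+t. ennreal K * ((1 + ennreal S) * indicator {a..b} t +
      (\<integral>\<^sup>+x. ennreal ((norm (v t x))\<^sup>2) \<partial>\<rho> t) * indicator {a..b} t) \<partial>lborel)"
    by (rule nn_integral_cong) (auto split: split_indicator)
  also have "\<dots> = ennreal K * ((1 + ennreal S) * emeasure lborel {a..b} +
      (\<integral>\<^sup>+t\<in>{a..b}. (\<integral>\<^sup>+x. ennreal ((norm (v t x))\<^sup>2) \<partial>\<rho> t) \<partial>lborel))"
    by (simp add: nn_integral_cmult nn_integral_add)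
  also have "\<dots> < \<infinity>"
    using kinetic_energy'[OF ab(2,1)] by (auto simp: emeasure_lborel_Icc_eq ennreal_mult_less_top ennreal_add_eq_top less_top[symmetric] ennreal_mult_eq_top_iff)
  finally show ?thesis .
qed

text \<open>The integrated continuity equation for a test function that does not depend on time.
  \<open>G\<close> stands for the gradient of \<open>\<phi>\<close> but is kept as separate data, so
  that the property survives limits in which differentiability is lost.\<close>

definition has_increments :: "('a \<Rightarrow> real) \<Rightarrow> ('a \<Rightarrow> 'a) \<Rightarrow> bool" where
  "has_increments \<phi> G \<longleftrightarrow> (\<forall>a b. 0 \<le> a \<longrightarrow> a \<le> b \<longrightarrow> b < 1 \<longrightarrow>
     (LINT x|\<rho> b. \<phi> x) - (LINT x|\<rho> a. \<phi> x) = (LINT t:{a..b}|lborel. LINT x|\<rho> t. G x \<bullet> v t x))"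

lemma has_increments_smooth:
  fixes \<phi> :: "'a \<Rightarrow> real"
  assumes smooth: "\<And>k. Ck k \<phi>" and supp: "\<And>x. norm x \<ge> N \<Longrightarrow> \<phi> x = 0"
    and der: "\<And>x. (\<phi> has_derivative (\<lambda>w. G x \<bullet> w)) (at x)"
  shows "has_increments \<phi> G"
proof -
  have fr: "frechet_derivative \<phi> (at x) w = G x \<bullet> w" for x w
    using frechet_derivative_at[OF der[of x]] by (metis)
  have contG: "continuous_on UNIV G"
  proof -
    have "continuous_on UNIV (\<lambda>x. G x \<bullet> w)" for w
      using smooth[of "Suc 0"] by (simp add: fr)
    then have "continuous_on UNIV (\<lambda>x. \<Sum>b\<in>Basis. (G x \<bullet> b) *\<^sub>R b)"
      by (intro continuous_on_sum continuous_on_scaleR continuous_on_const)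
    then show ?thesis by (simp add: euclidean_representation)
  qed
  then have [measurable]: "G \<in> borel_measurable borel" by (rule borel_measurable_continuous_onI)
  have cont: "continuous_on UNIV \<phi>" using smooth[of 0] by simp
  then have [measurable]: "\<phi> \<in> borel_measurable borel" by (rule borel_measurable_continuous_onI)
  have G0: "G x = 0" if "norm x > N" for x
  proof -
    have "(\<phi> has_derivative (\<lambda>w. 0)) (at x)"
    proof (rule has_derivative_transform_within_open[of "\<lambda>_. 0"])
      show "open {x::'a. norm x > N}" by (intro open_Collect_less continuous_intros)
    qed (use that supp in auto)
    then have "(\<lambda>w. G x \<bullet> w) = (\<lambda>w. 0)" by (rule has_derivative_unique[OF der])
    then show ?thesis by (metis inner_eq_zero_iff)
  qed
  obtain C where C: "\<And>x. norm (G x) \<le> C"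
  proof -
    have "bounded (G ` cball 0 N)"
      by (intro compact_imp_bounded compact_continuous_image continuous_on_subset[OF contG]) auto
    then obtain B where "\<forall>x\<in>cball 0 N. norm (G x) \<le> B" by (auto simp: bounded_iff)
    then have B: "\<And>x. norm x \<le> N \<Longrightarrow> norm (G x) \<le> B" by simp
    show ?thesis
    proof (rule that[of "max B 0"])
      fix x show "norm (G x) \<le> max B 0" using B[of x] G0[of x] by (cases "norm x \<le> N") auto
    qed
  qed
  have C0: "C \<ge> 0" using C[of 0] norm_ge_zero order_trans by blast
  obtain B where B: "\<And>x. \<bar>\<phi> x\<bar> \<le> B" and bd: "bounded (range \<phi>)"
  proof -
    have "bounded (\<phi> ` cball 0 N)"
      by (intro compact_imp_bounded compact_continuous_image continuous_on_subset[OF cont]) auto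
    then obtain B where "\<forall>x\<in>cball 0 N. \<bar>\<phi> x\<bar> \<le> B" by (auto simp: bounded_iff)
    then have B: "\<And>x. norm x \<le> N \<Longrightarrow> \<bar>\<phi> x\<bar> \<le> B" by simp
    have *: "\<bar>\<phi> x\<bar> \<le> max B 0" for x using B[of x] supp[of x] by (cases "norm x \<le> N") auto
    show ?thesis by (rule that[of "max B 0"]) (use * in \<open>auto intro!: boundedI[of _ "max B 0"]\<close>)
  qed
  define m where "m t = (LINT x|\<rho> t. \<phi> x)" for t
  define q where "q t = (LINT x|\<rho> t. G x \<bullet> v t x)" for t
  have m: "continuous_on {0..<1} m"
    using narrow cont bd unfolding narrowly_continuous_on_def m_def by blast
  have [measurable]: "m \<in> borel_measurable borel" "q \<in> borel_measurable borel"
    unfolding m_def[abs_def] q_def[abs_def]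
    by (rule integral_measurable_kernel[OF kernel]; simp)+
  have bnd: "\<bar>G x \<bullet> v t x\<bar> \<le> C * (1 + 0 + (norm (v t x))\<^sup>2)" for t x
  proof -
    have "\<bar>G x \<bullet> v t x\<bar> \<le> norm (G x) * norm (v t x)" by (rule Cauchy_Schwarz_ineq2)
    also have "\<dots> \<le> C * (1 + 0 + (norm (v t x))\<^sup>2)"
    proof (intro mult_mono C C0)
      have "0 \<le> (norm (v t x) - 1)\<^sup>2" by simp
      then have "2 * norm (v t x) \<le> 1 + (norm (v t x))\<^sup>2" by (simp add: power2_diff)
      then show "norm (v t x) \<le> 1 + 0 + (norm (v t x))\<^sup>2" using norm_ge_zero[of "v t x"] by linarith
    qed auto
    finally show ?thesis .
  qed
  have fin: "(\<integral>\<^sup>+t\<in>{a..b}. (\<integral>\<^sup>+x. ennreal (C * (1 + 0 + (norm (v t x))\<^sup>2)) \<partial>\<rho> t) \<partial>lborel) < \<infinity>"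
    if "0 \<le> a" "b < 1" for a b
    by (rule affine_energy_finite[where h = "\<lambda>_ _. 0" and S = 0]) (use that C0 in auto)
  have qi: "set_integrable lborel {a..b} q" if "0 \<le> a" "b < 1" for a b
    unfolding q_def
    by (rule kernel_dominated_integrable[OF kernel_lborel _ _ fin[OF that]])
      (use bnd in \<open>simp_all add: measurable_prod_borel\<close>)
  have pos: "m b - m a = (LINT t:{a..b}|lborel. q t)" if ab: "0 < a" "a < b" "b < 1" for a b
  proof (rule weak_derivative_increment)
    show "continuous_on {a..b} m" using ab by (intro continuous_on_subset[OF m]) auto
    show "set_integrable lborel {a..b} q" using ab by (intro qi) auto
    fix n
    have "(LINT t:{0<..<1}|lborel. time_cutoff' a b n t * m t + time_cutoff a b n t * q t) =
        (LINT t:{0<..<1}|lborel. LINT x|\<rho> t.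
           frechet_derivative (\<lambda>z. time_cutoff a b n (fst z) * \<phi> (snd z)) (at (t, x)) (1, 0) +
           frechet_derivative (\<lambda>z. time_cutoff a b n (fst z) * \<phi> (snd z)) (at (t, x)) (0, v t x))"
    proof (rule set_lebesgue_integral_cong_AE)
      have e: "frechet_derivative (\<lambda>z. time_cutoff a b n (fst z) * \<phi> (snd z)) (at (t, x)) (1, 0) +
          frechet_derivative (\<lambda>z. time_cutoff a b n (fst z) * \<phi> (snd z)) (at (t, x)) (0, v t x) =
          time_cutoff' a b n t * \<phi> x + time_cutoff a b n t * (G x \<bullet> v t x)" for t x
        by (simp add: frechet_derivative_test_product[OF der])
      show "(\<lambda>t. LINT x|\<rho> t.
           frechet_derivative (\<lambda>z. time_cutoff a b n (fst z) * \<phi> (snd z)) (at (t, x)) (1, 0) +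
           frechet_derivative (\<lambda>z. time_cutoff a b n (fst z) * \<phi> (snd z)) (at (t, x)) (0, v t x))
           \<in> borel_measurable lborel"
        unfolding e by (rule integral_measurable_kernel[OF kernel_lborel]) (simp add: measurable_prod_borel)
      \<comment> \<open>The velocity is known to be integrable for almost every \<open>t\<close>
        only, and there the inner integral of the sum can be split.\<close>
      have "AE t in lborel. t \<in> {0..b} \<longrightarrow> (\<integral>\<^sup>+x. ennreal (C * (1 + 0 + (norm (v t x))\<^sup>2)) \<partial>\<rho> t) < \<infinity>"
        by (rule AE_kernel_finite[OF kernel_lborel _ _ fin]) (use ab in \<open>auto simp: measurable_prod_borel\<close>)
      then show "AE t\<in>{0<..<1} in lborel. time_cutoff' a b n t * m t + time_cutoff a b n t * q t =
        (LINT x|\<rho> t.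
           frechet_derivative (\<lambda>z. time_cutoff a b n (fst z) * \<phi> (snd z)) (at (t, x)) (1, 0) +
           frechet_derivative (\<lambda>z. time_cutoff a b n (fst z) * \<phi> (snd z)) (at (t, x)) (0, v t x))"
      proof eventually_elim
        case (elim t)
        show ?case
        proof (cases "t \<in> {a<..<b}")
          case True
          interpret prob_space "\<rho> t" by (rule prob_rho)
          have 1: "integrable (\<rho> t) \<phi>" using B by (intro integrable_const_bound[of _ B]) auto
          have "(\<integral>\<^sup>+x. ennreal (norm (G x \<bullet> v t x)) \<partial>\<rho> t) \<le> (\<integral>\<^sup>+x. ennreal (C * (1 + 0 + (norm (v t x))\<^sup>2)) \<partial>\<rho> t)"
            using bnd by (intro nn_integral_mono ennreal_leI) simp
          also have "\<dots> < \<infinity>" using elim True ab by auto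
          finally have 2: "integrable (\<rho> t) (\<lambda>x. G x \<bullet> v t x)" by (simp add: integrable_iff_bounded)
          show ?thesis unfolding e m_def q_def using 1 2 by simp
        qed (simp add: e time_cutoff_eq_0)
      qed
    qed measurable
    also have "\<dots> = 0"
      using weak_equation test_functions_product[OF smooth supp] ab unfolding weak_continuity_equation_def by blast
    finally show "(LINT t:{0<..<1}|lborel. time_cutoff' a b n t * m t + time_cutoff a b n t * q t) = 0" .
  qed (use ab in auto)
  show ?thesis
    unfolding has_increments_def m_def[symmetric] q_def[symmetric]
  proof (intro allI impI)
    fix a b :: real assume ab: "0 \<le> a" "a \<le> b" "b < 1"
    consider "a = b" | "0 < a" "a < b" | "a = 0" "0 < b" using ab by linarith
    then show "m b - m a = (LINT t:{a..b}|lborel. q t)"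
    proof cases
      case 1
      have "(LINT t:{b}|lborel. q t) = 0"
        unfolding set_lebesgue_integral_def
        by (rule integral_eq_zero_AE) (use AE_lborel_singleton[of b] in eventually_elim, auto)
      with 1 show ?thesis by simp
    next
      case 2
      then show ?thesis using pos ab by simp
    next
      case 3
      \<comment> \<open>Time 0 is outside the reach of the test functions and is approached from the
        right; shifting the index by two keeps \<open>s n\<close> strictly below
        \<open>b\<close>.\<close>
      define s where "s n = b / real (Suc (Suc n))" for n
      have s: "0 < s n" "s n < b" for n using 3 by (auto simp: s_def field_simps add_pos_nonneg)
      have s0: "s \<longlonglongrightarrow> 0"
        unfolding s_def by (rule LIMSEQ_Suc[OF divide_Suc_tendsto_0])
      have "(\<lambda>n. m (s n)) \<longlonglongrightarrow> m 0"
      proof (rule continuous_on_tendsto_compose[OF m s0])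
        have "s n \<in> {0..<1}" for n using s[of n] ab by auto
        then show "\<forall>\<^sub>F n in sequentially. s n \<in> {0..<1}" by simp
      qed simp
      then have L: "(\<lambda>n. m b - m (s n)) \<longlonglongrightarrow> m b - m 0" by (intro tendsto_intros)
      have "(\<lambda>n. LINT t|lborel. indicat_real {s n..b} t *\<^sub>R q t) \<longlonglongrightarrow> (LINT t|lborel. indicat_real {0..b} t *\<^sub>R q t)"
      proof (rule integral_dominated_convergence)
        show "integrable lborel (\<lambda>t. norm (indicat_real {0..b} t *\<^sub>R q t))"
          using qi[of 0 b] ab by (intro integrable_norm) (simp add: set_integrable_def)
        show "AE t in lborel. norm (indicat_real {s n..b} t *\<^sub>R q t) \<le> norm (indicat_real {0..b} t *\<^sub>R q t)" for n
          using s[of n] by (auto split: split_indicator)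
        show "AE t in lborel. (\<lambda>n. indicat_real {s n..b} t *\<^sub>R q t) \<longlonglongrightarrow> indicat_real {0..b} t *\<^sub>R q t"
          using AE_lborel_singleton[of 0]
        proof eventually_elim
          case (elim t)
          show ?case
          proof (cases "t > 0")
            case True
            have "eventually (\<lambda>n. s n < t) sequentially" using order_tendstoD(2)[OF s0 True] .
            then have "eventually (\<lambda>n. indicat_real {0..b} t *\<^sub>R q t = indicat_real {s n..b} t *\<^sub>R q t) sequentially"
              by eventually_elim (use True in \<open>auto split: split_indicator\<close>)
            then show ?thesis by (rule Lim_transform_eventually[OF tendsto_const])
          next
            case False
            with elim have "t < 0" by simp
            then have "t \<notin> {s n..b}" for n using s(1)[of n] by simp
            with \<open>t < 0\<close> show ?thesis by simp
          qed
        qed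
      qed measurable
      moreover have "(LINT t|lborel. indicat_real {s n..b} t *\<^sub>R q t) = m b - m (s n)" for n
        using pos[of "s n" b] s[of n] ab by (simp add: set_lebesgue_integral_def)
      ultimately have "(\<lambda>n. m b - m (s n)) \<longlonglongrightarrow> (LINT t:{0..b}|lborel. q t)"
        by (simp add: set_lebesgue_integral_def)
      from LIMSEQ_unique[OF L this] 3 show ?thesis by simp
    qed
  qed
qed

end

section \<open>Second moments, bounded locally uniformly in time\<close>

lemma two_mult_le_squares: "2 * (a * b) \<le> a\<^sup>2 + b\<^sup>2" for a b :: real
  using sum_squares_bound[of a b] by simp

lemma one_plus_mult_le:
  "(1 + c) * d \<le> 1 + c\<^sup>2 + d\<^sup>2" "(1 + c) * c \<le> 2 * (1 + c\<^sup>2)" for c d :: real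
proof -
  have "2 * (1 * d) \<le> 1\<^sup>2 + d\<^sup>2" "2 * (1 * c) \<le> 1\<^sup>2 + c\<^sup>2" "2 * (c * d) \<le> c\<^sup>2 + d\<^sup>2" "0 \<le> c\<^sup>2" "0 \<le> d\<^sup>2"
    by (intro two_mult_le_squares zero_le_power2)+
  note le = this[unfolded power_one mult_1]
  have "d + c * d \<le> 1 + c\<^sup>2 + d\<^sup>2" using le by linarith
  moreover have "c + c\<^sup>2 \<le> 2 * (1 + c\<^sup>2)" using le by (smt (verit))
  ultimately show "(1 + c) * d \<le> 1 + c\<^sup>2 + d\<^sup>2" "(1 + c) * c \<le> 2 * (1 + c\<^sup>2)"
    by (simp_all add: distrib_right power2_eq_square)
qed

lemma abs_inner_unit_le: "norm \<theta> = 1 \<Longrightarrow> \<bar>\<theta> \<bullet> x\<bar> \<le> norm x"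
  using Cauchy_Schwarz_ineq2[of \<theta> x] by simp

context continuity_equation
begin

text \<open>A flow is only assumed to have a finite second moment at each single time. Testing with
  the squared norm times a squared cut-off gives a rate that is at most the tested quantity itself
  plus kinetic energy; the supremum over [0, b] then satisfies an inequality that can be solved
  because \<open>b\<close> is below 1.\<close>

lemma second_moment_bounded:
  assumes b: "0 \<le> b" "b < 1"
  obtains S where "S \<ge> 0" "\<And>t. t \<in> {0..b} \<Longrightarrow> (\<integral>\<^sup>+x. ennreal ((norm x)\<^sup>2) \<partial>\<rho> t) \<le> ennreal S"
proof -
  obtain C where C: "C > 0" "\<And>N (x::'a) w. N > 0 \<Longrightarrow> norm x * \<bar>space_cutoff' N x w\<bar> \<le> C * norm w"
    using space_cutoff'_bound by metis
  define E where "E t = (LINT x|\<rho> t. (1 + C)\<^sup>2 * (norm (v t x))\<^sup>2)" for t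
  have fin: "(\<integral>\<^sup>+t\<in>{0..b}. (\<integral>\<^sup>+x. ennreal (K * (1 + 0 + (norm (v t x))\<^sup>2)) \<partial>\<rho> t) \<partial>lborel) < \<infinity>"
    if "K \<ge> 0" for K
    by (rule affine_energy_finite[where h = "\<lambda>_ _. 0" and S = 0]) (use that b in auto)
  have Ei: "set_integrable lborel {0..b} E"
    unfolding E_def
    by (rule kernel_dominated_integrable[OF kernel_lborel _ _ fin[of "(1 + C)\<^sup>2"]])
      (auto simp: measurable_prod_borel algebra_simps)
  have E0: "E t \<ge> 0" for t unfolding E_def by (rule Bochner_Integration.integral_nonneg) simp
  define E1 where "E1 = (LINT t:{0..b}|lborel. E t)"
  have E1: "E1 \<ge> 0" unfolding E1_def set_lebesgue_integral_def using E0 by (intro Bochner_Integration.integral_nonneg) auto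
  define M0 where "M0 = (LINT x|\<rho> 0. (norm x)\<^sup>2)"
  have M0: "M0 \<ge> 0" unfolding M0_def by (rule Bochner_Integration.integral_nonneg) simp
  \<comment> \<open>The solution of \<open>Z = M0 + E1 + b * Z\<close>; it does not depend on the
    radius of the cut-off.\<close>
  define S where "S = (M0 + E1) / (1 - b)"
  have Sge: "S \<ge> 0" using M0 E1 b by (simp add: S_def)
  \<comment> \<open>The cut-off is squared so that its gradient keeps one factor of the cut-off,
    which lets Young's inequality return the tested function itself.\<close>
  define \<phi> where "\<phi> N x = (x \<bullet> x) * (space_cutoff N x * space_cutoff N x)" for N and x :: 'a
  have [measurable]: "\<phi> N \<in> borel_measurable borel" for N
  proof -
    have "Ck 0 (\<phi> N)" unfolding \<phi>_def[abs_def] by (intro Ck_mult Ck_inner_self Ck_space_cutoff)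
    then show ?thesis by (intro borel_measurable_continuous_onI) simp
  qed
  have \<phi>0: "\<phi> N x \<ge> 0" for N x by (simp add: \<phi>_def)
  have \<phi>le: "\<phi> N x \<le> (norm x)\<^sup>2" for N x
    using space_cutoff_bounds[of N x] by (simp add: \<phi>_def power2_norm_eq_inner mult_left_le mult_le_one)
  have bound: "(LINT x|\<rho> t. \<phi> N x) \<le> S" if t: "t \<in> {0..b}" and N: "N > 0" for t N
  proof -
    have \<phi>N: "\<bar>\<phi> N x\<bar> \<le> N\<^sup>2" for x
    proof (cases "norm x \<ge> N")
      case True
      then show ?thesis using N by (simp add: \<phi>_def space_cutoff_eq_0)
    next
      case False
      then have "(norm x)\<^sup>2 \<le> N\<^sup>2" by (intro power_mono) auto
      then show ?thesis using \<phi>le[of N x] \<phi>0[of N x] by simp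
    qed
    have i\<phi>: "integrable (\<rho> t) (\<phi> N)" for t
    proof -
      interpret prob_space "\<rho> t" by (rule prob_rho)
      show ?thesis using \<phi>N by (intro integrable_const_bound[of _ "N\<^sup>2"]) auto
    qed
    define g where "g x = (- 2 * exp 1 / N\<^sup>2 * sexp 2 (1 - (x \<bullet> x) / N\<^sup>2)) *\<^sub>R x" for x :: 'a
    have g: "space_cutoff' N x w = g x \<bullet> w" for x w by (simp add: space_cutoff'_def g_def)
    define G where "G x = (2 * (space_cutoff N x * space_cutoff N x)) *\<^sub>R x
      + (2 * (x \<bullet> x) * space_cutoff N x) *\<^sub>R g x" for x :: 'a
    have inc: "has_increments (\<phi> N) G"
    proof (rule has_increments_smooth)
      show "Ck k (\<phi> N)" for k unfolding \<phi>_def[abs_def] by (intro Ck_mult Ck_inner_self Ck_space_cutoff)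
      show "\<phi> N x = 0" if "norm x \<ge> N" for x using that N by (simp add: \<phi>_def space_cutoff_eq_0)
      show "(\<phi> N has_derivative (\<lambda>w. G x \<bullet> w)) (at x)" for x
      proof -
        have d: "((\<lambda>x::'a. x \<bullet> x) has_derivative (\<lambda>w. x \<bullet> w + w \<bullet> x)) (at x)"
          by (auto intro!: derivative_eq_intros)
        have e: "(\<lambda>w. G x \<bullet> w) = (\<lambda>w. x \<bullet> x * (space_cutoff N x * space_cutoff' N x w + space_cutoff' N x w * space_cutoff N x) +
               (x \<bullet> w + w \<bullet> x) * (space_cutoff N x * space_cutoff N x))"
        proof
          fix w
          have "w \<bullet> x = x \<bullet> w" by (rule inner_commute)
          then show "G x \<bullet> w = x \<bullet> x * (space_cutoff N x * space_cutoff' N x w + space_cutoff' N x w * space_cutoff N x) +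
               (x \<bullet> w + w \<bullet> x) * (space_cutoff N x * space_cutoff N x)"
            by (simp add: G_def g inner_add_left algebra_simps)
        qed
        show ?thesis
          unfolding \<phi>_def[abs_def] e
          by (rule has_derivative_mult[OF d has_derivative_mult[OF space_cutoff_has_derivative space_cutoff_has_derivative]])
      qed
    qed
    have [measurable]: "G \<in> borel_measurable borel" unfolding G_def[abs_def] g_def[abs_def] space_cutoff_def by measurable
    \<comment> \<open>Both terms of the gradient carry the factor
      \<open>space_cutoff N x * norm x\<close>, whose square is \<open>\<phi> N x\<close>; the
      remaining factors add up to at most \<open>2 * ((1 + C) * norm w)\<close>.\<close>
    have Gv: "G x \<bullet> w \<le> \<phi> N x + (1 + C)\<^sup>2 * (norm w)\<^sup>2" for x w
    proof -
      let ?p = "space_cutoff N x * norm x"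
      have "G x \<bullet> w = 2 * ((space_cutoff N x) * (space_cutoff N x)) * (x \<bullet> w) + 2 * ((x \<bullet> x) * space_cutoff N x) * space_cutoff' N x w"
        by (simp add: G_def g inner_add_left)
      also have "\<dots> \<le> 2 * (?p * norm w) + 2 * (?p * (C * norm w))"
      proof (rule add_mono)
        have "space_cutoff N x * space_cutoff N x * (x \<bullet> w) \<le> space_cutoff N x * 1 * (norm x * norm w)"
        proof -
          have "space_cutoff N x * space_cutoff N x * (x \<bullet> w) \<le> space_cutoff N x * space_cutoff N x * (norm x * norm w)"
            by (intro mult_left_mono norm_cauchy_schwarz) simp
          also have "\<dots> \<le> space_cutoff N x * 1 * (norm x * norm w)"
            by (intro mult_right_mono mult_left_mono space_cutoff_bounds) auto
          finally show ?thesis .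
        qed
        then show "2 * ((space_cutoff N x) * (space_cutoff N x)) * (x \<bullet> w) \<le> 2 * (?p * norm w)" by (simp add: mult.assoc)
        have "norm x * space_cutoff' N x w \<le> C * norm w"
          using C(2)[OF N, of x w] abs_ge_self[of "space_cutoff' N x w"] mult_left_mono[OF abs_ge_self norm_ge_zero, of x "space_cutoff' N x w"]
          by linarith
        then have "?p * (norm x * space_cutoff' N x w) \<le> ?p * (C * norm w)"
          using space_cutoff_bounds(1)[of N x] by (intro mult_left_mono) auto
        then show "2 * ((x \<bullet> x) * space_cutoff N x) * space_cutoff' N x w \<le> 2 * (?p * (C * norm w))"
          by (simp add: power2_norm_eq_inner[symmetric] power2_eq_square mult_ac)
      qed
      also have "\<dots> = 2 * (?p * ((1 + C) * norm w))" by (simp add: algebra_simps)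
      also have "\<dots> \<le> ?p\<^sup>2 + ((1 + C) * norm w)\<^sup>2" by (rule two_mult_le_squares)
      also have "?p\<^sup>2 = \<phi> N x" by (simp add: \<phi>_def power2_norm_eq_inner[symmetric] power2_eq_square)
      finally show ?thesis by (simp add: power_mult_distrib)
    qed
    define m where "m t = (LINT x|\<rho> t. \<phi> N x)" for t
    have m0: "m t \<ge> 0" "m t \<le> N\<^sup>2" for t
    proof -
      interpret prob_space "\<rho> t" by (rule prob_rho)
      show "m t \<ge> 0" unfolding m_def using \<phi>0 by (intro Bochner_Integration.integral_nonneg) auto
      show "m t \<le> N\<^sup>2" unfolding m_def using \<phi>N abs_le_D1 by (intro integral_le_const[OF i\<phi>]) auto
    qed
    have [measurable]: "m \<in> borel_measurable borel"
      unfolding m_def by (rule integral_measurable_kernel[OF kernel]) simp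
    define Z where "Z = (SUP t\<in>{0..b}. m t)"
    \<comment> \<open>The crude bound by the squared radius ensures that the supremum is finite;
      otherwise the term \<open>b * Z\<close> could not be absorbed.\<close>
    have bdd: "bdd_above (m ` {0..b})" using m0(2) by (intro bdd_aboveI2) auto
    have Z: "m t \<le> Z" if "t \<in> {0..b}" for t
      unfolding Z_def using that bdd by (rule cSUP_upper)
    have Z0: "Z \<ge> 0" using Z[of 0] m0(1)[of 0] b by auto
    have step: "m t \<le> M0 + E1 + b * Z" if t: "t \<in> {0..b}" for t
    proof -
      have "m t - m 0 = (LINT s:{0..t}|lborel. LINT x|\<rho> s. G x \<bullet> v s x)"
        using inc t b unfolding has_increments_def m_def by auto
      also have "\<dots> \<le> (LINT s:{0..t}|lborel. Z + E s)"
        unfolding set_lebesgue_integral_def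
      proof (rule integral_mono_AE)
        have subset: "set_integrable lborel {0..t} f" if "set_integrable lborel {0..b} f" for f :: "real \<Rightarrow> real"
          by (rule set_integrable_subset[OF that]) (use t in auto)
        have cs: "\<bar>G x \<bullet> v s x\<bar> \<le> (N\<^sup>2 + (1 + C)\<^sup>2) * (1 + 0 + (norm (v s x))\<^sup>2)" for s x
        proof -
          have "\<bar>G x \<bullet> v s x\<bar> \<le> \<phi> N x + (1 + C)\<^sup>2 * (norm (v s x))\<^sup>2"
            using Gv[of x "v s x"] Gv[of x "- v s x"] by (auto simp: abs_if)
          also have "\<dots> \<le> N\<^sup>2 * (1 + 0 + (norm (v s x))\<^sup>2) + (1 + C)\<^sup>2 * (1 + 0 + (norm (v s x))\<^sup>2)"
          proof (rule add_mono)
            have "N\<^sup>2 * 1 \<le> N\<^sup>2 * (1 + 0 + (norm (v s x))\<^sup>2)" by (intro mult_left_mono) auto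
            then show "\<phi> N x \<le> N\<^sup>2 * (1 + 0 + (norm (v s x))\<^sup>2)" using abs_le_D1[OF \<phi>N, of x] by linarith
            show "(1 + C)\<^sup>2 * (norm (v s x))\<^sup>2 \<le> (1 + C)\<^sup>2 * (1 + 0 + (norm (v s x))\<^sup>2)" by (intro mult_left_mono) auto
          qed
          finally show ?thesis by (simp add: distrib_right)
        qed
        note f' = fin[of "N\<^sup>2 + (1 + C)\<^sup>2"]
        have "set_integrable lborel {0..b} (\<lambda>s. LINT x|\<rho> s. G x \<bullet> v s x)"
          by (rule kernel_dominated_integrable[OF kernel_lborel _ _ f'])
            (use cs in \<open>auto simp: measurable_prod_borel\<close>)
        from subset[OF this] show "integrable lborel (\<lambda>s. indicat_real {0..t} s *\<^sub>R (LINT x|\<rho> s. G x \<bullet> v s x))"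
          by (simp add: set_integrable_def)
        have "set_integrable lborel {0..b} (\<lambda>s. Z + E s)"
          by (intro set_integral_add Ei) (simp add: set_integrable_def emeasure_lborel_Icc_eq)
        from subset[OF this] show "integrable lborel (\<lambda>s. indicat_real {0..t} s *\<^sub>R (Z + E s))"
          by (simp add: set_integrable_def)
        have "AE s in lborel. s \<in> {0..b} \<longrightarrow> (\<integral>\<^sup>+x. ennreal ((N\<^sup>2 + (1 + C)\<^sup>2) * (1 + 0 + (norm (v s x))\<^sup>2)) \<partial>\<rho> s) < \<infinity>"
          by (rule AE_kernel_finite[OF kernel_lborel _ _ f']) (auto simp: measurable_prod_borel)
        then show "AE s in lborel. indicat_real {0..t} s *\<^sub>R (LINT x|\<rho> s. G x \<bullet> v s x) \<le> indicat_real {0..t} s *\<^sub>R (Z + E s)"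
        proof eventually_elim
          case (elim s)
          show ?case
          proof (cases "s \<in> {0..t}")
            case True
            then have sb: "s \<in> {0..b}" using t by auto
            interpret prob_space "\<rho> s" by (rule prob_rho)
            have fs: "(\<integral>\<^sup>+x. ennreal ((N\<^sup>2 + (1 + C)\<^sup>2) * (1 + 0 + (norm (v s x))\<^sup>2)) \<partial>\<rho> s) < \<infinity>" using elim sb by blast
            have dom: "integrable (\<rho> s) f" if [measurable]: "f \<in> borel_measurable borel"
              and "\<And>x. \<bar>f x\<bar> \<le> (N\<^sup>2 + (1 + C)\<^sup>2) * (1 + 0 + (norm (v s x))\<^sup>2)" for f
            proof -
              have "(\<integral>\<^sup>+x. ennreal (norm (f x)) \<partial>\<rho> s) \<le>
                  (\<integral>\<^sup>+x. ennreal ((N\<^sup>2 + (1 + C)\<^sup>2) * (1 + 0 + (norm (v s x))\<^sup>2)) \<partial>\<rho> s)"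
                by (intro nn_integral_mono ennreal_leI) (use that in simp)
              from le_less_trans[OF this fs] show ?thesis by (simp add: integrable_iff_bounded)
            qed
            have i1: "integrable (\<rho> s) (\<lambda>x. G x \<bullet> v s x)" using cs by (intro dom) auto
            have i2: "integrable (\<rho> s) (\<lambda>x. (1 + C)\<^sup>2 * (norm (v s x))\<^sup>2)"
              by (intro dom) (auto simp: algebra_simps)
            have "(LINT x|\<rho> s. G x \<bullet> v s x) \<le> (LINT x|\<rho> s. \<phi> N x + (1 + C)\<^sup>2 * (norm (v s x))\<^sup>2)"
              by (intro integral_mono i1 Bochner_Integration.integrable_add i\<phi> i2 Gv)
            also have "\<dots> = m s + E s" using i\<phi> i2 by (simp add: m_def E_def)
            also have "\<dots> \<le> Z + E s" using Z[OF sb] by simp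
            finally show ?thesis using True by simp
          qed simp
        qed
      qed
      also have "\<dots> \<le> (LINT s:{0..b}|lborel. Z + E s)"
        unfolding set_lebesgue_integral_def
      proof (rule integral_mono)
        have i: "set_integrable lborel {0..b} (\<lambda>s. Z + E s)"
          by (intro set_integral_add Ei) (simp add: set_integrable_def emeasure_lborel_Icc_eq)
        show "integrable lborel (\<lambda>s. indicat_real {0..b} s *\<^sub>R (Z + E s))" using i by (simp add: set_integrable_def)
        show "integrable lborel (\<lambda>s. indicat_real {0..t} s *\<^sub>R (Z + E s))"
          using set_integrable_subset[OF i, of "{0..t}"] t by (simp add: set_integrable_def)
      qed (use t Z0 E0 in \<open>auto split: split_indicator\<close>)
      also have "\<dots> = b * Z + E1"
        using Ei b unfolding E1_def by (subst set_integral_add) (auto simp: set_integrable_def emeasure_lborel_Icc_eq set_lebesgue_integral_def)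
      finally have "m t \<le> m 0 + b * Z + E1" by simp
      moreover have "m 0 \<le> M0"
        unfolding m_def M0_def using \<phi>le square_integrable_rho[of 0] by (intro integral_mono i\<phi>) auto
      ultimately show ?thesis by linarith
    qed
    have "Z \<le> M0 + E1 + b * Z" unfolding Z_def
      using b step[unfolded Z_def] by (intro cSUP_least) auto
    then have "Z * (1 - b) \<le> M0 + E1" by (simp add: algebra_simps)
    then have "Z \<le> S" using b by (simp add: S_def pos_le_divide_eq)
    then show ?thesis using Z[OF t] by (simp add: m_def)
  qed
  show ?thesis
  proof (rule that[OF Sge])
    fix t assume t: "t \<in> {0..b}"
    have lim: "(\<lambda>n. \<phi> (real (Suc n)) x) \<longlonglongrightarrow> (norm x)\<^sup>2" for x
    proof -
      have "(\<lambda>n. \<phi> (real (Suc n)) x) \<longlonglongrightarrow> (x \<bullet> x) * (1 * 1)"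
        unfolding \<phi>_def by (intro tendsto_intros space_cutoff_tendsto)
      then show ?thesis by (simp add: power2_norm_eq_inner)
    qed
    have "(\<integral>\<^sup>+x. ennreal ((norm x)\<^sup>2) \<partial>\<rho> t) = (\<integral>\<^sup>+x. liminf (\<lambda>n. ennreal (\<phi> (real (Suc n)) x)) \<partial>\<rho> t)"
      by (intro nn_integral_cong lim_imp_Liminf[symmetric] tendsto_ennrealI lim) simp
    also have "\<dots> \<le> liminf (\<lambda>n. \<integral>\<^sup>+x. ennreal (\<phi> (real (Suc n)) x) \<partial>\<rho> t)"
      by (rule nn_integral_liminf) simp
    also have "\<dots> \<le> liminf (\<lambda>n. ennreal S)"
    proof (intro Liminf_mono always_eventually allI)
      fix n
      have "integrable (\<rho> t) (\<phi> (real (Suc n)))"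
        by (rule Bochner_Integration.integrable_bound[OF square_integrable_rho[of t]])
          (use t b \<phi>le \<phi>0 in \<open>auto simp: abs_of_nonneg\<close>)
      then have "(\<integral>\<^sup>+x. ennreal (\<phi> (real (Suc n)) x) \<partial>\<rho> t) = ennreal (LINT x|\<rho> t. \<phi> (real (Suc n)) x)"
        using \<phi>0 by (intro nn_integral_eq_integral) auto
      also have "\<dots> \<le> ennreal S" by (intro ennreal_leI bound t) simp
      finally show "(\<integral>\<^sup>+x. ennreal (\<phi> (real (Suc n)) x) \<partial>\<rho> t) \<le> ennreal S" .
    qed
    also have "\<dots> = ennreal S" by (simp add: Liminf_const)
    finally show "(\<integral>\<^sup>+x. ennreal ((norm x)\<^sup>2) \<partial>\<rho> t) \<le> ennreal S" .
  qed
qed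

lemma quadratic_energy_finite:
  assumes "0 \<le> a" "b < 1" "K \<ge> 0"
  shows "(\<integral>\<^sup>+t\<in>{a..b}. (\<integral>\<^sup>+x. ennreal (K * (1 + (norm x)\<^sup>2 + (norm (v t x))\<^sup>2)) \<partial>\<rho> t) \<partial>lborel) < \<infinity>"
proof (cases "a \<le> b")
  case True
  then obtain S where "\<And>t. t \<in> {0..b} \<Longrightarrow> (\<integral>\<^sup>+x. ennreal ((norm x)\<^sup>2) \<partial>\<rho> t) \<le> ennreal S"
    using second_moment_bounded[of b] assms by auto
  then show ?thesis using assms by (intro affine_energy_finite[where h = "\<lambda>_ x. (norm x)\<^sup>2" and S = S]) auto
qed simp

end

text \<open>The oriented integral from 0 to \<open>x\<close>, negative \<open>x\<close> included.
  Signed indicators keep it a single Lebesgue integral, convenient for dominated convergence and for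
  measurability in \<open>x\<close>.\<close>

definition primitive :: "(real \<Rightarrow> real) \<Rightarrow> real \<Rightarrow> real" where
  "primitive f x = (LINT y|lborel. (indicator {0<..x} y - indicator {x<..0} y) * f y)"

definition linear_growth :: "real \<Rightarrow> (real \<Rightarrow> real) \<Rightarrow> bool" where
  "linear_growth K f \<longleftrightarrow> f \<in> borel_measurable borel \<and> (\<forall>y. \<bar>f y\<bar> \<le> K * (1 + \<bar>y\<bar>))"

lemma linear_growth_nonneg: "linear_growth K f \<Longrightarrow> K \<ge> 0"
  unfolding linear_growth_def by (metis abs_ge_zero abs_zero add.right_neutral mult.right_neutral order_trans)

lemma linear_growth_measurable: "linear_growth K f \<Longrightarrow> f \<in> borel_measurable borel"
  by (simp add: linear_growth_def)

lemma linear_growth_integrable: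
  assumes f: "linear_growth K f"
  shows "integrable lborel (\<lambda>y. indicator {x<..z} y * f y)"
proof (rule Bochner_Integration.integrable_bound)
  show "integrable lborel (\<lambda>y. K * (1 + \<bar>x\<bar> + \<bar>z\<bar>) * indicator {x<..z} y)"
    by (intro integrable_mult_right, rule integrable_real_indicator) (cases "x \<le> z"; simp)+
  note [measurable] = linear_growth_measurable[OF f]
  show "(\<lambda>y. indicator {x<..z} y * f y) \<in> borel_measurable lborel" by measurable
  have "\<bar>f y\<bar> \<le> K * (1 + \<bar>x\<bar> + \<bar>z\<bar>)" if "x < y" "y \<le> z" for y
  proof -
    have "\<bar>f y\<bar> \<le> K * (1 + \<bar>y\<bar>)" using f by (simp add: linear_growth_def)
    also have "\<dots> \<le> K * (1 + \<bar>x\<bar> + \<bar>z\<bar>)" using that linear_growth_nonneg[OF f] by (intro mult_left_mono) auto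
    finally show ?thesis .
  qed
  then show "AE y in lborel. norm (indicator {x<..z} y * f y) \<le> norm (K * (1 + \<bar>x\<bar> + \<bar>z\<bar>) * indicator {x<..z} y)"
    using linear_growth_nonneg[OF f] by (auto split: split_indicator)
qed

lemma primitive_0 [simp]: "primitive f 0 = 0"
  by (simp add: primitive_def)

lemma primitive_diff:
  assumes f: "linear_growth K f" and xz: "x \<le> z"
  shows "primitive f z - primitive f x = (LINT y|lborel. indicator {x<..z} y * f y)"
proof -
  note i = linear_growth_integrable[OF f]
  have "primitive f z - primitive f x = (LINT y|lborel. (indicator {0<..z} y * f y - indicator {z<..0} y * f y)
      - (indicator {0<..x} y * f y - indicator {x<..0} y * f y))"
    unfolding primitive_def left_diff_distrib
    by (subst Bochner_Integration.integral_diff[symmetric]) (intro Bochner_Integration.integrable_diff i refl)+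
  also have "\<dots> = (LINT y|lborel. indicator {x<..z} y * f y)"
    using xz by (intro Bochner_Integration.integral_cong) (auto split: split_indicator)
  finally show ?thesis .
qed

lemma primitive_bound:
  assumes f: "linear_growth K f"
  shows "\<bar>primitive f x\<bar> \<le> K * (1 + \<bar>x\<bar>) * \<bar>x\<bar>"
proof -
  note K = linear_growth_nonneg[OF f]
  note [measurable] = linear_growth_measurable[OF f]
  have le: "\<bar>(indicator {0<..x} y - indicator {x<..0} y) * f y\<bar> \<le>
      K * (1 + \<bar>x\<bar>) * (indicator {0<..x} y + indicator {x<..0} y)" for y
  proof -
    have "\<bar>f y\<bar> \<le> K * (1 + \<bar>y\<bar>)" using f by (simp add: linear_growth_def)
    moreover have "K * (1 + \<bar>y\<bar>) \<le> K * (1 + \<bar>x\<bar>)" if "\<bar>y\<bar> \<le> \<bar>x\<bar>"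
      using that K by (intro mult_left_mono) auto
    ultimately show ?thesis by (auto split: split_indicator)
  qed
  have i: "integrable lborel (\<lambda>y. K * (1 + \<bar>x\<bar>) * (indicator {0<..x} y + indicator {x<..0} y))"
    by (intro integrable_mult_right Bochner_Integration.integrable_add; rule integrable_real_indicator)
      (cases "0 \<le> x"; simp)+
  have "norm (primitive f x) \<le> (LINT y|lborel. K * (1 + \<bar>x\<bar>) * (indicator {0<..x} y + indicator {x<..0} y))"
    unfolding primitive_def
    by (rule Bochner_Integration.integral_norm_bound_integral[OF Bochner_Integration.integrable_bound[OF i] i])
      (use le in \<open>auto intro: order_trans[OF _ abs_ge_self]\<close>)
  also have "\<dots> = K * (1 + \<bar>x\<bar>) * \<bar>x\<bar>"
  proof -
    have "integrable lborel (indicat_real {0<..x})" "integrable lborel (indicat_real {x<..0})"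
      by (rule integrable_real_indicator; cases "0 \<le> x"; simp)+
    then show ?thesis by (cases "0 \<le> x") simp_all
  qed
  finally show ?thesis by simp
qed

lemma primitive_has_derivative:
  assumes f: "linear_growth K f" and c: "continuous_on UNIV f"
  shows "(primitive f has_real_derivative f x) (at x)"
proof -
  define M where "M = \<bar>x\<bar> + 1"
  have x: "x \<in> {- M<..<M}" by (auto simp: M_def)
  have c': "continuous_on {- M..M} f" by (rule continuous_on_subset[OF c]) auto
  have eq: "primitive f u = primitive f (- M) + integral {- M..u} f" if u: "u \<in> {- M<..<M}" for u
  proof -
    have "set_integrable lborel {- M..u} f"
      by (rule borel_integrable_atLeastAtMost') (rule continuous_on_subset[OF c], simp)
    then have "integral {- M..u} f = (LINT y:{- M..u}|lborel. f y)"
      by (rule set_borel_integral_eq_integral(2)[symmetric])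
    also have "\<dots> = (LINT y|lborel. indicator {- M<..u} y * f y)"
      unfolding set_lebesgue_integral_def
    proof (rule integral_cong_AE)
      show "AE y in lborel. indicat_real {- M..u} y *\<^sub>R f y = indicat_real {- M<..u} y * f y"
        using AE_lborel_singleton[of "- M"] by eventually_elim (auto split: split_indicator)
    qed (use linear_growth_measurable[OF f] in measurable)
    also have "\<dots> = primitive f u - primitive f (- M)"
      using u by (intro primitive_diff[OF f, symmetric]) auto
    finally show ?thesis by simp
  qed
  have "((\<lambda>u. integral {- M..u} f) has_vector_derivative f x) (at x within {- M..M})"
    by (rule integral_has_vector_derivative[OF c']) (use x in auto)
  then have "((\<lambda>u. integral {- M..u} f) has_real_derivative f x) (at x)"
    using at_within_Icc_at[of "- M" x M] x by (simp add: has_real_derivative_iff_has_vector_derivative)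
  then have "((\<lambda>u. primitive f (- M) + integral {- M..u} f) has_real_derivative f x) (at x)"
    by (auto intro!: derivative_eq_intros)
  then show ?thesis
    by (rule has_field_derivative_transform_within_open[where S = "{- M<..<M}"]) (use x eq in auto)
qed

lemma primitive_measurable:
  assumes f: "linear_growth K f"
  shows "primitive f \<in> borel_measurable borel"
proof -
  note [measurable] = linear_growth_measurable[OF f]
  have "(\<lambda>x. LINT y|lborel. (indicator {y. 0 < y \<and> y \<le> x} y - indicator {y. x < y \<and> y \<le> 0} y) * f y) \<in> borel_measurable borel"
    by measurable
  then show ?thesis
    by (simp add: primitive_def[abs_def] greaterThanAtMost_def greaterThan_def atMost_def Int_def)
qed

lemma primitive_tendsto:
  assumes f: "\<And>n. linear_growth K (f n)" and lim: "\<And>y. (\<lambda>n. f n y) \<longlonglongrightarrow> g y"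
  shows "(\<lambda>n. primitive (f n) x) \<longlonglongrightarrow> primitive g x"
  unfolding primitive_def
proof (rule integral_dominated_convergence)
  note [measurable] = linear_growth_measurable[OF f]
  have [measurable]: "g \<in> borel_measurable borel" by (rule borel_measurable_LIMSEQ_real[OF lim]) measurable
  have K: "K \<ge> 0" by (rule linear_growth_nonneg[OF f])
  show "(\<lambda>y. (indicat_real {0<..x} y - indicator {x<..0} y) * g y) \<in> borel_measurable lborel" by measurable
  show "(\<lambda>y. (indicat_real {0<..x} y - indicator {x<..0} y) * f n y) \<in> borel_measurable lborel" for n by measurable
  show "AE y in lborel. (\<lambda>n. (indicat_real {0<..x} y - indicator {x<..0} y) * f n y)
      \<longlonglongrightarrow> (indicat_real {0<..x} y - indicator {x<..0} y) * g y"
    by (intro AE_I2 tendsto_intros lim)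
  have "integrable lborel (indicat_real {0<..x})" "integrable lborel (indicat_real {x<..0})"
    by (rule integrable_real_indicator; cases "0 \<le> x"; simp)+
  then show "integrable lborel (\<lambda>y. K * (1 + \<bar>x\<bar>) * (indicator {0<..x} y + indicator {x<..0} y))"
    by (intro integrable_mult_right Bochner_Integration.integrable_add)
  show "AE y in lborel. norm ((indicat_real {0<..x} y - indicator {x<..0} y) * f n y) \<le>
      K * (1 + \<bar>x\<bar>) * (indicator {0<..x} y + indicator {x<..0} y)" for n
  proof (rule AE_I2)
    fix y
    have "\<bar>f n y\<bar> \<le> K * (1 + \<bar>y\<bar>)" using f[of n] by (simp add: linear_growth_def)
    moreover have "K * (1 + \<bar>y\<bar>) \<le> K * (1 + \<bar>x\<bar>)" if "\<bar>y\<bar> \<le> \<bar>x\<bar>"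
      using that K by (intro mult_left_mono) auto
    ultimately show "norm ((indicat_real {0<..x} y - indicator {x<..0} y) * f n y) \<le>
      K * (1 + \<bar>x\<bar>) * (indicator {0<..x} y + indicator {x<..0} y)" by (auto split: split_indicator)
  qed
qed

text \<open>The primitive of a monotone function is convex, and \<open>f x\<close> is a subgradient
  even where \<open>f\<close> jumps. This is the source of duality in
  \<open>monotone_correlation_le\<close>.\<close>

lemma primitive_subgradient:
  assumes f: "linear_growth K f" and m: "mono f"
  shows "f x * (z - x) \<le> primitive f z - primitive f x"
proof -
  note i = linear_growth_integrable[OF f]
  have c: "integrable lborel (\<lambda>y. indicat_real {a<..b} y * c)" if "a \<le> b" for a b c :: real
    using that by (intro integrable_mult_left, intro integrable_real_indicator) simp_all
  show ?thesis
  proof (cases "x \<le> z")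
    case True
    have "f x * (z - x) = (LINT y|lborel. indicat_real {x<..z} y * f x)" using True by simp
    also have "\<dots> \<le> (LINT y|lborel. indicator {x<..z} y * f y)"
    proof (intro integral_mono c i True)
      show "indicat_real {x<..z} y * f x \<le> indicator {x<..z} y * f y" for y
        using monoD[OF m, of x y] by (cases "y \<in> {x<..z}") auto
    qed
    finally show ?thesis using primitive_diff[OF f True] by simp
  next
    case False
    then have zx: "z \<le> x" by simp
    have "(LINT y|lborel. indicator {z<..x} y * f y) \<le> (LINT y|lborel. indicat_real {z<..x} y * f x)"
    proof (intro integral_mono c i zx)
      show "indicator {z<..x} y * f y \<le> indicat_real {z<..x} y * f x" for y
        using monoD[OF m, of y x] by (cases "y \<in> {z<..x}") auto
    qed
    also have "\<dots> = f x * (x - z)" using zx by simp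
    finally show ?thesis using primitive_diff[OF f zx] by (simp add: algebra_simps)
  qed
qed

text \<open>Polynomials serve as smooth approximants: \<open>p\<close> and its antiderivative
  \<open>P\<close> are then both of class \<open>Ck k\<close> for every \<open>k\<close>.\<close>

lemma real_polynomial_antiderivative:
  fixes p :: "real \<Rightarrow> real"
  assumes "real_polynomial_function p"
  obtains P where "real_polynomial_function P" "P 0 = 0" "\<And>x. (P has_real_derivative p x) (at x)"
proof -
  obtain a n where p: "p = (\<lambda>x. \<Sum>i\<le>n. a i * x ^ i)"
    using real_polynomial_function_imp_sum[OF assms] by auto
  define P where "P x = (\<Sum>i\<le>n. a i / real (Suc i) * x ^ Suc i)" for x
  have "((\<lambda>x. a i / real (Suc i) * x ^ Suc i) has_real_derivative a i * x ^ i) (at x)" for i x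
    by (rule DERIV_cong[OF DERIV_cmult[OF DERIV_power[OF DERIV_ident]]]) (simp del: of_nat_Suc)
  then have "(P has_real_derivative p x) (at x)" for x
    unfolding P_def p by (rule DERIV_sum)
  moreover have "real_polynomial_function P"
    unfolding P_def[abs_def]
    by (intro real_polynomial_function_sum real_polynomial_function.intros(4)
        real_polynomial_function.intros(2) real_polynomial_function_power
        real_polynomial_function.intros(1) bounded_linear_ident) simp
  moreover have "P 0 = 0" by (simp add: P_def)
  ultimately show ?thesis using that by blast
qed

section \<open>From smooth test functions to ridge functions\<close>

context continuity_equation
begin

text \<open>The left-hand side of the increment formula converges by the second moments at the two
  end times, the right-hand side by \<open>quadratic_energy_finite\<close>.\<close>

lemma has_increments_limit:
  fixes \<phi> :: "nat \<Rightarrow> 'a \<Rightarrow> real"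
  assumes inc: "\<And>n. has_increments (\<phi> n) (G n)"
    and [measurable]: "\<And>n. \<phi> n \<in> borel_measurable borel" "\<And>n. G n \<in> borel_measurable borel"
      "\<psi> \<in> borel_measurable borel" "H \<in> borel_measurable borel"
    and bound: "\<And>n x. \<bar>\<phi> n x\<bar> \<le> L * (1 + (norm x)\<^sup>2)"
    and boundG: "\<And>n x w. \<bar>G n x \<bullet> w\<bar> \<le> L * (1 + (norm x)\<^sup>2 + (norm w)\<^sup>2)"
    and lim: "\<And>x. (\<lambda>n. \<phi> n x) \<longlonglongrightarrow> \<psi> x" "\<And>x w. (\<lambda>n. G n x \<bullet> w) \<longlonglongrightarrow> H x \<bullet> w"
  shows "has_increments \<psi> H"
  unfolding has_increments_def
proof (intro allI impI)
  fix a b :: real assume ab: "0 \<le> a" "a \<le> b" "b < 1"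
  have L: "L \<ge> 0" using bound[of 0 0] by simp
  have 1: "(\<lambda>n. LINT x|\<rho> t. \<phi> n x) \<longlonglongrightarrow> (LINT x|\<rho> t. \<psi> x)" if t: "t \<in> {0..<1}" for t
  proof (rule integral_dominated_convergence[where w = "\<lambda>x. L * (1 + (norm x)\<^sup>2)"])
    interpret prob_space "\<rho> t" by (rule prob_rho)
    show "integrable (\<rho> t) (\<lambda>x. L * (1 + (norm x)\<^sup>2))"
      using square_integrable_rho[OF t] by simp
  qed (use lim bound in auto)
  have 2: "(\<lambda>n. LINT t:{a..b}|lborel. LINT x|\<rho> t. G n x \<bullet> v t x) \<longlonglongrightarrow> (LINT t:{a..b}|lborel. LINT x|\<rho> t. H x \<bullet> v t x)"
    by (rule kernel_dominated_convergence[OF kernel_lborel _ _ quadratic_energy_finite[OF ab(1,3) L]])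
      (use boundG lim in \<open>auto simp: measurable_prod_borel\<close>)
  have "(\<lambda>n. LINT t:{a..b}|lborel. LINT x|\<rho> t. G n x \<bullet> v t x) \<longlonglongrightarrow> (LINT x|\<rho> b. \<psi> x) - (LINT x|\<rho> a. \<psi> x)"
    using tendsto_diff[OF 1[of b] 1[of a]] ab inc by (simp add: has_increments_def)
  from LIMSEQ_unique[OF this 2]
  show "(LINT x|\<rho> b. \<psi> x) - (LINT x|\<rho> a. \<psi> x) = (LINT t:{a..b}|lborel. LINT x|\<rho> t. H x \<bullet> v t x)" .
qed

text \<open>A ridge function has no compact support, and its primitive profile need not be smooth.
  Polynomials on [-N, N] repair the second defect and a cut-off at radius \<open>N\<close> the
  first. Since the modulus of \<open>\<theta> \<bullet> x\<close> is at most \<open>norm x\<close>,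
  the polynomial contributes only where it is close to \<open>f\<close>.\<close>

lemma has_increments_ridge_continuous:
  fixes \<theta> :: 'a
  assumes \<theta>: "norm \<theta> = 1" and f: "linear_growth K f" and c: "continuous_on UNIV f"
  shows "has_increments (\<lambda>x. primitive f (\<theta> \<bullet> x)) (\<lambda>x. f (\<theta> \<bullet> x) *\<^sub>R \<theta>)"
proof -
  have K: "K \<ge> 0" by (rule linear_growth_nonneg[OF f])
  have fK: "\<bar>f s\<bar> \<le> K * (1 + \<bar>s\<bar>)" for s using f by (simp add: linear_growth_def)
  have \<theta>x: "\<bar>\<theta> \<bullet> x\<bar> \<le> norm x" for x by (rule abs_inner_unit_le[OF \<theta>])
  obtain C where C: "C > 0" "\<And>N (x::'a) w. N > 0 \<Longrightarrow> \<bar>space_cutoff' N x w\<bar> \<le> C / N * norm w"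
    "\<And>N (x::'a) w. N > 0 \<Longrightarrow> norm x * \<bar>space_cutoff' N x w\<bar> \<le> C * norm w"
    using space_cutoff'_bound by metis
  define N where "N n = real (Suc n)" for n
  have N: "N n > 0" "N n \<ge> 1" for n by (auto simp: N_def)
  \<comment> \<open>The accuracy 1/N is tied to the interval [-N, N], so that one index both
    exhausts the line and removes the error.\<close>
  have "\<exists>p P. real_polynomial_function P \<and> real_polynomial_function p \<and> P 0 = 0 \<and>
      (\<forall>s. (P has_real_derivative p s) (at s)) \<and> (\<forall>s\<in>{- N n..N n}. \<bar>f s - p s\<bar> < 1 / N n)" for n
  proof -
    obtain p where p: "real_polynomial_function p" "\<And>s. s \<in> {- N n..N n} \<Longrightarrow> \<bar>f s - p s\<bar> < 1 / N n"
      by (rule Stone_Weierstrass_real_polynomial_function[of "{- N n..N n}" f "1 / N n"])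
        (use N continuous_on_subset[OF c, of "{- N n..N n}"] in auto)
    obtain P where "real_polynomial_function P" "P 0 = 0" "\<And>x. (P has_real_derivative p x) (at x)"
      using real_polynomial_antiderivative[OF p(1)] by blast
    with p show ?thesis by blast
  qed
  then obtain p P where poly: "\<And>n. real_polynomial_function (P n)" "\<And>n. real_polynomial_function (p n)"
    and P0: "\<And>n. P n 0 = 0" and P: "\<And>n s. (P n has_real_derivative p n s) (at s)"
    and p: "\<And>n s. s \<in> {- N n..N n} \<Longrightarrow> \<bar>f s - p n s\<bar> < 1 / N n"
    by metis
  \<comment> \<open>The mean value inequality, started at 0, where both primitives vanish.\<close>
  have Pd: "\<bar>P n s - primitive f s\<bar> \<le> \<bar>s\<bar> / N n" if s: "s \<in> {- N n..N n}" for n s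
  proof -
    have "norm ((P n s - primitive f s) - (P n 0 - primitive f 0)) \<le> 1 / N n * norm (s - 0)"
    proof (rule field_differentiable_bound[where S = "{- N n..N n}" and f' = "\<lambda>s. p n s - f s"])
      show "((\<lambda>s. P n s - primitive f s) has_real_derivative p n z - f z) (at z within {- N n..N n})" for z
        by (rule has_field_derivative_at_within[OF DERIV_diff[OF P primitive_has_derivative[OF f c]]])
      show "norm (p n z - f z) \<le> 1 / N n" if "z \<in> {- N n..N n}" for z
        using p[OF that] by (simp add: abs_minus_commute)
    qed (use s N[of n] in auto)
    then show ?thesis using P0 by simp
  qed
  have pb: "\<bar>p n s\<bar> \<le> (K + 1) * (1 + \<bar>s\<bar>)" if "s \<in> {- N n..N n}" for n s
  proof -
    have "1 / N n \<le> 1" using N[of n] by simp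
    then have "\<bar>p n s\<bar> \<le> K * (1 + \<bar>s\<bar>) + 1" using p[OF that] fK[of s] by linarith
    then show ?thesis by (simp add: distrib_right)
  qed
  have Pb: "\<bar>P n s\<bar> \<le> (K + 1) * (1 + \<bar>s\<bar>) * \<bar>s\<bar>" if "s \<in> {- N n..N n}" for n s
  proof -
    have "\<bar>s\<bar> / N n \<le> \<bar>s\<bar>" using N[of n] frac_le[of "\<bar>s\<bar>" "\<bar>s\<bar>" 1 "N n"] by simp
    moreover have "1 * \<bar>s\<bar> \<le> (1 + \<bar>s\<bar>) * \<bar>s\<bar>" by (intro mult_right_mono) auto
    ultimately have "\<bar>P n s\<bar> \<le> (1 + \<bar>s\<bar>) * \<bar>s\<bar> + K * (1 + \<bar>s\<bar>) * \<bar>s\<bar>"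
      using Pd[OF that] primitive_bound[OF f, of s] by linarith
    then show ?thesis by (simp add: algebra_simps)
  qed
  define g where "g n x = (- 2 * exp 1 / (N n)\<^sup>2 * sexp 2 (1 - (x \<bullet> x) / (N n)\<^sup>2)) *\<^sub>R x" for n and x :: 'a
  have g: "space_cutoff' (N n) x w = g n x \<bullet> w" for n x w by (simp add: space_cutoff'_def g_def)
  define \<phi> where "\<phi> n x = P n (\<theta> \<bullet> x) * space_cutoff (N n) x" for n x
  define G where "G n x = (p n (\<theta> \<bullet> x) * space_cutoff (N n) x) *\<^sub>R \<theta> + P n (\<theta> \<bullet> x) *\<^sub>R g n x" for n x
  have Ckpoly: "Ck k (\<lambda>x. q (\<theta> \<bullet> x))" if "real_polynomial_function q" for q k
    by (intro Ck_compose_linear[OF bounded_linear_inner_right] Ck_real_polynomial that)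
  have inside: "\<theta> \<bullet> x \<in> {- N n..N n}" if "norm x < N n" for x n
    using \<theta>x[of x] that by auto
  show ?thesis
  \<comment> \<open>In the constant, \<open>K + 1\<close> bounds the growth of \<open>p n\<close>,
    which is within 1 of \<open>f\<close>; \<open>1 + C\<close> collects the cut-off and its
    gradient; 2 comes from \<open>one_plus_mult_le\<close>.\<close>
  proof (rule has_increments_limit[of \<phi> G _ _ "2 * (K + 1) * (1 + C)"])
    show "has_increments (\<phi> n) (G n)" for n
    proof (rule has_increments_smooth)
      show "Ck k (\<phi> n)" for k
        unfolding \<phi>_def[abs_def] by (intro Ck_mult Ck_space_cutoff Ckpoly poly)
      show "\<phi> n x = 0" if "norm x \<ge> N n" for x using that N[of n] by (simp add: \<phi>_def space_cutoff_eq_0)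
      show "(\<phi> n has_derivative (\<lambda>w. G n x \<bullet> w)) (at x)" for x
      proof -
        have d: "((\<lambda>x. P n (\<theta> \<bullet> x)) has_derivative (\<lambda>w. p n (\<theta> \<bullet> x) * (\<theta> \<bullet> w))) (at x)"
          using has_derivative_compose[OF bounded_linear_imp_has_derivative[OF bounded_linear_inner_right[of \<theta>], of "at x"]
              P[of n "\<theta> \<bullet> x", unfolded has_field_derivative_def]] by simp
        have e: "(\<lambda>w. G n x \<bullet> w) = (\<lambda>w. P n (\<theta> \<bullet> x) * space_cutoff' (N n) x w
            + p n (\<theta> \<bullet> x) * (\<theta> \<bullet> w) * space_cutoff (N n) x)"
          by (simp add: fun_eq_iff G_def g inner_add_left algebra_simps)
        show ?thesis unfolding \<phi>_def[abs_def] e by (rule has_derivative_mult[OF d space_cutoff_has_derivative])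
      qed
    qed
    have [measurable]: "P n \<in> borel_measurable borel" "p n \<in> borel_measurable borel" for n
      using Ck_real_polynomial[OF poly(1), of 0] Ck_real_polynomial[OF poly(2), of 0]
      by (auto intro: borel_measurable_continuous_onI)
    have [measurable]: "space_cutoff M \<in> borel_measurable borel" for M
      unfolding space_cutoff_def[abs_def] by measurable
    show "\<phi> n \<in> borel_measurable borel" "G n \<in> borel_measurable borel" for n
      unfolding \<phi>_def[abs_def] G_def[abs_def] g_def[abs_def] by measurable
    note [measurable] = primitive_measurable[OF f] linear_growth_measurable[OF f]
    show "(\<lambda>x. primitive f (\<theta> \<bullet> x)) \<in> borel_measurable borel" "(\<lambda>x. f (\<theta> \<bullet> x) *\<^sub>R \<theta>) \<in> borel_measurable borel"
      by measurable
    show "\<bar>\<phi> n x\<bar> \<le> 2 * (K + 1) * (1 + C) * (1 + (norm x)\<^sup>2)" for n x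
    proof (cases "norm x \<ge> N n")
      case True
      then show ?thesis using N[of n] K C by (simp add: \<phi>_def space_cutoff_eq_0)
    next
      case False
      have "\<bar>\<phi> n x\<bar> \<le> \<bar>P n (\<theta> \<bullet> x)\<bar> * 1"
        unfolding \<phi>_def abs_mult using space_cutoff_bounds[of "N n" x] by (intro mult_left_mono) auto
      also have "\<dots> \<le> (K + 1) * (1 + \<bar>\<theta> \<bullet> x\<bar>) * \<bar>\<theta> \<bullet> x\<bar>" using Pb[OF inside] False by simp
      also have "\<dots> \<le> (K + 1) * (1 + norm x) * norm x" using K \<theta>x by (intro mult_mono) auto
      also have "\<dots> \<le> (K + 1) * (2 * (1 + (norm x)\<^sup>2))"
        unfolding mult.assoc using K by (intro mult_left_mono one_plus_mult_le) auto
      also have "\<dots> = 2 * (K + 1) * (1 + (norm x)\<^sup>2) * 1" by (simp only: mult_ac mult_1_right)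
      also have "\<dots> \<le> 2 * (K + 1) * (1 + (norm x)\<^sup>2) * (1 + C)" using K C by (intro mult_left_mono) auto
      finally show ?thesis by (simp add: mult_ac)
    qed
    show "\<bar>G n x \<bullet> w\<bar> \<le> 2 * (K + 1) * (1 + C) * (1 + (norm x)\<^sup>2 + (norm w)\<^sup>2)" for n x w
    proof (cases "norm x \<ge> N n")
      case True
      then show ?thesis using N[of n] K C by (simp add: G_def inner_add_left g[symmetric] space_cutoff_eq_0)
    next
      case False
      then have ins: "\<theta> \<bullet> x \<in> {- N n..N n}" by (intro inside) auto
      have "\<bar>G n x \<bullet> w\<bar> \<le> \<bar>p n (\<theta> \<bullet> x)\<bar> * (space_cutoff (N n) x * \<bar>\<theta> \<bullet> w\<bar>) + \<bar>P n (\<theta> \<bullet> x)\<bar> * \<bar>space_cutoff' (N n) x w\<bar>"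
        unfolding G_def inner_add_left inner_scaleR_left g[symmetric]
        using space_cutoff_bounds[of "N n" x] by (intro order_trans[OF abs_triangle_ineq]) (simp add: abs_mult)
      also have "\<dots> \<le> ((K + 1) * (1 + norm x)) * (1 * norm w) + (K + 1) * (1 + norm x) * norm x * \<bar>space_cutoff' (N n) x w\<bar>"
      proof (intro add_mono mult_mono mult_right_mono)
        show "\<bar>p n (\<theta> \<bullet> x)\<bar> \<le> (K + 1) * (1 + norm x)"
          by (rule order_trans[OF pb[OF ins]]) (use K \<theta>x in \<open>auto intro!: mult_left_mono\<close>)
        show "\<bar>P n (\<theta> \<bullet> x)\<bar> \<le> (K + 1) * (1 + norm x) * norm x"
          by (rule order_trans[OF Pb[OF ins]]) (use K \<theta>x in \<open>auto intro!: mult_mono\<close>)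
      qed (use space_cutoff_bounds[of "N n" x] \<theta>x K in \<open>auto intro!: mult_nonneg_nonneg\<close>)
      \<comment> \<open>The gradient of the cut-off absorbs one factor \<open>norm x\<close> of the
        quadratic growth of \<open>P n\<close>, which leaves a product of linear growth in
        \<open>x\<close> and in \<open>w\<close>.\<close>
      also have "(K + 1) * (1 + norm x) * norm x * \<bar>space_cutoff' (N n) x w\<bar> \<le> (K + 1) * (1 + norm x) * (C * norm w)"
        unfolding mult.assoc[of _ "norm x"] using K C(3)[OF N(1)] by (intro mult_left_mono) auto
      finally have "\<bar>G n x \<bullet> w\<bar> \<le> (K + 1) * (1 + C) * ((1 + norm x) * norm w)" by (simp add: algebra_simps)
      also have "\<dots> \<le> (K + 1) * (1 + C) * (1 + (norm x)\<^sup>2 + (norm w)\<^sup>2)"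
        using K C by (intro mult_left_mono one_plus_mult_le) auto
      also have "\<dots> \<le> 2 * ((K + 1) * (1 + C) * (1 + (norm x)\<^sup>2 + (norm w)\<^sup>2))"
      proof -
        have "0 \<le> (K + 1) * (1 + C) * (1 + (norm x)\<^sup>2 + (norm w)\<^sup>2)" using K C by (intro mult_nonneg_nonneg) auto
        then show ?thesis by (simp only: mult_2 le_add_same_cancel1)
      qed
      finally show ?thesis by (simp only: mult.assoc)
    qed
    have N0: "(\<lambda>n. c / N n) \<longlonglongrightarrow> 0" for c :: real
      unfolding N_def by (rule divide_Suc_tendsto_0)
    have ev: "\<forall>\<^sub>F n in sequentially. \<theta> \<bullet> x \<in> {- N n..N n}" for x
    proof -
      obtain n0 where n0: "norm x < real n0" using reals_Archimedean2 by blast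
      show ?thesis by (rule eventually_sequentiallyI[of n0], rule inside) (use n0 in \<open>auto simp: N_def\<close>)
    qed
    have limP: "(\<lambda>n. P n (\<theta> \<bullet> x)) \<longlonglongrightarrow> primitive f (\<theta> \<bullet> x)" for x
    proof (rule LIM_zero_cancel, rule Lim_null_comparison[OF _ N0[of "\<bar>\<theta> \<bullet> x\<bar>"]])
      show "\<forall>\<^sub>F n in sequentially. norm (P n (\<theta> \<bullet> x) - primitive f (\<theta> \<bullet> x)) \<le> \<bar>\<theta> \<bullet> x\<bar> / N n"
        using ev[of x] by eventually_elim (use Pd in simp)
    qed
    have limp: "(\<lambda>n. p n (\<theta> \<bullet> x)) \<longlonglongrightarrow> f (\<theta> \<bullet> x)" for x
    proof (rule LIM_zero_cancel, rule Lim_null_comparison[OF _ N0[of 1]])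
      show "\<forall>\<^sub>F n in sequentially. norm (p n (\<theta> \<bullet> x) - f (\<theta> \<bullet> x)) \<le> 1 / N n"
        using ev[of x] by eventually_elim (use p in \<open>fastforce simp: abs_minus_commute less_imp_le\<close>)
    qed
    have lims: "(\<lambda>n. space_cutoff (N n) x) \<longlonglongrightarrow> 1" for x :: 'a
      unfolding N_def by (rule space_cutoff_tendsto)
    have lims': "(\<lambda>n. space_cutoff' (N n) x w) \<longlonglongrightarrow> 0" for x w :: 'a
      by (rule Lim_null_comparison[OF _ N0[of "C * norm w"]]) (use C(2)[OF N(1)] in \<open>auto intro!: always_eventually\<close>)
    show "(\<lambda>n. \<phi> n x) \<longlonglongrightarrow> primitive f (\<theta> \<bullet> x)" for x
      unfolding \<phi>_def using tendsto_mult[OF limP lims] by simp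
    show "(\<lambda>n. G n x \<bullet> w) \<longlonglongrightarrow> f (\<theta> \<bullet> x) *\<^sub>R \<theta> \<bullet> w" for x w
    proof -
      have "(\<lambda>n. p n (\<theta> \<bullet> x) * space_cutoff (N n) x * (\<theta> \<bullet> w) + P n (\<theta> \<bullet> x) * space_cutoff' (N n) x w)
          \<longlonglongrightarrow> f (\<theta> \<bullet> x) * 1 * (\<theta> \<bullet> w) + primitive f (\<theta> \<bullet> x) * 0"
        by (intro tendsto_add tendsto_mult tendsto_const limp limP lims lims')
      then show ?thesis by (simp add: G_def inner_add_left g)
    qed
  qed
qed

text \<open>Clipped quantile functions jump across intervals that the target does not charge, hence
  the extension to pointwise limits of continuous functions.\<close>

lemma has_increments_ridge:
  fixes \<theta> :: 'a
  assumes \<theta>: "norm \<theta> = 1" and f: "\<And>n. linear_growth K (f n)" and c: "\<And>n. continuous_on UNIV (f n)"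
    and lim: "\<And>s. (\<lambda>n. f n s) \<longlonglongrightarrow> h s" and h: "linear_growth K h"
  shows "has_increments (\<lambda>x. primitive h (\<theta> \<bullet> x)) (\<lambda>x. h (\<theta> \<bullet> x) *\<^sub>R \<theta>)"
proof (rule has_increments_limit[of "\<lambda>n x. primitive (f n) (\<theta> \<bullet> x)" "\<lambda>n x. f n (\<theta> \<bullet> x) *\<^sub>R \<theta>" _ _ "2 * K"])
  have K: "K \<ge> 0" by (rule linear_growth_nonneg[OF h])
  have \<theta>x: "\<bar>\<theta> \<bullet> x\<bar> \<le> norm x" for x by (rule abs_inner_unit_le[OF \<theta>])
  note [measurable] = primitive_measurable[OF f] linear_growth_measurable[OF f]
    primitive_measurable[OF h] linear_growth_measurable[OF h]
  show "has_increments (\<lambda>x. primitive (f n) (\<theta> \<bullet> x)) (\<lambda>x. f n (\<theta> \<bullet> x) *\<^sub>R \<theta>)" for n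
    by (rule has_increments_ridge_continuous[OF \<theta> f c])
  show "(\<lambda>x. primitive (f n) (\<theta> \<bullet> x)) \<in> borel_measurable borel" "(\<lambda>x. f n (\<theta> \<bullet> x) *\<^sub>R \<theta>) \<in> borel_measurable borel"
    "(\<lambda>x. primitive h (\<theta> \<bullet> x)) \<in> borel_measurable borel" "(\<lambda>x. h (\<theta> \<bullet> x) *\<^sub>R \<theta>) \<in> borel_measurable borel" for n
    by measurable
  show "\<bar>primitive (f n) (\<theta> \<bullet> x)\<bar> \<le> 2 * K * (1 + (norm x)\<^sup>2)" for n x
  proof -
    have "\<bar>primitive (f n) (\<theta> \<bullet> x)\<bar> \<le> K * (1 + \<bar>\<theta> \<bullet> x\<bar>) * \<bar>\<theta> \<bullet> x\<bar>" by (rule primitive_bound[OF f])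
    also have "\<dots> \<le> K * (1 + norm x) * norm x" using K \<theta>x by (intro mult_mono) auto
    also have "\<dots> \<le> K * (2 * (1 + (norm x)\<^sup>2))"
      unfolding mult.assoc using K by (intro mult_left_mono one_plus_mult_le) auto
    finally show ?thesis by (simp only: mult_ac)
  qed
  show "\<bar>(f n (\<theta> \<bullet> x) *\<^sub>R \<theta>) \<bullet> w\<bar> \<le> 2 * K * (1 + (norm x)\<^sup>2 + (norm w)\<^sup>2)" for n x w
  proof -
    have "\<bar>(f n (\<theta> \<bullet> x) *\<^sub>R \<theta>) \<bullet> w\<bar> = \<bar>f n (\<theta> \<bullet> x)\<bar> * \<bar>\<theta> \<bullet> w\<bar>" by (simp add: abs_mult)
    also have "\<dots> \<le> (K * (1 + norm x)) * norm w"
    proof (intro mult_mono)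
      have "\<bar>f n (\<theta> \<bullet> x)\<bar> \<le> K * (1 + \<bar>\<theta> \<bullet> x\<bar>)" using f[of n] by (simp add: linear_growth_def)
      also have "\<dots> \<le> K * (1 + norm x)" using K \<theta>x by (intro mult_left_mono) auto
      finally show "\<bar>f n (\<theta> \<bullet> x)\<bar> \<le> K * (1 + norm x)" .
    qed (use \<theta>x K in auto)
    also have "\<dots> \<le> K * (1 + (norm x)\<^sup>2 + (norm w)\<^sup>2)"
      unfolding mult.assoc using K by (intro mult_left_mono one_plus_mult_le) auto
    also have "\<dots> \<le> 2 * (K * (1 + (norm x)\<^sup>2 + (norm w)\<^sup>2))"
    proof -
      have "0 \<le> K * (1 + (norm x)\<^sup>2 + (norm w)\<^sup>2)" using K by (intro mult_nonneg_nonneg) auto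
      then show ?thesis by simp
    qed
    finally show ?thesis by (simp add: mult.assoc)
  qed
  show "(\<lambda>n. primitive (f n) (\<theta> \<bullet> x)) \<longlonglongrightarrow> primitive h (\<theta> \<bullet> x)" for x
    by (rule primitive_tendsto[OF f lim])
  show "(\<lambda>n. f n (\<theta> \<bullet> x) *\<^sub>R \<theta> \<bullet> w) \<longlonglongrightarrow> h (\<theta> \<bullet> x) *\<^sub>R \<theta> \<bullet> w" for x w
    by (intro tendsto_intros lim)
qed

end

section \<open>Increments from two-sided bounds\<close>

text \<open>The integrand is frozen at an end point of each cell of a uniform partition; both choices of
  the end point converge to the integral of the diagonal.\<close>

lemma tagged_partition_integral_tendsto:
  fixes k :: "real \<Rightarrow> real \<Rightarrow> real" and c :: "nat \<Rightarrow> nat \<Rightarrow> real"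
  assumes ab: "a < b"
    and meas: "\<And>s. s \<in> {a..b} \<Longrightarrow> k s \<in> borel_measurable borel" "(\<lambda>t. k t t) \<in> borel_measurable borel"
    and w: "set_integrable lborel {a..b} w"
    and bound: "AE t in lborel. t \<in> {a..b} \<longrightarrow> (\<forall>s\<in>{a..b}. \<bar>k s t\<bar> \<le> w t)"
    and lim: "AE t in lborel. t \<in> {a..b} \<longrightarrow>
      (\<forall>S. (\<forall>n. S n \<in> {a..b}) \<longrightarrow> S \<longlonglongrightarrow> t \<longrightarrow> (\<lambda>n. k (S n) t) \<longlonglongrightarrow> k t t)"
    and p: "\<And>n i. p n i = a + real i * (b - a) / real (Suc n)"
    and c: "\<And>n i. p n i \<le> c n i" "\<And>n i. c n i \<le> p n (Suc i)"
  shows "(\<lambda>n. \<Sum>i\<le>n. LINT t:{p n i..p n (Suc i)}|lborel. k (c n i) t) \<longlonglongrightarrow> (LINT t:{a..b}|lborel. k t t)"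
proof -
  have step: "p n (Suc i) = p n i + (b - a) / real (Suc n)" for n i
    by (simp add: p add_divide_distrib distrib_right)
  have \<delta>: "(b - a) / real (Suc n) > 0" for n using ab by simp
  have mono: "p n i \<le> p n j" if "i \<le> j" for n i j
    using that by (rule lift_Suc_mono_le[rotated]) (use step \<delta> less_imp_le in \<open>auto simp: less_imp_le\<close>)
  have p0: "p n 0 = a" and pn: "p n (Suc n) = b" for n by (auto simp: p)
  have range: "p n i \<in> {a..b}" if "i \<le> Suc n" for n i
    using mono[of 0 i n] mono[OF that, of n] p0 pn by auto
  have crange: "c n i \<in> {a..b}" if "i \<le> n" for n i
    using range[of i n] range[of "Suc i" n] c[of n i] that by auto
  \<comment> \<open>Half-open cells are disjoint, so every point of (a, b] lies in exactly one of
    them; the point \<open>a\<close> is negligible.\<close>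
  define K where "K n t = (\<Sum>i\<le>n. indicator {p n i<..p n (Suc i)} t * k (c n i) t)" for n t
  have cell: "\<exists>i\<le>n. K n t = k (c n i) t \<and> p n i < t \<and> t \<le> p n (Suc i)" if t: "a < t" "t \<le> b" for n t
  proof -
    define i where "i = (LEAST i. t \<le> p n (Suc i))"
    have ex: "t \<le> p n (Suc n)" using t pn by simp
    have i: "t \<le> p n (Suc i)" "i \<le> n" unfolding i_def using ex by (rule LeastI, rule Least_le)
    have ti: "p n i < t"
    proof (cases i)
      case 0
      then show ?thesis using t p0 by simp
    next
      case (Suc j)
      then have "j < (LEAST i. t \<le> p n (Suc i))" by (simp add: i_def)
      then have "\<not> t \<le> p n (Suc j)" by (rule not_less_Least)
      then show ?thesis using Suc by simp
    qed
    have "indicator {p n j<..p n (Suc j)} t * k (c n j) t = (if j = i then k (c n i) t else 0)" for j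
    proof -
      consider "j < i" | "j = i" | "j > i" by linarith
      then show ?thesis
      proof cases
        case 1
        then have "p n (Suc j) \<le> p n i" by (intro mono) simp
        then show ?thesis using ti 1 by simp
      next
        case 3
        then have "p n (Suc i) \<le> p n j" by (intro mono) simp
        then show ?thesis using i 3 by simp
      qed (use i ti in simp)
    qed
    then have "K n t = k (c n i) t" using i by (simp add: K_def sum.delta)
    then show ?thesis using i ti by blast
  qed
  have int: "set_integrable lborel {p n i..p n (Suc i)} (k (c n i))" if "i \<le> n" for n i
    unfolding set_integrable_def
  proof (rule Bochner_Integration.integrable_bound[OF w[unfolded set_integrable_def]])
    note [measurable] = meas(1)[OF crange[OF that]]
    show "(\<lambda>t. indicat_real {p n i..p n (Suc i)} t *\<^sub>R k (c n i) t) \<in> borel_measurable lborel" by measurable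
    show "AE t in lborel. norm (indicat_real {p n i..p n (Suc i)} t *\<^sub>R k (c n i) t) \<le> norm (indicat_real {a..b} t *\<^sub>R w t)"
      using bound
    proof eventually_elim
      case (elim t)
      show ?case
      proof (cases "t \<in> {p n i..p n (Suc i)}")
        case True
        then have t: "t \<in> {a..b}" using range[of i n] range[of "Suc i" n] that by auto
        then have "\<bar>k (c n i) t\<bar> \<le> w t" using elim crange[OF that] by blast
        then show ?thesis using True t by simp
      qed simp
    qed
  qed
  have eq: "(\<Sum>i\<le>n. LINT t:{p n i..p n (Suc i)}|lborel. k (c n i) t) = (LINT t|lborel. K n t)" for n
  proof -
    have "(LINT t:{p n i..p n (Suc i)}|lborel. k (c n i) t) = (LINT t|lborel. indicator {p n i<..p n (Suc i)} t * k (c n i) t)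
        \<and> integrable lborel (\<lambda>t. indicator {p n i<..p n (Suc i)} t * k (c n i) t)" if "i \<le> n" for i
    proof
      note [measurable] = meas(1)[OF crange[OF that]]
      show "(LINT t:{p n i..p n (Suc i)}|lborel. k (c n i) t) = (LINT t|lborel. indicator {p n i<..p n (Suc i)} t * k (c n i) t)"
        unfolding set_lebesgue_integral_def
      proof (rule integral_cong_AE)
        show "AE t in lborel. indicat_real {p n i..p n (Suc i)} t *\<^sub>R k (c n i) t = indicat_real {p n i<..p n (Suc i)} t * k (c n i) t"
          using AE_lborel_singleton[of "p n i"] by eventually_elim (auto split: split_indicator)
      qed measurable
      have "set_integrable lborel {p n i<..p n (Suc i)} (k (c n i))"
        by (rule set_integrable_subset[OF int[OF that]]) auto
      then show "integrable lborel (\<lambda>t. indicator {p n i<..p n (Suc i)} t * k (c n i) t)" by (simp add: set_integrable_def)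
    qed
    then show ?thesis unfolding K_def by (subst Bochner_Integration.integral_sum) auto
  qed
  have "(\<lambda>n. LINT t|lborel. K n t) \<longlonglongrightarrow> (LINT t|lborel. indicator {a..b} t * k t t)"
  proof (rule integral_dominated_convergence[where w = "\<lambda>t. indicat_real {a..b} t *\<^sub>R w t"])
    show "integrable lborel (\<lambda>t. indicat_real {a..b} t *\<^sub>R w t)" using w by (simp add: set_integrable_def)
    note [measurable] = meas
    show "(\<lambda>t. indicat_real {a..b} t * k t t) \<in> borel_measurable lborel" by measurable
    have [measurable]: "i \<le> n \<Longrightarrow> k (c n i) \<in> borel_measurable borel" for n i by (rule meas(1)[OF crange])
    show "K n \<in> borel_measurable lborel" for n unfolding K_def by measurable (use crange in auto)
    have out: "K n t = 0" if "t \<notin> {a..b}" for n t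
    proof -
      have "t \<notin> {p n i<..p n (Suc i)}" if "i \<le> n" for i
        using range[of i n] range[of "Suc i" n] that \<open>t \<notin> {a..b}\<close> by auto
      then show ?thesis unfolding K_def by (intro sum.neutral) auto
    qed
    show "AE t in lborel. norm (K n t) \<le> indicat_real {a..b} t *\<^sub>R w t" for n
      using bound AE_lborel_singleton[of a]
    proof eventually_elim
      case (elim t)
      show ?case
      proof (cases "t \<in> {a..b}")
        case True
        then obtain i where "i \<le> n" "K n t = k (c n i) t" using cell[of t n] elim(2) by force
        then show ?thesis using True elim(1) crange[of i n] by auto
      qed (simp add: out)
    qed
    show "AE t in lborel. (\<lambda>n. K n t) \<longlonglongrightarrow> indicat_real {a..b} t * k t t"
      using lim AE_lborel_singleton[of a]
    proof eventually_elim
      case (elim t)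
      show ?case
      proof (cases "t \<in> {a..b}")
        case True
        then have "\<forall>n. \<exists>i\<le>n. K n t = k (c n i) t \<and> p n i < t \<and> t \<le> p n (Suc i)"
          using cell[of t] elim(2) by force
        then obtain i where i: "\<And>n. i n \<le> n" "\<And>n. K n t = k (c n (i n)) t" "\<And>n. p n (i n) < t" "\<And>n. t \<le> p n (Suc (i n))"
          by metis
        have "(\<lambda>n. c n (i n)) \<longlonglongrightarrow> t"
        proof (rule LIM_zero_cancel, rule Lim_null_comparison)
          show "\<forall>\<^sub>F n in sequentially. norm (c n (i n) - t) \<le> (b - a) / real (Suc n)"
          proof (intro always_eventually allI)
            fix n
            show "norm (c n (i n) - t) \<le> (b - a) / real (Suc n)"
              using c[of n "i n"] i(3)[of n] i(4)[of n] step[of n "i n"] by (simp add: abs_le_iff)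
          qed
          show "(\<lambda>n. (b - a) / real (Suc n)) \<longlonglongrightarrow> 0"
            by (rule divide_Suc_tendsto_0)
        qed
        moreover have "\<forall>n. c n (i n) \<in> {a..b}" using crange i(1) by blast
        ultimately have "(\<lambda>n. k (c n (i n)) t) \<longlonglongrightarrow> k t t"
          using elim(1)[THEN mp, OF True, THEN spec[of _ "\<lambda>n. c n (i n)"]] by simp
        then show ?thesis using True i(2) by simp
      qed (simp add: out)
    qed
  qed
  then show ?thesis unfolding eq by (simp add: set_lebesgue_integral_def)
qed

text \<open>The two bounds express that the potential of one time is admissible, though not optimal,
  at the other: freezing at the left end of a cell underestimates the increment of \<open>H\<close>,
  freezing at the right end overestimates it. Telescoping squeezes the increment between sums with a
  common limit.\<close>

lemma increment_eq_diagonal_integral: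
  fixes k :: "real \<Rightarrow> real \<Rightarrow> real"
  assumes ab: "a \<le> b"
    and meas: "\<And>s. s \<in> {a..b} \<Longrightarrow> k s \<in> borel_measurable borel" "(\<lambda>t. k t t) \<in> borel_measurable borel"
    and w: "set_integrable lborel {a..b} w"
    and bound: "AE t in lborel. t \<in> {a..b} \<longrightarrow> (\<forall>s\<in>{a..b}. \<bar>k s t\<bar> \<le> w t)"
    and lim: "AE t in lborel. t \<in> {a..b} \<longrightarrow>
      (\<forall>S. (\<forall>n. S n \<in> {a..b}) \<longrightarrow> S \<longlonglongrightarrow> t \<longrightarrow> (\<lambda>n. k (S n) t) \<longlonglongrightarrow> k t t)"
    and lower: "\<And>s t. a \<le> s \<Longrightarrow> s \<le> t \<Longrightarrow> t \<le> b \<Longrightarrow> (LINT u:{s..t}|lborel. k s u) \<le> H t - H s"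
    and upper: "\<And>s t. a \<le> s \<Longrightarrow> s \<le> t \<Longrightarrow> t \<le> b \<Longrightarrow> H t - H s \<le> (LINT u:{s..t}|lborel. k t u)"
  shows "H b - H a = (LINT t:{a..b}|lborel. k t t)"
proof (cases "a = b")
  case True
  have "(LINT t:{b}|lborel. k t t) = 0"
    unfolding set_lebesgue_integral_def
    by (rule integral_eq_zero_AE) (use AE_lborel_singleton[of b] in eventually_elim, auto)
  with True show ?thesis by simp
next
  case False
  then have ab': "a < b" using ab by simp
  define p where "p n i = a + real i * (b - a) / real (Suc n)" for n i
  have step: "p n i \<le> p n (Suc i)" for n i
    using ab by (simp add: p_def divide_right_mono mult_right_mono)
  have mono: "p n i \<le> p n j" if "i \<le> j" for n i j
    using that step by (rule lift_Suc_mono_le[rotated])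
  have p0: "p n 0 = a" and pn: "p n (Suc n) = b" for n by (auto simp: p_def)
  have range: "a \<le> p n i" "i \<le> Suc n \<Longrightarrow> p n i \<le> b" for n i
    using mono[of 0 i n] mono[of i "Suc n" n] p0 pn by auto
  have tele: "(\<Sum>i\<le>n. H (p n (Suc i)) - H (p n i)) = H b - H a" for n
    using sum_lessThan_telescope[of "\<lambda>i. H (p n i)" "Suc n"] p0 pn
    by (simp add: lessThan_Suc_atMost)
  note T = tagged_partition_integral_tendsto[OF ab' meas w bound lim p_def]
  have "(\<lambda>n. \<Sum>i\<le>n. LINT t:{p n i..p n (Suc i)}|lborel. k (p n i) t) \<longlonglongrightarrow> (LINT t:{a..b}|lborel. k t t)"
    by (rule T) (use step in auto)
  then have "(LINT t:{a..b}|lborel. k t t) \<le> H b - H a"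
  proof (rule LIMSEQ_le_const2)
    have "(\<Sum>i\<le>n. LINT t:{p n i..p n (Suc i)}|lborel. k (p n i) t) \<le> H b - H a" for n
      unfolding tele[of n, symmetric] by (intro sum_mono lower range step) auto
    then show "\<exists>N. \<forall>n\<ge>N. (\<Sum>i\<le>n. LINT t:{p n i..p n (Suc i)}|lborel. k (p n i) t) \<le> H b - H a" by blast
  qed
  moreover have "(\<lambda>n. \<Sum>i\<le>n. LINT t:{p n i..p n (Suc i)}|lborel. k (p n (Suc i)) t) \<longlonglongrightarrow> (LINT t:{a..b}|lborel. k t t)"
    by (rule T) (use step in auto)
  then have "H b - H a \<le> (LINT t:{a..b}|lborel. k t t)"
  proof (rule LIMSEQ_le_const)
    have "H b - H a \<le> (\<Sum>i\<le>n. LINT t:{p n i..p n (Suc i)}|lborel. k (p n (Suc i)) t)" for n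
      unfolding tele[of n, symmetric] by (intro sum_mono upper range step) auto
    then show "\<exists>N. \<forall>n\<ge>N. H b - H a \<le> (\<Sum>i\<le>n. LINT t:{p n i..p n (Suc i)}|lborel. k (p n (Suc i)) t)" by blast
  qed
  ultimately show ?thesis by simp
qed

section \<open>Clipped monotone maps between distributions on the line\<close>

definition clip :: "real \<Rightarrow> real \<Rightarrow> real" where
  "clip R q = max (- R) (min R q)"

text \<open>Layer-cake reconstruction of a number in [-R, R] from a function \<open>h\<close> that
  says, for each level \<open>y\<close>, whether or to what degree the number exceeds
  \<open>y\<close>.\<close>

definition level_integral :: "real \<Rightarrow> (real \<Rightarrow> real) \<Rightarrow> real" where
  "level_integral R h = - R + (LINT y|lborel. indicator {- R<..R} y * h y)"

text \<open>The clipped quantile function of \<open>\<nu>\<close>, written as a layer-cake integral: this makes measurable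
  dependence on parameters and approximation by continuous functions immediate.\<close>

definition clipped_quantile :: "real \<Rightarrow> real measure \<Rightarrow> real \<Rightarrow> real" where
  "clipped_quantile R \<nu> u = level_integral R (\<lambda>y. if cdf \<nu> y < u then 1 else 0)"

text \<open>The jump is replaced by a ramp of slope \<open>n\<close> that vanishes where
  \<open>cdf \<nu> y\<close> is at least \<open>u\<close>. The limit is thus the strict indicator of
  \<open>clipped_quantile\<close> at every \<open>u\<close>, exceptional levels included.\<close>

definition smooth_quantile :: "nat \<Rightarrow> real \<Rightarrow> real measure \<Rightarrow> real \<Rightarrow> real" where
  "smooth_quantile n R \<nu> u = level_integral R (\<lambda>y. min 1 (real n * max 0 (u - cdf \<nu> y)))"

context
  fixes R :: real
  assumes R: "R \<ge> 0"
begin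

lemma level_integrable:
  fixes h :: "real \<Rightarrow> real"
  assumes "h \<in> borel_measurable borel" "\<And>y. 0 \<le> h y" "\<And>y. h y \<le> 1"
  shows "integrable lborel (\<lambda>y. indicator {- R<..R} y * h y)"
proof (rule Bochner_Integration.integrable_bound)
  show "integrable lborel (indicat_real {- R<..R})" by (rule integrable_real_indicator) (use R in auto)
qed (use assms in \<open>auto split: split_indicator\<close>)

lemma level_integral_bound:
  assumes "h \<in> borel_measurable borel" "\<And>y. 0 \<le> h y" "\<And>y. h y \<le> 1"
  shows "\<bar>level_integral R h\<bar> \<le> R"
proof -
  have "0 \<le> (LINT y|lborel. indicator {- R<..R} y * h y)"
    using assms by (intro Bochner_Integration.integral_nonneg) auto
  moreover have "(LINT y|lborel. indicator {- R<..R} y * h y) \<le> (LINT y|lborel. indicat_real {- R<..R} y)"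
    by (intro integral_mono level_integrable assms, rule integrable_real_indicator)
      (use R assms in \<open>auto split: split_indicator\<close>)
  ultimately show ?thesis using R by (simp add: level_integral_def abs_le_iff)
qed

lemma level_integral_mono:
  assumes "h \<in> borel_measurable borel" "\<And>y. 0 \<le> h y" "\<And>y. h y \<le> 1"
    and "h' \<in> borel_measurable borel" "\<And>y. 0 \<le> h' y" "\<And>y. h' y \<le> 1" and "\<And>y. h y \<le> h' y"
  shows "level_integral R h \<le> level_integral R h'"
  unfolding level_integral_def
  by (intro add_left_mono integral_mono level_integrable assms) (auto intro: assms mult_left_mono)

lemma level_integral_tendsto:
  assumes [measurable]: "\<And>n. h n \<in> borel_measurable borel" "h' \<in> borel_measurable borel"
    and bound: "\<And>n y. 0 \<le> h n y" "\<And>n y. h n y \<le> 1"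
    and lim: "AE y in lborel. (\<lambda>n. h n y) \<longlonglongrightarrow> h' y"
  shows "(\<lambda>n. level_integral R (h n)) \<longlonglongrightarrow> level_integral R h'"
  unfolding level_integral_def
proof (intro tendsto_intros integral_dominated_convergence[where w = "indicat_real {- R<..R}"])
  show "integrable lborel (indicat_real {- R<..R})" by (rule integrable_real_indicator) (use R in auto)
  show "AE y in lborel. (\<lambda>n. indicat_real {- R<..R} y * h n y) \<longlonglongrightarrow> indicat_real {- R<..R} y * h' y"
    using lim by eventually_elim (intro tendsto_intros)
  show "AE y in lborel. norm (indicat_real {- R<..R} y * h n y) \<le> indicat_real {- R<..R} y" for n
    using bound by (auto split: split_indicator)
qed measurable

text \<open>The two integrands can differ only at the single level \<open>y = q\<close>.\<close>

lemma clip_eq_level_integral: "clip R q = level_integral R (\<lambda>y. if y < q then 1 else 0)"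
proof -
  have "(LINT y|lborel. indicat_real {- R<..R} y * (if y < q then 1 else 0)) = (LINT y|lborel. indicat_real {- R<..clip R q} y)"
  proof (rule integral_cong_AE)
    show "AE y in lborel. indicat_real {- R<..R} y * (if y < q then 1 else 0) = indicat_real {- R<..clip R q} y"
      using AE_lborel_singleton[of q]
      by eventually_elim (use R in \<open>auto simp: clip_def split: split_indicator\<close>)
  qed measurable
  also have "\<dots> = clip R q + R" using R by (simp add: clip_def)
  finally show ?thesis by (simp add: level_integral_def)
qed

context
  fixes \<nu> :: "real measure"
  assumes \<nu>: "real_distribution \<nu>"
begin

lemma cdf_nu_measurable [measurable]: "cdf \<nu> \<in> borel_measurable borel"
  using \<nu> by (intro borel_measurable_mono monoI finite_borel_measure.cdf_nondecreasing
      real_distribution.finite_borel_measure_M)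

lemma clipped_quantile_bound: "\<bar>clipped_quantile R \<nu> u\<bar> \<le> R"
  unfolding clipped_quantile_def by (rule level_integral_bound) auto

lemma smooth_quantile_bound: "\<bar>smooth_quantile n R \<nu> u\<bar> \<le> R"
  unfolding smooth_quantile_def by (rule level_integral_bound) auto

lemma clipped_quantile_mono: "u \<le> u' \<Longrightarrow> clipped_quantile R \<nu> u \<le> clipped_quantile R \<nu> u'"
  unfolding clipped_quantile_def by (rule level_integral_mono) auto

lemma smooth_quantile_continuous: "continuous_on UNIV (smooth_quantile n R \<nu>)"
  unfolding continuous_on_sequentially o_def smooth_quantile_def
  by (intro ballI allI impI level_integral_tendsto) (auto intro!: tendsto_intros)

lemma smooth_quantile_tendsto: "(\<lambda>n. smooth_quantile n R \<nu> u) \<longlonglongrightarrow> clipped_quantile R \<nu> u"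
  unfolding smooth_quantile_def clipped_quantile_def
proof (rule level_integral_tendsto)
  have "(\<lambda>n. min 1 (real n * max 0 (u - cdf \<nu> y))) \<longlonglongrightarrow> (if cdf \<nu> y < u then 1 else 0)" for y
  proof (cases "cdf \<nu> y < u")
    case True
    then obtain n0 where n0: "1 < real n0 * (u - cdf \<nu> y)" using reals_Archimedean3[of "u - cdf \<nu> y"] by auto
    have ev: "\<forall>\<^sub>F n in sequentially. 1 = min 1 (real n * max 0 (u - cdf \<nu> y))"
    proof (rule eventually_sequentiallyI[of n0])
      fix n assume "n0 \<le> n"
      then have "real n0 * (u - cdf \<nu> y) \<le> real n * (u - cdf \<nu> y)" using True by (intro mult_right_mono) auto
      then have "1 \<le> real n * (u - cdf \<nu> y)" using n0 by linarith
      then show "1 = min 1 (real n * max 0 (u - cdf \<nu> y))" using True by (simp add: min_absorb1)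
    qed
    show ?thesis using True Lim_transform_eventually[OF tendsto_const ev] by simp
  qed simp
  then show "AE y in lborel. (\<lambda>n. min 1 (real n * max 0 (u - cdf \<nu> y))) \<longlonglongrightarrow> (if cdf \<nu> y < u then 1 else 0)"
    by simp
qed auto

text \<open>A quantile function can jump only at a level that the distribution function takes on a
  set of positive length; the second assumption excludes this.\<close>

lemma clipped_quantile_tendsto:
  assumes "u \<longlonglongrightarrow> u0" and "AE y in lborel. cdf \<nu> y \<noteq> u0"
  shows "(\<lambda>n. clipped_quantile R \<nu> (u n)) \<longlonglongrightarrow> clipped_quantile R \<nu> u0"
  unfolding clipped_quantile_def
proof (rule level_integral_tendsto)
  show "AE y in lborel. (\<lambda>n. if cdf \<nu> y < u n then 1 else 0) \<longlonglongrightarrow> (if cdf \<nu> y < u0 then 1 else (0::real))"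
    using assms(2)
  proof eventually_elim
    case (elim y)
    then consider "cdf \<nu> y < u0" | "u0 < cdf \<nu> y" by linarith
    then show ?case
    proof cases
      case 1
      have "\<forall>\<^sub>F n in sequentially. 1 = (if cdf \<nu> y < u n then 1 else (0::real))"
        using order_tendstoD(1)[OF assms(1) 1] by eventually_elim simp
      from Lim_transform_eventually[OF tendsto_const this] 1 show ?thesis by simp
    next
      case 2
      have "\<forall>\<^sub>F n in sequentially. 0 = (if cdf \<nu> y < u n then 1 else (0::real))"
        using order_tendstoD(2)[OF assms(1) 2] by eventually_elim simp
      from Lim_transform_eventually[OF tendsto_const this] 2 show ?thesis by simp
    qed
  qed
qed auto

end

end

text \<open>On a level set the distribution function does not grow, so an interval between two of
  its points carries no mass. The level set is covered by countably many such intervals with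
  rational end points and at most two further points, which are not atoms.\<close>

lemma cdf_level_null:
  assumes \<mu>: "real_distribution \<mu>" and atomless: "\<And>x. measure \<mu> {x} = 0"
  shows "AE x in \<mu>. cdf \<mu> x \<noteq> c"
proof -
  interpret real_distribution \<mu> by (rule \<mu>)
  have null1: "N \<in> null_sets \<mu>" if "\<And>x y. x \<in> N \<Longrightarrow> y \<in> N \<Longrightarrow> x = y" for N
  proof (cases "N = {}")
    case False
    then obtain m where "m \<in> N" by blast
    with that have "N = {m}" by blast
    then show ?thesis using atomless[of m] by (auto simp: null_sets_def emeasure_eq_measure)
  qed simp
  define A where "A = {x. cdf \<mu> x = c}"
  have conv: "y \<in> A" if "x \<in> A" "z \<in> A" "x \<le> y" "y \<le> z" for x y z
    using that cdf_nondecreasing[of x y] cdf_nondecreasing[of y z] by (auto simp: A_def)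
  \<comment> \<open>\<open>L\<close> and \<open>U\<close> collect the points that rational members
    of the level set fail to enclose from below or from above. Two distinct points of the level set
    have a rational member strictly between them, so each of these sets has at most one
    element.\<close>
  define L where "L = {x\<in>A. \<forall>q\<in>A \<inter> \<rat>. \<not> q < x}"
  define U where "U = {x\<in>A. \<forall>q\<in>A \<inter> \<rat>. \<not> x \<le> q}"
  define Q where "Q = (A \<inter> \<rat>) \<times> (A \<inter> \<rat>)"
  have between: "\<exists>q\<in>A \<inter> \<rat>. x < q \<and> q < y" if "x \<in> A" "y \<in> A" "x < y" for x y
    using Rats_dense_in_real[OF that(3)] conv[OF that(1,2)] by (metis IntI less_imp_le)
  have L: "L \<in> null_sets \<mu>"
  proof (rule null1)
    fix x y assume "x \<in> L" "y \<in> L"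
    then show "x = y" using between[of x y] between[of y x] unfolding L_def by (metis (mono_tags, lifting) linorder_neqE mem_Collect_eq)
  qed
  have U: "U \<in> null_sets \<mu>"
  proof (rule null1)
    fix x y assume "x \<in> U" "y \<in> U"
    then show "x = y" using between[of x y] between[of y x] unfolding U_def
      by (metis (mono_tags, lifting) linorder_neqE mem_Collect_eq less_imp_le)
  qed
  have Q: "(\<Union>(p, q)\<in>Q. {p<..q}) \<in> null_sets \<mu>"
  proof (rule null_sets_UN')
    show "countable Q" unfolding Q_def using countable_rat by (intro countable_SIGMA) (auto intro: countable_Int2)
    fix i assume "i \<in> Q"
    then obtain p q where i: "i = (p, q)" "p \<in> A" "q \<in> A" by (auto simp: Q_def)
    show "(case i of (p, q) \<Rightarrow> {p<..q}) \<in> null_sets \<mu>"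
    proof (cases "p < q")
      case True
      then have "measure \<mu> {p<..q} = 0" using cdf_diff_eq[of p q] i by (simp add: A_def)
      then show ?thesis using i by (auto simp: null_sets_def emeasure_eq_measure)
    qed (use i in auto)
  qed
  have "A \<subseteq> L \<union> U \<union> (\<Union>(p, q)\<in>Q. {p<..q})"
  proof
    fix x assume x: "x \<in> A"
    show "x \<in> L \<union> U \<union> (\<Union>(p, q)\<in>Q. {p<..q})"
    proof (cases "x \<in> L \<union> U")
      case False
      then obtain p q where "p \<in> A \<inter> \<rat>" "p < x" "q \<in> A \<inter> \<rat>" "x \<le> q" using x by (auto simp: L_def U_def)
      then have "(p, q) \<in> Q" "x \<in> {p<..q}" by (auto simp: Q_def)
      then show ?thesis by blast
    qed simp
  qed
  moreover have "L \<union> U \<union> (\<Union>(p, q)\<in>Q. {p<..q}) \<in> null_sets \<mu>" using L U Q by auto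
  ultimately show ?thesis by (intro AE_I'[where N = "L \<union> U \<union> (\<Union>(p, q)\<in>Q. {p<..q})"]) (auto simp: A_def)
qed

text \<open>For each \<open>y\<close> the exceptional \<open>x\<close> form a level set, null by
  \<open>cdf_level_null\<close>; Fubini's theorem exchanges the quantifiers.\<close>

lemma cdf_values_differ:
  assumes \<mu>: "real_distribution \<mu>" and \<nu>: "real_distribution \<nu>" and atomless: "\<And>x. measure \<mu> {x} = 0"
  shows "AE x in \<mu>. AE y in lborel. cdf \<nu> y \<noteq> cdf \<mu> x"
proof -
  interpret M: real_distribution \<mu> by (rule \<mu>)
  interpret N: real_distribution \<nu> by (rule \<nu>)
  interpret P: pair_sigma_finite \<mu> "lborel :: real measure" ..
  have [measurable]: "cdf \<mu> \<in> borel_measurable borel" "cdf \<nu> \<in> borel_measurable borel"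
    by (intro borel_measurable_mono monoI M.cdf_nondecreasing N.cdf_nondecreasing; assumption)+
  have [measurable_cong]: "sets \<mu> = sets borel" by simp
  have "AE y in lborel. AE x in \<mu>. cdf \<nu> y \<noteq> cdf \<mu> x"
  proof (rule AE_I2)
    show "AE x in \<mu>. cdf \<nu> y \<noteq> cdf \<mu> x" for y
      using cdf_level_null[OF \<mu> atomless, of "cdf \<nu> y"] by eventually_elim auto
  qed
  moreover have "{z \<in> space (\<mu> \<Otimes>\<^sub>M lborel). cdf \<nu> (snd z) \<noteq> cdf \<mu> (fst z)} \<in> sets (\<mu> \<Otimes>\<^sub>M lborel)"
    by measurable
  ultimately show ?thesis
    using P.AE_commute[of "\<lambda>x y. cdf \<nu> y \<noteq> cdf \<mu> x"] by simp
qed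

text \<open>Uniqueness of the monotone map, level by level: apart from ties, \<open>y < T x\<close>
  holds exactly when \<open>cdf \<nu> y < cdf \<mu> x\<close>. For almost every \<open>x\<close> the
  ties fill a null set of levels, which the layer-cake formula does not see.\<close>

lemma clip_monotone_ot_map:
  assumes \<mu>: "real_distribution \<mu>" and \<nu>: "real_distribution \<nu>" and atomless: "\<And>x. measure \<mu> {x} = 0"
    and T: "monotone_ot_map \<mu> \<nu> T" and R: "R \<ge> 0"
  shows "AE x in \<mu>. clip R (T x) = clipped_quantile R \<nu> (cdf \<mu> x)"
proof -
  interpret M: real_distribution \<mu> by (rule \<mu>)
  obtain A where A: "A \<in> sets borel" "AE s in \<mu>. s \<in> A" "mono_on A T"
    and Tm [measurable]: "T \<in> borel_measurable borel" and push: "distr \<mu> borel T = \<nu>"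
    using T unfolding monotone_ot_map_def by auto
  have [measurable_cong]: "sets \<mu> = sets borel" by simp
  have cdf\<nu>: "cdf \<nu> y = measure \<mu> {s. T s \<le> y}" for y
  proof -
    have "measure (distr \<mu> borel T) {..y} = measure \<mu> (T -` {..y} \<inter> space \<mu>)" by (rule measure_distr) auto
    then show ?thesis unfolding push by (simp add: cdf_def2 vimage_def)
  qed
  \<comment> \<open>Monotonicity sends every point of \<open>A\<close> to the left of
    \<open>x\<close> to a value at most \<open>T x\<close>.\<close>
  have ge: "cdf \<mu> x \<le> cdf \<nu> y" if "x \<in> A" "T x \<le> y" for x y
    unfolding cdf\<nu> unfolding cdf_def2
  proof (rule M.finite_measure_mono_AE)
    show "AE s in \<mu>. s \<in> {..x} \<longrightarrow> s \<in> {s. T s \<le> y}"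
      using A(2)
    proof eventually_elim
      case (elim s)
      then show ?case using mono_onD[OF A(3), of s x] that by auto
    qed
  qed measurable
  \<comment> \<open>Conversely, a point of \<open>A\<close> to the right of \<open>x\<close> has
    image at least \<open>T x\<close>, hence above \<open>y\<close>.\<close>
  have le: "cdf \<nu> y \<le> cdf \<mu> x" if "x \<in> A" "y < T x" for x y
    unfolding cdf\<nu> unfolding cdf_def2
  proof (rule M.finite_measure_mono_AE)
    show "AE s in \<mu>. s \<in> {s. T s \<le> y} \<longrightarrow> s \<in> {..x}"
      using A(2)
    proof eventually_elim
      case (elim s)
      then show ?case using mono_onD[OF A(3), of x s] that by force
    qed
  qed auto
  show ?thesis
    using A(2) cdf_values_differ[OF \<mu> \<nu> atomless]
  proof eventually_elim
    case (elim x)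
    have "(LINT y|lborel. indicat_real {- R<..R} y * (if y < T x then 1 else 0)) =
        (LINT y|lborel. indicat_real {- R<..R} y * (if cdf \<nu> y < cdf \<mu> x then 1 else 0))"
    proof (rule integral_cong_AE)
      show "AE y in lborel. indicat_real {- R<..R} y * (if y < T x then 1 else 0) =
          indicat_real {- R<..R} y * (if cdf \<nu> y < cdf \<mu> x then 1 else 0)"
        using elim(2)
      proof eventually_elim
        case (elim y)
        then show ?case using ge[OF \<open>x \<in> A\<close>, of y] le[OF \<open>x \<in> A\<close>, of y] by (cases "y < T x") auto
      qed
      note [measurable] = cdf_nu_measurable[OF R \<nu>]
      show "(\<lambda>y. indicat_real {- R<..R} y * (if cdf \<nu> y < cdf \<mu> x then 1 else 0)) \<in> borel_measurable lborel" by measurable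
    qed measurable
    then show ?case
      by (simp add: clip_eq_level_integral[OF R] clipped_quantile_def level_integral_def)
  qed
qed

section \<open>Kantorovich duality for the clipped maps\<close>

context
  fixes f :: "real \<Rightarrow> real" and R :: real
  assumes mono: "mono f" and bound: "\<And>x. \<bar>f x\<bar> \<le> R"
begin

lemma bounded_mono_growth: "linear_growth R f"
proof -
  have "R \<ge> 0" using bound[of 0] by simp
  then have "R * 1 \<le> R * (1 + \<bar>y\<bar>)" for y by (intro mult_left_mono) auto
  then show ?thesis
    using borel_measurable_mono[OF mono] bound order_trans unfolding linear_growth_def by fastforce
qed

text \<open>One half of Kantorovich duality. The product x y is at most \<open>primitive f x\<close>
  plus the convex conjugate at y, with equality for y = f x; the conjugate integrates to the same
  value on both sides because the image measures agree.\<close>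

lemma monotone_correlation_le:
  assumes \<mu>: "real_distribution \<mu>" "integrable \<mu> (\<lambda>x. \<bar>x\<bar>)" and \<mu>': "real_distribution \<mu>'" "integrable \<mu>' (\<lambda>x. \<bar>x\<bar>)"
    and f': "f' \<in> borel_measurable borel" "\<And>x. \<bar>f' x\<bar> \<le> R" and push: "distr \<mu>' borel f' = distr \<mu> borel f"
  shows "(LINT x|\<mu>'. x * f' x) - (LINT x|\<mu>'. primitive f x) \<le> (LINT x|\<mu>. x * f x) - (LINT x|\<mu>. primitive f x)"
proof -
  interpret M: real_distribution \<mu> by (rule \<mu>)
  interpret M': real_distribution \<mu>' by (rule \<mu>')
  note g = bounded_mono_growth
  note sub = primitive_subgradient[OF g mono]
  note [measurable] = linear_growth_measurable[OF g] primitive_measurable[OF g] f'(1)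
  have [measurable_cong]: "sets \<mu> = sets borel" "sets \<mu>' = sets borel" by simp_all
  have lip: "\<bar>primitive f z - primitive f x\<bar> \<le> R * \<bar>z - x\<bar>" for x z
  proof -
    have "\<bar>f x * (z - x)\<bar> \<le> R * \<bar>z - x\<bar>" "\<bar>f z * (x - z)\<bar> \<le> R * \<bar>z - x\<bar>"
      using mult_right_mono[OF bound, of "\<bar>z - x\<bar>"] by (auto simp: abs_mult abs_minus_commute)
    then show ?thesis using sub[of x z] sub[of z x] by linarith
  qed
  have i: "integrable \<mu> (\<lambda>x. primitive f x)" "integrable \<mu>' (\<lambda>x. primitive f x)"
    by (rule Bochner_Integration.integrable_bound[OF integrable_mult_right[of R, OF \<mu>(2)]]
        Bochner_Integration.integrable_bound[OF integrable_mult_right[of R, OF \<mu>'(2)]];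
        use order_trans[OF lip[of _ 0, simplified] abs_ge_self] in simp)+
  have dom: "norm (x * y) \<le> norm (R * \<bar>x\<bar>)" if "\<bar>y\<bar> \<le> R" for x y
    using mult_left_mono[OF that abs_ge_zero[of x]] order_trans[OF abs_ge_zero that]
    by (simp add: abs_mult mult.commute)
  have i2: "integrable \<mu> (\<lambda>x. x * f x)"
    by (rule Bochner_Integration.integrable_bound[OF integrable_mult_right[of R, OF \<mu>(2)]])
      (use dom[OF bound] in auto)
  have i3: "integrable \<mu>' (\<lambda>x. x * f' x)"
    by (rule Bochner_Integration.integrable_bound[OF integrable_mult_right[of R, OF \<mu>'(2)]])
      (use dom[OF f'(2)] in auto)
  \<comment> \<open>The Legendre transform of \<open>primitive f\<close>. Rational points make the
    supremum measurable, and truncation at 0 by \<open>ennreal\<close> is harmless since the point 0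
    already contributes 0. Working with nonnegative integrals avoids having to show that the
    transform is integrable.\<close>
  define \<kappa> where "\<kappa> y = (SUP q\<in>\<rat>. ennreal (q * y - primitive f q))" for y
  have [measurable]: "\<kappa> \<in> borel_measurable borel"
    unfolding \<kappa>_def using countable_rat by (intro borel_measurable_SUP) auto
  have up: "\<kappa> (f x) \<le> ennreal (x * f x - primitive f x)" for x
    unfolding \<kappa>_def
  proof (intro SUP_least ennreal_leI)
    show "q * f x - primitive f q \<le> x * f x - primitive f x" for q
      using sub[of x q] by (simp add: algebra_simps)
  qed
  \<comment> \<open>Rational points approaching \<open>x\<close> suffice because the primitive is
    Lipschitz.\<close>
  have low: "ennreal (x * y - primitive f x) \<le> \<kappa> y" for x y
  proof -
    have "\<forall>n. \<exists>q\<in>\<rat>. x < q \<and> q < x + 1 / real (Suc n)" by (intro allI Rats_dense_in_real) simp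
    then obtain q where q: "\<And>n. q n \<in> \<rat>" "\<And>n. x < q n" "\<And>n. q n < x + 1 / real (Suc n)" by metis
    have qx: "q \<longlonglongrightarrow> x"
    proof (rule LIM_zero_cancel, rule Lim_null_comparison[OF _ divide_Suc_tendsto_0[of 1]])
      show "\<forall>\<^sub>F n in sequentially. norm (q n - x) \<le> 1 / real (Suc n)"
      proof (intro always_eventually allI)
        show "norm (q n - x) \<le> 1 / real (Suc n)" for n using q(2)[of n] q(3)[of n] by simp
      qed
    qed
    have "(\<lambda>n. primitive f (q n)) \<longlonglongrightarrow> primitive f x"
    proof (rule LIM_zero_cancel, rule Lim_null_comparison)
      show "\<forall>\<^sub>F n in sequentially. norm (primitive f (q n) - primitive f x) \<le> R * \<bar>q n - x\<bar>"
        using lip by (auto intro!: always_eventually)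
      show "(\<lambda>n. R * \<bar>q n - x\<bar>) \<longlonglongrightarrow> 0"
        using tendsto_mult_right_zero[OF tendsto_rabs_zero[OF LIM_zero[OF qx]]] .
    qed
    then have "(\<lambda>n. ennreal (q n * y - primitive f (q n))) \<longlonglongrightarrow> ennreal (x * y - primitive f x)"
      by (intro tendsto_ennrealI tendsto_intros qx)
    then show ?thesis
      by (rule LIMSEQ_le_const2) (use q(1) in \<open>auto simp: \<kappa>_def intro!: exI[of _ 0] SUP_upper\<close>)
  qed
  have "ennreal (enn2real (\<integral>\<^sup>+x. ennreal (x * f' x - primitive f x) \<partial>\<mu>')) \<le> (\<integral>\<^sup>+x. ennreal (x * f' x - primitive f x) \<partial>\<mu>')"
    by (simp add: ennreal_enn2real_if)
  also have "\<dots> \<le> (\<integral>\<^sup>+x. \<kappa> (f' x) \<partial>\<mu>')" by (intro nn_integral_mono low)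
  also have "\<dots> = (\<integral>\<^sup>+y. \<kappa> y \<partial>distr \<mu>' borel f')" by (subst nn_integral_distr) auto
  also have "\<dots> = (\<integral>\<^sup>+x. \<kappa> (f x) \<partial>\<mu>)" unfolding push by (subst nn_integral_distr) auto
  also have "\<dots> \<le> (\<integral>\<^sup>+x. ennreal (x * f x - primitive f x) \<partial>\<mu>)" by (intro nn_integral_mono up)
  also have "\<dots> = ennreal (LINT x|\<mu>. x * f x - primitive f x)"
    by (rule nn_integral_eq_integral) (use i i2 sub[of _ 0] in \<open>auto simp: algebra_simps\<close>)
  finally have "enn2real (\<integral>\<^sup>+x. ennreal (x * f' x - primitive f x) \<partial>\<mu>') \<le> (LINT x|\<mu>. x * f x - primitive f x)"
  proof (subst (asm) ennreal_le_iff)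
    show "0 \<le> (LINT x|\<mu>. x * f x - primitive f x)"
      using sub[of _ 0] by (intro Bochner_Integration.integral_nonneg) (simp add: algebra_simps)
  qed
  \<comment> \<open>Under \<open>\<mu>'\<close> the integrand may take negative values; the
    nonnegative integral sees its positive part and still bounds from above.\<close>
  moreover have "(LINT x|\<mu>'. x * f' x - primitive f x) \<le> enn2real (\<integral>\<^sup>+x. ennreal (x * f' x - primitive f x) \<partial>\<mu>')"
    using i3 i by (subst real_lebesgue_integral_def) auto
  ultimately show ?thesis using i i2 i3 by simp
qed

end

section \<open>Cost increments in a fixed direction\<close>

lemma abs_clip_le: "R \<ge> 0 \<Longrightarrow> \<bar>clip R q\<bar> \<le> \<bar>q\<bar>"
  by (auto simp: clip_def)

lemma clip_measurable [measurable]: "clip R \<in> borel_measurable borel"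
  unfolding clip_def[abs_def] by measurable

lemma clip_tendsto: "(\<lambda>n. clip (real n) q) \<longlonglongrightarrow> q"
proof -
  obtain n0 where n0: "\<bar>q\<bar> < real n0" using reals_Archimedean2 by blast
  have "\<forall>\<^sub>F n in sequentially. q = clip (real n) q"
    by (rule eventually_sequentiallyI[of n0]) (use n0 in \<open>auto simp: clip_def\<close>)
  then show ?thesis by (rule Lim_transform_eventually[OF tendsto_const])
qed

text \<open>The Kantorovich potential for the quadratic cost, written as a primitive so that the
  increment formula for ridge functions applies to the doubled displacement.\<close>

lemma primitive_twice_diff:
  assumes f: "linear_growth K f"
  shows "primitive (\<lambda>s. 2 * (s - f s)) x = x\<^sup>2 - 2 * primitive f x"
proof -
  have id: "linear_growth 1 (\<lambda>s. s)" by (auto simp: linear_growth_def)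
  have "primitive (\<lambda>s. s) x - x\<^sup>2 / 2 = primitive (\<lambda>s. s) 0 - 0\<^sup>2 / 2"
  proof (rule DERIV_isconst_all[where f = "\<lambda>x. primitive (\<lambda>s. s) x - x\<^sup>2 / 2"], rule allI)
    show "((\<lambda>x. primitive (\<lambda>s. s) x - x\<^sup>2 / 2) has_real_derivative 0) (at y)" for y
      by (rule derivative_eq_intros primitive_has_derivative[OF id] | simp)+
  qed
  then have sq: "primitive (\<lambda>s. s) x = x\<^sup>2 / 2" by simp
  note i = linear_growth_integrable[OF id] linear_growth_integrable[OF f]
  have D: "integrable lborel (\<lambda>y. (indicat_real {0<..x} y - indicator {x<..0} y) * y)"
    "integrable lborel (\<lambda>y. (indicat_real {0<..x} y - indicator {x<..0} y) * f y)"
    unfolding left_diff_distrib by (intro Bochner_Integration.integrable_diff i)+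
  have "primitive (\<lambda>s. 2 * (s - f s)) x = (LINT y|lborel. 2 * ((indicat_real {0<..x} y - indicator {x<..0} y) * y)
      - 2 * ((indicat_real {0<..x} y - indicator {x<..0} y) * f y))"
    unfolding primitive_def by (intro Bochner_Integration.integral_cong) (auto simp: algebra_simps)
  also have "\<dots> = 2 * primitive (\<lambda>s. s) x - 2 * primitive f x"
    unfolding primitive_def using D by simp
  finally have "primitive (\<lambda>s. 2 * (s - f s)) x = 2 * primitive (\<lambda>s. s) x - 2 * primitive f x" .
  then show ?thesis using sq by simp
qed

lemma displacement_growth:
  assumes f: "f \<in> borel_measurable borel" "\<And>s. \<bar>f s\<bar> \<le> R"
  shows "linear_growth (2 * (1 + R)) (\<lambda>s. 2 * (s - f s))"
  unfolding linear_growth_def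
proof (intro conjI allI)
  fix s
  have R: "R \<ge> 0" using f(2)[of 0] by simp
  define z where "z = R * \<bar>s\<bar>"
  have z: "0 \<le> z" using R by (simp add: z_def)
  have e: "2 * (1 + R) * (1 + \<bar>s\<bar>) = 2 + 2 * R + 2 * \<bar>s\<bar> + 2 * z"
    by (simp add: algebra_simps z_def)
  show "\<bar>2 * (s - f s)\<bar> \<le> 2 * (1 + R) * (1 + \<bar>s\<bar>)"
    unfolding e abs_le_iff using f(2)[of s] z abs_ge_self[of s] abs_ge_minus_self[of s] by (simp add: abs_le_iff)
qed (use f in measurable)

lemma P2_prob_space: "\<mu> \<in> P2 \<Longrightarrow> prob_space \<mu>"
  and P2_sets: "\<mu> \<in> P2 \<Longrightarrow> sets \<mu> = sets borel"
  by (auto simp: P2_def)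

section \<open>The flow and its clipped transport maps\<close>

locale averaged_flow = continuity_equation \<rho> v
  for \<rho> :: "real \<Rightarrow> 'a::euclidean_space measure" and v :: "real \<Rightarrow> 'a \<Rightarrow> 'a" +
  fixes \<rho>1 :: "'a measure" and T :: "real \<Rightarrow> 'a \<Rightarrow> real \<Rightarrow> real"
  assumes target: "\<rho>1 \<in> P2"
    and maps: "\<And>t. t \<in> {0..<1} \<Longrightarrow> sliced_ot_maps (\<rho> t) \<rho>1 (T t)"
begin

sublocale target: prob_space \<rho>1
  by (rule P2_prob_space[OF target])

lemma sets_target [simp, measurable_cong]: "sets \<rho>1 = sets borel"
  by (rule P2_sets[OF target])

lemma space_target [simp]: "space \<rho>1 = UNIV"
  using sets_eq_imp_space_eq[OF sets_target] by simp

lemma real_distribution_proj: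
  "real_distribution (proj_measure \<theta> (\<rho> t))" "real_distribution (proj_measure \<theta> \<rho>1)"
  unfolding proj_measure_def
  by (rule prob_space.real_distribution_distr[OF prob_rho]; simp)
    (rule target.real_distribution_distr; simp)

lemma cdf_proj: "cdf (proj_measure \<theta> (\<rho> t)) s = (LINT z|\<rho> t. indicator {z. \<theta> \<bullet> z \<le> s} z)"
  "cdf (proj_measure \<theta> \<rho>1) s = (LINT z|\<rho>1. indicator {z. \<theta> \<bullet> z \<le> s} z)"
  by (simp_all add: proj_measure_def cdf_def2 measure_distr vimage_def)

lemma cdf_proj_measurable [measurable (raw)]:
  fixes f :: "'b \<Rightarrow> 'a" and g h :: "'b \<Rightarrow> real"
  assumes [measurable]: "f \<in> borel_measurable N" "g \<in> borel_measurable N" "h \<in> borel_measurable N"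
  shows "(\<lambda>p. cdf (proj_measure (f p) (\<rho> (g p))) (h p)) \<in> borel_measurable N"
proof -
  have "(\<lambda>p. \<rho> (g p)) \<in> N \<rightarrow>\<^sub>M subprob_algebra borel" by measurable
  then show ?thesis
    unfolding cdf_proj by (rule integral_measurable_kernel) (simp add: indicator_def)
qed

lemma cdf_target_measurable [measurable (raw)]:
  fixes f :: "'b \<Rightarrow> 'a" and h :: "'b \<Rightarrow> real"
  assumes [measurable]: "f \<in> borel_measurable N" "h \<in> borel_measurable N"
  shows "(\<lambda>p. cdf (proj_measure (f p) \<rho>1) (h p)) \<in> borel_measurable N"
  unfolding cdf_proj by (rule target.borel_measurable_lebesgue_integral) (simp add: indicator_def case_prod_beta')

text \<open>Monotone rearrangement: the quantile function of the projected target after the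
  distribution function of the projected curve. The formula does not mention \<open>T\<close>, which
  is how it gains measurability in time.\<close>

definition Tclip :: "real \<Rightarrow> 'a \<Rightarrow> real \<Rightarrow> real \<Rightarrow> real" where
  "Tclip R \<theta> t s = clipped_quantile R (proj_measure \<theta> \<rho>1) (cdf (proj_measure \<theta> (\<rho> t)) s)"

text \<open>A version of the transport maps that is jointly Borel in time, direction and position.\<close>

definition Tjoint :: "'a \<Rightarrow> real \<Rightarrow> real \<Rightarrow> real" where
  "Tjoint \<theta> t s = lim (\<lambda>n. Tclip (real n) \<theta> t s)"

lemma Tclip_measurable [measurable (raw)]:
  fixes f :: "'b \<Rightarrow> 'a" and g h :: "'b \<Rightarrow> real"
  assumes [measurable]: "f \<in> borel_measurable N" "g \<in> borel_measurable N" "h \<in> borel_measurable N"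
  shows "(\<lambda>p. Tclip R (f p) (g p) (h p)) \<in> borel_measurable N"
  unfolding Tclip_def clipped_quantile_def level_integral_def
  by (intro borel_measurable_add borel_measurable_const lborel.borel_measurable_lebesgue_integral)
    measurable

lemma Tjoint_measurable [measurable (raw)]:
  fixes f :: "'b \<Rightarrow> 'a" and g h :: "'b \<Rightarrow> real"
  assumes [measurable]: "f \<in> borel_measurable N" "g \<in> borel_measurable N" "h \<in> borel_measurable N"
  shows "(\<lambda>p. Tjoint (f p) (g p) (h p)) \<in> borel_measurable N"
  unfolding Tjoint_def by measurable

lemma Tclip_bound: "R \<ge> 0 \<Longrightarrow> \<bar>Tclip R \<theta> t s\<bar> \<le> R"
  unfolding Tclip_def by (rule clipped_quantile_bound[OF _ real_distribution_proj(2)])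

lemma Tclip_mono: "R \<ge> 0 \<Longrightarrow> mono (Tclip R \<theta> t)"
  unfolding Tclip_def
  by (intro monoI clipped_quantile_mono[OF _ real_distribution_proj(2)] finite_borel_measure.cdf_nondecreasing
      real_distribution.finite_borel_measure_M real_distribution_proj(1))

text \<open>Hyperplanes are Lebesgue null sets; this is where absolute continuity of the curve
  enters.\<close>

lemma atomless_proj:
  assumes \<theta>: "\<theta> \<noteq> 0" and t: "t \<in> {0..<1}"
  shows "measure (proj_measure \<theta> (\<rho> t)) {x} = 0"
proof -
  have "{z. \<theta> \<bullet> z = x} \<in> null_sets lborel"
  proof -
    have "negligible {z. \<theta> \<bullet> z = x}" using \<theta> by (intro negligible_hyperplane) auto
    moreover have "closed {z. \<theta> \<bullet> z = x}" by (rule closed_hyperplane)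
    ultimately show ?thesis
      by (auto simp: negligible_iff_null_sets null_sets_completion_iff)
  qed
  then have "{z. \<theta> \<bullet> z = x} \<in> null_sets (\<rho> t)"
    using abs_cont[OF t] unfolding absolutely_continuous_def by blast
  then have "measure (\<rho> t) {z. \<theta> \<bullet> z = x} = 0" by (simp add: null_sets_def measure_def)
  then show ?thesis
    by (simp add: proj_measure_def measure_distr vimage_def)
qed

section \<open>Transport in one fixed direction\<close>

context
  fixes \<theta> :: 'a
  assumes \<theta>: "norm \<theta> = 1"
begin

lemma theta_nonzero: "\<theta> \<noteq> 0" using \<theta> by auto

lemma sets_proj: "sets (proj_measure \<theta> \<mu>) = sets borel"
  by (simp add: proj_measure_def)

lemma AE_proj:
  assumes "AE s in proj_measure \<theta> (\<rho> t). P s"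
  shows "AE x in \<rho> t. P (\<theta> \<bullet> x)"
proof -
  have "(\<lambda>x. \<theta> \<bullet> x) \<in> \<rho> t \<rightarrow>\<^sub>M borel" by simp
  from AE_distrD[OF this, of P] show ?thesis using assms unfolding proj_measure_def by simp
qed

lemma integral_proj:
  fixes f :: "real \<Rightarrow> real"
  shows "f \<in> borel_measurable borel \<Longrightarrow> (LINT s|proj_measure \<theta> (\<rho> t). f s) = (LINT x|\<rho> t. f (\<theta> \<bullet> x))"
  "f \<in> borel_measurable borel \<Longrightarrow> (LINT s|proj_measure \<theta> \<rho>1. f s) = (LINT x|\<rho>1. f (\<theta> \<bullet> x))"
  unfolding proj_measure_def by (subst integral_distr; simp)+

lemma proj_square_integrable:
  assumes "t \<in> {0..<1}"
  shows "integrable (\<rho> t) (\<lambda>x. (\<theta> \<bullet> x)\<^sup>2)" "integrable (\<rho> t) (\<lambda>x. \<bar>\<theta> \<bullet> x\<bar>)"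
    "integrable (\<rho> t) (\<lambda>x. norm x)"
proof -
  interpret prob_space "\<rho> t" by (rule prob_rho)
  note sq = square_integrable_rho[OF assms]
  show n: "integrable (\<rho> t) (\<lambda>x. norm x)"
    by (rule square_integrable_imp_integrable[OF _ sq]) simp
  show "integrable (\<rho> t) (\<lambda>x. \<bar>\<theta> \<bullet> x\<bar>)"
    by (rule Bochner_Integration.integrable_bound[OF n]) (use abs_inner_unit_le[OF \<theta>] in auto)
  show "integrable (\<rho> t) (\<lambda>x. (\<theta> \<bullet> x)\<^sup>2)"
    by (rule Bochner_Integration.integrable_bound[OF sq])
      (use abs_inner_unit_le[OF \<theta>] in \<open>auto simp: abs_le_square_iff[symmetric]\<close>)
qed

lemma map_properties:
  assumes t: "t \<in> {0..<1}"
  shows "monotone_ot_map (proj_measure \<theta> (\<rho> t)) (proj_measure \<theta> \<rho>1) (T t \<theta>)"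
  using maps[OF t] \<theta> by (auto simp: sliced_ot_maps_def)

lemma AE_clip_proj:
  assumes t: "t \<in> {0..<1}" and R: "R \<ge> 0"
  shows "AE s in proj_measure \<theta> (\<rho> t). clip R (T t \<theta> s) = Tclip R \<theta> t s"
  unfolding Tclip_def
  by (rule clip_monotone_ot_map[OF real_distribution_proj atomless_proj[OF theta_nonzero t] map_properties[OF t] R])

text \<open>The integer clipping levels are countable, so one null set serves all of them, and off
  it clipping at growing levels recovers the map.\<close>

lemma AE_Tjoint:
  assumes t: "t \<in> {0..<1}"
  shows "AE x in \<rho> t. T t \<theta> (\<theta> \<bullet> x) = Tjoint \<theta> t (\<theta> \<bullet> x) \<and> (\<forall>n. Tclip (real n) \<theta> t (\<theta> \<bullet> x) = clip (real n) (T t \<theta> (\<theta> \<bullet> x)))"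
proof -
  have "AE x in \<rho> t. \<forall>n. clip (real n) (T t \<theta> (\<theta> \<bullet> x)) = Tclip (real n) \<theta> t (\<theta> \<bullet> x)"
    unfolding AE_all_countable by (intro allI AE_proj AE_clip_proj t) simp
  then show ?thesis
  proof eventually_elim
    case (elim x)
    then have "(\<lambda>n. Tclip (real n) \<theta> t (\<theta> \<bullet> x)) \<longlonglongrightarrow> T t \<theta> (\<theta> \<bullet> x)"
      using clip_tendsto[of "T t \<theta> (\<theta> \<bullet> x)"] by simp
    from limI[OF this] elim show ?case by (simp add: Tjoint_def)
  qed
qed

text \<open>The right-hand side does not involve \<open>t\<close>: the clipped problems of all times
  share one target, as duality requires for comparing their costs.\<close>

lemma distr_Tclip:
  assumes t: "t \<in> {0..<1}" and R: "R \<ge> 0"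
  shows "distr (proj_measure \<theta> (\<rho> t)) borel (Tclip R \<theta> t) = distr (proj_measure \<theta> \<rho>1) borel (clip R)"
proof -
  have Tm: "T t \<theta> \<in> borel_measurable borel" and push: "distr (proj_measure \<theta> (\<rho> t)) borel (T t \<theta>) = proj_measure \<theta> \<rho>1"
    using map_properties[OF t] by (auto simp: monotone_ot_map_def)
  note [measurable_cong] = sets_proj
  note [measurable] = Tm
  have "distr (proj_measure \<theta> (\<rho> t)) borel (Tclip R \<theta> t) = distr (proj_measure \<theta> (\<rho> t)) borel (\<lambda>s. clip R (T t \<theta> s))"
    by (rule distr_cong_AE[OF refl refl]) (use AE_clip_proj[OF t R] in \<open>auto elim: AE_mp\<close>)
  also have "\<dots> = distr (distr (proj_measure \<theta> (\<rho> t)) borel (T t \<theta>)) borel (clip R)"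
    by (subst distr_distr) (auto simp: o_def)
  finally show ?thesis by (simp add: push)
qed

text \<open>Narrow convergence passes to the projections by testing with ridge functions. The limit
  has no atoms, so its distribution function is continuous and convergence holds at every
  point.\<close>

lemma cdf_proj_tendsto:
  assumes t: "t \<in> {0..<1}" and S: "\<And>n. S n \<in> {0..<1}" "S \<longlonglongrightarrow> t"
  shows "(\<lambda>n. cdf (proj_measure \<theta> (\<rho> (S n))) s) \<longlonglongrightarrow> cdf (proj_measure \<theta> (\<rho> t)) s"
proof -
  have "weak_conv_m (\<lambda>n. proj_measure \<theta> (\<rho> (S n))) (proj_measure \<theta> (\<rho> t))"
  proof (rule integral_cts_step_conv_imp_weak_conv[OF real_distribution_proj(1) real_distribution_proj(1)])
    fix x y :: real assume xy: "x < y"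
    have c: "continuous_on UNIV (cts_step x y)"
      using cts_step_uniformly_continuous[OF xy] by (rule uniformly_continuous_imp_continuous)
    have [measurable]: "cts_step x y \<in> borel_measurable borel" by (rule borel_measurable_continuous_onI[OF c])
    have "continuous_on {0..<1} (\<lambda>t. LINT z|\<rho> t. cts_step x y (\<theta> \<bullet> z))"
    proof -
      have "continuous_on UNIV (\<lambda>z. cts_step x y (\<theta> \<bullet> z))"
        by (rule continuous_on_compose2[OF c]) (auto intro!: continuous_intros)
      moreover have "bounded (range (\<lambda>z. cts_step x y (\<theta> \<bullet> z)))"
        using xy by (intro boundedI[of _ 1]) (auto simp: cts_step_def)
      ultimately show ?thesis using narrow unfolding narrowly_continuous_on_def by blast
    qed
    from continuous_on_tendsto_compose[OF this S(2) t]
    show "(\<lambda>n. integral\<^sup>L (proj_measure \<theta> (\<rho> (S n))) (cts_step x y)) \<longlonglongrightarrow> integral\<^sup>L (proj_measure \<theta> (\<rho> t)) (cts_step x y)"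
      using S(1) by (simp add: integral_proj)
  qed
  moreover have "isCont (cdf (proj_measure \<theta> (\<rho> t))) s"
    using atomless_proj[OF theta_nonzero t]
      finite_borel_measure.isCont_cdf[OF real_distribution.finite_borel_measure_M[OF real_distribution_proj(1)]] by simp
  ultimately show ?thesis by (simp add: weak_conv_m_def weak_conv_def)
qed

text \<open>The null set depends on \<open>t\<close> alone and precedes the choice of the sequence:
  it holds the positions whose level is taken by the target's distribution function on a set of
  positive length.\<close>

lemma Tclip_tendsto:
  assumes t: "t \<in> {0..<1}" and R: "R \<ge> 0"
  shows "AE x in \<rho> t. \<forall>S. (\<forall>n. S n \<in> {0..<1}) \<longrightarrow> S \<longlonglongrightarrow> t \<longrightarrow> (\<lambda>n. Tclip R \<theta> (S n) (\<theta> \<bullet> x)) \<longlonglongrightarrow> Tclip R \<theta> t (\<theta> \<bullet> x)"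
  using AE_proj[OF cdf_values_differ[OF real_distribution_proj atomless_proj[OF theta_nonzero t]]]
  by eventually_elim
    (auto simp: Tclip_def intro!: clipped_quantile_tendsto[OF R real_distribution_proj(2)] cdf_proj_tendsto[OF t])

text \<open>Without atoms the distribution function is continuous, so its composition with
  \<open>smooth_quantile\<close> is continuous too, as \<open>has_increments_ridge\<close> asks of
  the approximants.\<close>

lemma has_increments_Tclip:
  assumes t: "t \<in> {0..<1}" and R: "R \<ge> 0"
  shows "has_increments (\<lambda>x. primitive (\<lambda>s. 2 * (s - Tclip R \<theta> t s)) (\<theta> \<bullet> x))
    (\<lambda>x. (2 * (\<theta> \<bullet> x - Tclip R \<theta> t (\<theta> \<bullet> x))) *\<^sub>R \<theta>)"
proof (rule has_increments_ridge[OF \<theta>])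
  let ?F = "cdf (proj_measure \<theta> (\<rho> t))"
  let ?f = "\<lambda>n s. smooth_quantile n R (proj_measure \<theta> \<rho>1) (?F s)"
  note q = smooth_quantile_continuous[OF R real_distribution_proj(2)]
  have "continuous_on UNIV ?F"
    using atomless_proj[OF theta_nonzero t]
      finite_borel_measure.isCont_cdf[OF real_distribution.finite_borel_measure_M[OF real_distribution_proj(1)]]
    by (intro continuous_at_imp_continuous_on) simp
  then have c: "continuous_on UNIV (?f n)" for n by (rule continuous_on_compose2[OF q]) auto
  then show "continuous_on UNIV (\<lambda>s. 2 * (s - ?f n s))" for n by (intro continuous_intros)
  show "linear_growth (2 * (1 + R)) (\<lambda>s. 2 * (s - ?f n s))" for n
    by (rule displacement_growth[OF borel_measurable_continuous_onI[OF c]])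
      (rule smooth_quantile_bound[OF R real_distribution_proj(2)])
  show "(\<lambda>n. 2 * (s - ?f n s)) \<longlonglongrightarrow> 2 * (s - Tclip R \<theta> t s)" for s
    unfolding Tclip_def by (intro tendsto_intros smooth_quantile_tendsto[OF R real_distribution_proj(2)])
  show "linear_growth (2 * (1 + R)) (\<lambda>s. 2 * (s - Tclip R \<theta> t s))"
    by (rule displacement_growth) (use Tclip_bound[OF R] in measurable)
qed

definition cost_clip :: "real \<Rightarrow> real \<Rightarrow> real" where
  "cost_clip R t = (LINT x|\<rho> t. (\<theta> \<bullet> x - Tclip R \<theta> t (\<theta> \<bullet> x))\<^sup>2)"

text \<open>The potential of time \<open>t\<close> is admissible at time \<open>s\<close>. Expanding
  the square, the cost is a second moment, minus twice a correlation, plus a term of the target that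
  cancels in the difference; \<open>monotone_correlation_le\<close> compares the
  correlations.\<close>

lemma cost_clip_increment_ge:
  assumes t: "t \<in> {0..<1}" and s: "s \<in> {0..<1}" and R: "R \<ge> 0"
  shows "(LINT x|\<rho> s. primitive (\<lambda>s. 2 * (s - Tclip R \<theta> t s)) (\<theta> \<bullet> x)) -
      (LINT x|\<rho> t. primitive (\<lambda>s. 2 * (s - Tclip R \<theta> t s)) (\<theta> \<bullet> x)) \<le> cost_clip R s - cost_clip R t"
proof -
  note b = Tclip_bound[OF R, of \<theta>]
  note m = Tclip_mono[OF R, of \<theta>]
  note g = bounded_mono_growth[OF m b]
  note [measurable] = linear_growth_measurable[OF g] primitive_measurable[OF g]
  have dom: "norm (x * y) \<le> norm (R * \<bar>x\<bar>)" if "\<bar>y\<bar> \<le> R" for x y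
    using mult_left_mono[OF that abs_ge_zero[of x]] R by (simp add: abs_mult mult.commute)
  have iT: "integrable (\<rho> r) (\<lambda>x. (\<theta> \<bullet> x) * Tclip R \<theta> r (\<theta> \<bullet> x))" if "r \<in> {0..<1}" for r
    by (rule Bochner_Integration.integrable_bound[OF integrable_mult_right[of R, OF proj_square_integrable(2)[OF that]]])
      (use dom[OF b] in auto)
  have iP: "integrable (\<rho> r) (\<lambda>x. primitive (Tclip R \<theta> t) (\<theta> \<bullet> x))" if "r \<in> {0..<1}" for r
  proof (rule Bochner_Integration.integrable_bound)
    interpret prob_space "\<rho> r" by (rule prob_rho)
    show "integrable (\<rho> r) (\<lambda>x. R * (2 * (1 + (\<theta> \<bullet> x)\<^sup>2)))" using proj_square_integrable(1)[OF that] by simp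
    have "\<bar>primitive (Tclip R \<theta> t) (\<theta> \<bullet> x)\<bar> \<le> R * (2 * (1 + (\<theta> \<bullet> x)\<^sup>2))" for x
    proof -
      have "\<bar>primitive (Tclip R \<theta> t) (\<theta> \<bullet> x)\<bar> \<le> R * ((1 + \<bar>\<theta> \<bullet> x\<bar>) * \<bar>\<theta> \<bullet> x\<bar>)"
        using primitive_bound[OF g, of t "\<theta> \<bullet> x"] by (simp only: mult.assoc)
      also have "\<dots> \<le> R * (2 * (1 + \<bar>\<theta> \<bullet> x\<bar>\<^sup>2))" by (intro mult_left_mono one_plus_mult_le R)
      finally show ?thesis by simp
    qed
    then show "AE x in \<rho> r. norm (primitive (Tclip R \<theta> t) (\<theta> \<bullet> x)) \<le> norm (R * (2 * (1 + (\<theta> \<bullet> x)\<^sup>2)))"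
      using order_trans[OF _ abs_ge_self] by fastforce
  qed simp
  have i2: "integrable (\<rho> r) (\<lambda>x. (Tclip R \<theta> r (\<theta> \<bullet> x))\<^sup>2)" for r
  proof -
    interpret prob_space "\<rho> r" by (rule prob_rho)
    show ?thesis
      by (rule integrable_const_bound[of _ "R\<^sup>2"]) (use b in \<open>auto simp: abs_le_square_iff[symmetric] R\<close>)
  qed
  have cost: "cost_clip R r = (LINT x|\<rho> r. (\<theta> \<bullet> x)\<^sup>2) - 2 * (LINT x|\<rho> r. (\<theta> \<bullet> x) * Tclip R \<theta> r (\<theta> \<bullet> x))
      + (LINT x|\<rho>1. (clip R (\<theta> \<bullet> x))\<^sup>2)" if r: "r \<in> {0..<1}" for r
  proof -
    have "(LINT x|\<rho> r. (Tclip R \<theta> r (\<theta> \<bullet> x))\<^sup>2) = (LINT s|distr (proj_measure \<theta> (\<rho> r)) borel (Tclip R \<theta> r). s\<^sup>2)"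
      by (subst integral_distr) (auto simp: integral_proj sets_proj cong: measurable_cong_sets)
    also have "\<dots> = (LINT x|\<rho>1. (clip R (\<theta> \<bullet> x))\<^sup>2)"
      unfolding distr_Tclip[OF r R] by (subst integral_distr) (auto simp: integral_proj sets_proj cong: measurable_cong_sets)
    finally have T2: "(LINT x|\<rho> r. (Tclip R \<theta> r (\<theta> \<bullet> x))\<^sup>2) = (LINT x|\<rho>1. (clip R (\<theta> \<bullet> x))\<^sup>2)" .
    have "cost_clip R r = (LINT x|\<rho> r. (\<theta> \<bullet> x)\<^sup>2 - 2 * ((\<theta> \<bullet> x) * Tclip R \<theta> r (\<theta> \<bullet> x)) + (Tclip R \<theta> r (\<theta> \<bullet> x))\<^sup>2)"
      unfolding cost_clip_def by (intro Bochner_Integration.integral_cong) (auto simp: power2_diff)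
    then show ?thesis
      using proj_square_integrable(1)[OF r] iT[OF r] i2 T2 by simp
  qed
  have prim: "(LINT x|\<rho> r. primitive (\<lambda>s. 2 * (s - Tclip R \<theta> t s)) (\<theta> \<bullet> x)) =
      (LINT x|\<rho> r. (\<theta> \<bullet> x)\<^sup>2) - 2 * (LINT x|\<rho> r. primitive (Tclip R \<theta> t) (\<theta> \<bullet> x))" if r: "r \<in> {0..<1}" for r
    unfolding primitive_twice_diff[OF g] using proj_square_integrable(1)[OF r] iP[OF r] by simp
  have ip: "integrable (proj_measure \<theta> (\<rho> r)) (\<lambda>x. \<bar>x\<bar>)" if "r \<in> {0..<1}" for r
    unfolding proj_measure_def using proj_square_integrable(2)[OF that] by (subst integrable_distr_eq) auto
  have "(LINT x|proj_measure \<theta> (\<rho> s). x * Tclip R \<theta> s x) - (LINT x|proj_measure \<theta> (\<rho> s). primitive (Tclip R \<theta> t) x)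
      \<le> (LINT x|proj_measure \<theta> (\<rho> t). x * Tclip R \<theta> t x) - (LINT x|proj_measure \<theta> (\<rho> t). primitive (Tclip R \<theta> t) x)"
    by (rule monotone_correlation_le[OF m b real_distribution_proj(1) ip[OF t] real_distribution_proj(1) ip[OF s] _ b])
      (simp_all add: distr_Tclip[OF s R] distr_Tclip[OF t R])
  then show ?thesis unfolding cost[OF s] cost[OF t] prim[OF s] prim[OF t] by (simp add: integral_proj)
qed

lemma cost_clip_increment:
  assumes ab: "0 \<le> a" "a \<le> b" "b < 1" and R: "R \<ge> 0"
  shows "cost_clip R b - cost_clip R a =
    (LINT t:{a..b}|lborel. LINT x|\<rho> t. 2 * (\<theta> \<bullet> x - Tclip R \<theta> t (\<theta> \<bullet> x)) * (\<theta> \<bullet> v t x))"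
proof -
  define k where "k s t = (LINT x|\<rho> t. 2 * (\<theta> \<bullet> x - Tclip R \<theta> s (\<theta> \<bullet> x)) * (\<theta> \<bullet> v t x))" for s t
  have K: "2 * (1 + R) \<ge> 0" using R by simp
  define w where "w t x = 2 * (1 + R) * (1 + (norm x)\<^sup>2 + (norm (v t x))\<^sup>2)" for t x
  note fin = quadratic_energy_finite[OF ab(1,3) K, folded w_def]
  have wm: "(\<lambda>z. w (fst z) (snd z)) \<in> borel_measurable (borel \<Otimes>\<^sub>M borel)" unfolding w_def by measurable
  have Am: "{a..b} \<in> sets lborel" by simp
  note wm' = wm[folded measurable_prod_borel]
  have dom: "\<bar>2 * (\<theta> \<bullet> x - Tclip R \<theta> s (\<theta> \<bullet> x)) * (\<theta> \<bullet> v t x)\<bar> \<le> w t x" for s t x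
  proof -
    have "\<bar>2 * (\<theta> \<bullet> x - Tclip R \<theta> s (\<theta> \<bullet> x))\<bar> \<le> 2 * (1 + R) * (1 + \<bar>\<theta> \<bullet> x\<bar>)"
      using displacement_growth[of "Tclip R \<theta> s" R] Tclip_bound[OF R] by (auto simp: linear_growth_def)
    also have "\<dots> \<le> 2 * (1 + R) * (1 + norm x)" using abs_inner_unit_le[OF \<theta>, of x] K by (intro mult_left_mono) auto
    finally have "\<bar>2 * (\<theta> \<bullet> x - Tclip R \<theta> s (\<theta> \<bullet> x)) * (\<theta> \<bullet> v t x)\<bar> \<le> (2 * (1 + R) * (1 + norm x)) * norm (v t x)"
      unfolding abs_mult[of _ "\<theta> \<bullet> v t x"] using abs_inner_unit_le[OF \<theta>, of "v t x"] K by (intro mult_mono) auto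
    also have "\<dots> \<le> w t x"
      unfolding w_def mult.assoc[of _ "1 + norm x"] using K by (intro mult_left_mono one_plus_mult_le)
    finally show ?thesis .
  qed
  have fm: "(\<lambda>z. 2 * (\<theta> \<bullet> snd z - Tclip R \<theta> s (\<theta> \<bullet> snd z)) * (\<theta> \<bullet> v (fst z) (snd z))) \<in> borel_measurable (borel \<Otimes>\<^sub>M borel)" for s
    by measurable
  note fm' = fm[folded measurable_prod_borel]
  show ?thesis
    unfolding k_def[symmetric]
  proof (rule increment_eq_diagonal_integral[where k = k and H = "cost_clip R"
        and w = "\<lambda>t. enn2real (\<integral>\<^sup>+x. ennreal (w t x) \<partial>\<rho> t)", OF ab(2)])
    show "k s \<in> borel_measurable borel" for s
      unfolding k_def by (rule integral_measurable_kernel[OF kernel fm])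
    show "(\<lambda>t. k t t) \<in> borel_measurable borel"
      unfolding k_def by (rule integral_measurable_kernel[OF kernel]) measurable
    show "set_integrable lborel {a..b} (\<lambda>t. enn2real (\<integral>\<^sup>+x. ennreal (w t x) \<partial>\<rho> t))"
      by (rule integrable_kernel_bound[OF kernel_lborel Am wm' fin])
    note AEf = AE_kernel_finite[OF kernel_lborel Am wm' fin]
    show "AE t in lborel. t \<in> {a..b} \<longrightarrow> (\<forall>s\<in>{a..b}. \<bar>k s t\<bar> \<le> enn2real (\<integral>\<^sup>+x. ennreal (w t x) \<partial>\<rho> t))"
      using AEf
    proof eventually_elim
      case (elim t)
      show ?case
        unfolding k_def
        using kernel_dominated_section(2)[OF kernel_lborel Am wm' fin fm', of t] dom elim by auto
    qed
    show "AE t in lborel. t \<in> {a..b} \<longrightarrow>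
      (\<forall>S. (\<forall>n. S n \<in> {a..b}) \<longrightarrow> S \<longlonglongrightarrow> t \<longrightarrow> (\<lambda>n. k (S n) t) \<longlonglongrightarrow> k t t)"
      using AEf
    proof eventually_elim
      case (elim t)
      show ?case
      proof (intro impI allI)
        fix S :: "nat \<Rightarrow> real" assume t: "t \<in> {a..b}" and S: "\<forall>n. S n \<in> {a..b}" "S \<longlonglongrightarrow> t"
        have t01: "t \<in> {0..<1}" using t ab by auto
        have S01: "\<forall>n. S n \<in> {0..<1}" using S(1) ab by (auto intro: order_trans le_less_trans)
        have [measurable]: "w t \<in> borel_measurable borel" unfolding w_def by measurable
        have wpos: "w t x \<ge> 0" for x using K by (simp add: w_def)
        show "(\<lambda>n. k (S n) t) \<longlonglongrightarrow> k t t"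
          unfolding k_def
        proof (rule integral_dominated_convergence[where w = "w t"])
          show "integrable (\<rho> t) (w t)" using elim t wpos by (auto simp: integrable_iff_bounded)
          show "AE x in \<rho> t. (\<lambda>n. 2 * (\<theta> \<bullet> x - Tclip R \<theta> (S n) (\<theta> \<bullet> x)) * (\<theta> \<bullet> v t x))
              \<longlonglongrightarrow> 2 * (\<theta> \<bullet> x - Tclip R \<theta> t (\<theta> \<bullet> x)) * (\<theta> \<bullet> v t x)"
            using Tclip_tendsto[OF t01 R]
          proof eventually_elim
            case (elim x)
            then have "(\<lambda>n. Tclip R \<theta> (S n) (\<theta> \<bullet> x)) \<longlonglongrightarrow> Tclip R \<theta> t (\<theta> \<bullet> x)" using S01 S(2) by blast
            then show ?case by (intro tendsto_intros)
          qed
        qed (use dom in auto)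
      qed
    qed
    have inc: "(LINT x|\<rho> t. primitive (\<lambda>s. 2 * (s - Tclip R \<theta> r s)) (\<theta> \<bullet> x)) -
        (LINT x|\<rho> s. primitive (\<lambda>s. 2 * (s - Tclip R \<theta> r s)) (\<theta> \<bullet> x)) = (LINT u:{s..t}|lborel. k r u)"
      if "a \<le> s" "s \<le> t" "t \<le> b" "r \<in> {0..<1}" for s t r
      using has_increments_Tclip[OF that(4) R] that ab unfolding has_increments_def k_def by auto
    fix s t assume st: "a \<le> s" "s \<le> t" "t \<le> b"
    then have s01: "s \<in> {0..<1}" and t01: "t \<in> {0..<1}" using ab by auto
    \<comment> \<open>The same comparison is used twice: with the potential of the earlier time it
      is a lower bound, and with the roles of the two times exchanged the change of sign makes it an
      upper bound.\<close>
    show "(LINT u:{s..t}|lborel. k s u) \<le> cost_clip R t - cost_clip R s"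
      using cost_clip_increment_ge[OF s01 t01 R] inc[OF st s01] by simp
    show "cost_clip R t - cost_clip R s \<le> (LINT u:{s..t}|lborel. k t u)"
      using cost_clip_increment_ge[OF t01 s01 R] inc[OF st t01] by simp
  qed
qed

end

end

section \<open>Isotropy of the sphere measure\<close>

lemma sets_sphere_measure [simp, measurable_cong]: "sets sphere_measure = sets borel"
  by (simp add: sphere_measure_def)

lemma space_sphere_measure [simp]: "space sphere_measure = UNIV"
  by (simp add: sphere_measure_def)

text \<open>A linear isometry preserves the unit ball and commutes with \<open>sgn\<close>.
  Invariance of Lebesgue measure is kept as an assumption, to be checked for sign flips and
  coordinate swaps, from which isotropy already follows.\<close>

lemma lborel_preserving_isometry_sphere:
  fixes f :: "'a::euclidean_space \<Rightarrow> 'a"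
  assumes lin: "linear f" and nf: "\<And>x. norm (f x) = norm x" and lb: "distr lborel borel f = lborel"
  shows "distr sphere_measure borel f = (sphere_measure :: 'a measure)"
proof (rule measure_eqI)
  have [measurable]: "f \<in> borel_measurable borel"
    using lin by (simp add: linear_continuous_on linear_conv_bounded_linear borel_measurable_continuous_onI)
  have sg: "sgn (f x) = f (sgn x)" for x using lin nf by (simp add: sgn_div_norm linear_cmul)
  fix A assume "A \<in> sets (distr (sphere_measure :: 'a measure) borel f)"
  then have A [measurable]: "A \<in> sets borel" by simp
  have fA [measurable]: "sgn -` A \<in> sets borel" "f -` A \<in> sets borel"
    by (auto intro!: measurable_sets_borel[OF _ A])
  have [measurable]: "sgn -` (f -` A) \<in> sets borel"
    by (rule measurable_sets_borel[OF sgn_borel_measurable fA(2)])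
  have "emeasure lborel (ball 0 1 \<inter> sgn -` A) = emeasure (distr lborel borel f) (ball 0 1 \<inter> sgn -` A)"
    unfolding lb ..
  also have "\<dots> = emeasure lborel (f -` (ball 0 1 \<inter> sgn -` A))"
    by (subst emeasure_distr) auto
  also have "f -` (ball 0 1 \<inter> sgn -` A) = ball 0 1 \<inter> sgn -` (f -` A)"
    by (auto simp: nf sg)
  finally show "emeasure (distr sphere_measure borel f) A = emeasure (sphere_measure :: 'a measure) A"
    by (simp add: sphere_measure_def emeasure_distr del: vimage_comp)
qed simp

lemma sphere_measure_integral_isometry:
  fixes f :: "'a::euclidean_space \<Rightarrow> 'a" and h :: "'a \<Rightarrow> real"
  assumes "linear f" "\<And>x. norm (f x) = norm x" "distr lborel borel f = lborel" and [measurable]: "h \<in> borel_measurable borel"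
  shows "(LINT \<theta>|sphere_measure. h (f \<theta>)) = (LINT \<theta>|sphere_measure. h \<theta>)"
proof -
  have [measurable]: "f \<in> borel_measurable borel"
    using assms(1) by (simp add: linear_continuous_on linear_conv_bounded_linear borel_measurable_continuous_onI)
  have "(LINT \<theta>|distr sphere_measure borel f. h \<theta>) = (LINT \<theta>|sphere_measure. h (f \<theta>))"
    by (rule integral_distr) auto
  then show ?thesis unfolding lborel_preserving_isometry_sphere[OF assms(1-3)] by simp
qed

definition flip :: "'a::euclidean_space \<Rightarrow> 'a \<Rightarrow> 'a" where
  "flip i x = (\<Sum>b\<in>Basis. ((if b = i then - 1 else 1) * (x \<bullet> b)) *\<^sub>R b)"

definition swap_coords :: "'a::euclidean_space \<Rightarrow> 'a \<Rightarrow> 'a \<Rightarrow> 'a" where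
  "swap_coords i j x = (\<Sum>b\<in>Basis. (x \<bullet> Transposition.transpose i j b) *\<^sub>R b)"

lemma flip_inner: "b \<in> Basis \<Longrightarrow> flip i x \<bullet> b = (if b = i then - (x \<bullet> b) else x \<bullet> b)"
  by (simp add: flip_def)

lemma swap_coords_inner: "b \<in> Basis \<Longrightarrow> swap_coords i j x \<bullet> b = x \<bullet> Transposition.transpose i j b"
  by (simp add: swap_coords_def)

lemma transpose_Basis: "i \<in> Basis \<Longrightarrow> j \<in> Basis \<Longrightarrow> b \<in> Basis \<Longrightarrow> Transposition.transpose i j b \<in> Basis"
  by (auto simp: Transposition.transpose_def)

lemma sum_transpose_Basis:
  "i \<in> Basis \<Longrightarrow> j \<in> Basis \<Longrightarrow> (\<Sum>b\<in>Basis. f (Transposition.transpose i j b)) = (\<Sum>b\<in>Basis. f b)"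
  "i \<in> Basis \<Longrightarrow> j \<in> Basis \<Longrightarrow> (\<Prod>b\<in>Basis. g (Transposition.transpose i j b)) = (\<Prod>b\<in>Basis. g b)"
  by (rule sum.reindex_bij_witness[where i = "Transposition.transpose i j" and j = "Transposition.transpose i j"], auto simp: transpose_Basis)
    (rule prod.reindex_bij_witness[where i = "Transposition.transpose i j" and j = "Transposition.transpose i j"], auto simp: transpose_Basis)

text \<open>A sign flip is a diagonal map with entries of modulus 1, so the change of variables has
  density 1.\<close>

lemma flip_isometry:
  "linear (flip i)" "norm (flip i x) = norm x" "distr lborel borel (flip i) = lborel"
proof -
  show "linear (flip i)"
    by (rule linearI) (auto simp: flip_def inner_add_left algebra_simps sum.distrib scaleR_sum_right intro!: sum.cong)
  show "norm (flip i x) = norm x"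
    unfolding norm_eq_sqrt_inner
    by (subst (1 2) euclidean_inner) (auto simp: flip_inner intro!: sum.cong arg_cong[where f = sqrt])
  have "lborel = density (distr lborel borel (flip i)) (\<lambda>_. (\<Prod>j\<in>Basis. \<bar>if j = i then - 1 else 1 :: real\<bar>))"
    using lborel_affine_euclidean[of "\<lambda>j. if j = i then - 1 else 1" 0] by (simp add: flip_def[abs_def])
  also have "(\<Prod>j\<in>Basis. \<bar>if j = i then - 1 else 1 :: real\<bar>) = 1" by (rule prod.neutral) auto
  finally show "distr lborel borel (flip i) = lborel" by (simp add: density_1)
qed

text \<open>Lebesgue measure is recognised on boxes: the preimage of a box is the box with two sides
  exchanged, which has the same volume.\<close>

lemma swap_isometry:
  assumes i: "i \<in> Basis" and j: "j \<in> Basis"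
  shows "linear (swap_coords i j)" "norm (swap_coords i j x) = norm x" "distr lborel borel (swap_coords i j) = lborel"
proof -
  show lin: "linear (swap_coords i j)"
    by (rule linearI) (auto simp: swap_coords_def inner_add_left algebra_simps sum.distrib scaleR_sum_right intro!: sum.cong)
  show "norm (swap_coords i j x) = norm x"
    unfolding norm_eq_sqrt_inner
    by (subst (1 2) euclidean_inner)
      (use sum_transpose_Basis(1)[OF i j, of "\<lambda>b. (x \<bullet> b) * (x \<bullet> b)"] in \<open>simp add: swap_coords_inner\<close>)
  have [measurable]: "swap_coords i j \<in> borel_measurable borel"
    using lin by (simp add: linear_continuous_on linear_conv_bounded_linear borel_measurable_continuous_onI)
  show "distr lborel borel (swap_coords i j) = lborel"
  proof (rule lborel_eqI[symmetric])
    fix l u :: 'a assume lu: "\<And>b. b \<in> Basis \<Longrightarrow> l \<bullet> b \<le> u \<bullet> b"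
    have "swap_coords i j -` box l u = box (swap_coords i j l) (swap_coords i j u)"
    proof (intro set_eqI)
      fix x
      have "x \<in> box (swap_coords i j l) (swap_coords i j u) \<longleftrightarrow>
          (\<forall>b\<in>Basis. l \<bullet> Transposition.transpose i j b < x \<bullet> b \<and> x \<bullet> b < u \<bullet> Transposition.transpose i j b)"
        by (auto simp: mem_box swap_coords_inner)
      also have "\<dots> \<longleftrightarrow> (\<forall>b\<in>Basis. l \<bullet> b < x \<bullet> Transposition.transpose i j b \<and> x \<bullet> Transposition.transpose i j b < u \<bullet> b)"
        by (metis transpose_Basis[OF i j] transpose_involutory)
      also have "\<dots> \<longleftrightarrow> x \<in> swap_coords i j -` box l u" by (auto simp: mem_box swap_coords_inner)
      finally show "x \<in> swap_coords i j -` box l u \<longleftrightarrow> x \<in> box (swap_coords i j l) (swap_coords i j u)" by simp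
    qed
    then have "emeasure (distr lborel borel (swap_coords i j)) (box l u) = emeasure lborel (box (swap_coords i j l) (swap_coords i j u))"
      by (subst emeasure_distr) auto
    also have "\<dots> = (\<Prod>b\<in>Basis. (swap_coords i j u - swap_coords i j l) \<bullet> b)"
      using lu transpose_Basis[OF i j] by (intro emeasure_lborel_box) (auto simp: swap_coords_inner)
    also have "(\<Prod>b\<in>Basis. (swap_coords i j u - swap_coords i j l) \<bullet> b) = (\<Prod>b\<in>Basis. (u - l) \<bullet> Transposition.transpose i j b)"
      by (intro prod.cong) (auto simp: inner_diff_left swap_coords_inner)
    also have "\<dots> = (\<Prod>b\<in>Basis. (u - l) \<bullet> b)" by (rule sum_transpose_Basis(2)[OF i j])
    finally show "emeasure (distr lborel borel (swap_coords i j)) (box l u) = (\<Prod>b\<in>Basis. (u - l) \<bullet> b)" .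
  qed simp
qed

text \<open>Reflecting one coordinate shows that the mixed second moments vanish, swapping two
  coordinates that the pure ones agree, and on the sphere the pure ones add up to 1.\<close>

lemma sphere_measure_isotropic:
  fixes w :: "'a::euclidean_space"
  shows "(LINT \<theta>|sphere_measure. (\<theta> \<bullet> w)\<^sup>2) = (norm w)\<^sup>2 / real DIM('a)"
proof -
  interpret S: prob_space "sphere_measure :: 'a measure" by (rule prob_space_sphere_measure)
  have int: "integrable sphere_measure (\<lambda>\<theta>. (\<theta> \<bullet> x) * (\<theta> \<bullet> y))" for x y :: 'a
  proof (rule S.integrable_const_bound[of _ "norm x * norm y"])
    show "AE \<theta> in sphere_measure. norm ((\<theta> \<bullet> x) * (\<theta> \<bullet> y)) \<le> norm x * norm y"
      using AE_sphere_measure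
    proof eventually_elim
      case (elim \<theta>)
      then show ?case
        using Cauchy_Schwarz_ineq2[of \<theta> x] Cauchy_Schwarz_ineq2[of \<theta> y] by (simp add: abs_mult mult_mono)
    qed
  qed measurable
  have off: "(LINT \<theta>|sphere_measure. (\<theta> \<bullet> i) * (\<theta> \<bullet> j)) = 0" if "i \<in> Basis" "j \<in> Basis" "i \<noteq> j" for i j :: 'a
  proof -
    have "(LINT \<theta>|sphere_measure. (flip i \<theta> \<bullet> i) * (flip i \<theta> \<bullet> j)) = (LINT \<theta>|sphere_measure. (\<theta> \<bullet> i) * (\<theta> \<bullet> j))"
      by (rule sphere_measure_integral_isometry[OF flip_isometry]) measurable
    then show ?thesis using that by (simp add: flip_inner)
  qed
  have diag: "(LINT \<theta>|sphere_measure. (\<theta> \<bullet> i) * (\<theta> \<bullet> i)) = (LINT \<theta>|sphere_measure. (\<theta> \<bullet> j) * (\<theta> \<bullet> j))"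
    if "i \<in> Basis" "j \<in> Basis" for i j :: 'a
  proof -
    have "(LINT \<theta>|sphere_measure. (swap_coords i j \<theta> \<bullet> i) * (swap_coords i j \<theta> \<bullet> i)) = (LINT \<theta>|sphere_measure. (\<theta> \<bullet> i) * (\<theta> \<bullet> i))"
      by (rule sphere_measure_integral_isometry[OF swap_isometry[OF that]]) measurable
    then show ?thesis using that by (simp add: swap_coords_inner)
  qed
  have one: "(LINT \<theta>|sphere_measure. (\<theta> \<bullet> i) * (\<theta> \<bullet> i)) = 1 / real DIM('a)" if i: "i \<in> Basis" for i :: 'a
  proof -
    have "real DIM('a) * (LINT \<theta>|sphere_measure. (\<theta> \<bullet> i) * (\<theta> \<bullet> i)) = (\<Sum>b\<in>(Basis :: 'a set). LINT \<theta>|sphere_measure. (\<theta> \<bullet> b) * (\<theta> \<bullet> b))"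
      unfolding sum_constant[symmetric] by (intro sum.cong refl diag i)
    also have "\<dots> = (LINT \<theta>|sphere_measure. (\<Sum>b\<in>(Basis :: 'a set). (\<theta> \<bullet> b) * (\<theta> \<bullet> b)))"
      by (rule Bochner_Integration.integral_sum[symmetric]) (rule int)
    also have "\<dots> = (LINT \<theta>|(sphere_measure :: 'a measure). 1)"
    proof (rule integral_cong_AE)
      show "AE \<theta> in (sphere_measure :: 'a measure). (\<Sum>b\<in>Basis. (\<theta> \<bullet> b) * (\<theta> \<bullet> b)) = 1"
        using AE_sphere_measure
        by eventually_elim (simp add: euclidean_inner[symmetric] norm_eq_1)
    qed measurable
    also have "\<dots> = 1" using S.prob_space by simp
    finally show ?thesis by (simp add: field_simps)
  qed
  have "(LINT \<theta>|sphere_measure. (\<theta> \<bullet> w)\<^sup>2) =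
      (LINT \<theta>|sphere_measure. (\<Sum>i\<in>Basis. \<Sum>j\<in>Basis. (w \<bullet> i) * (w \<bullet> j) * ((\<theta> \<bullet> i) * (\<theta> \<bullet> j))))"
  proof (rule Bochner_Integration.integral_cong[OF refl])
    fix \<theta> :: 'a
    have "\<theta> \<bullet> w = (\<Sum>i\<in>Basis. (\<theta> \<bullet> i) * (w \<bullet> i))" by (rule euclidean_inner)
    then show "(\<theta> \<bullet> w)\<^sup>2 = (\<Sum>i\<in>Basis. \<Sum>j\<in>Basis. (w \<bullet> i) * (w \<bullet> j) * ((\<theta> \<bullet> i) * (\<theta> \<bullet> j)))"
      by (simp add: power2_eq_square sum_product mult_ac)
  qed
  also have "\<dots> = (\<Sum>i\<in>Basis. \<Sum>j\<in>Basis. (w \<bullet> i) * (w \<bullet> j) * (LINT \<theta>|sphere_measure. (\<theta> \<bullet> i) * (\<theta> \<bullet> j)))"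
    using int by (subst Bochner_Integration.integral_sum, simp, subst Bochner_Integration.integral_sum) auto
  also have "\<dots> = (\<Sum>i\<in>Basis. \<Sum>j\<in>Basis. (if i = j then (w \<bullet> i) * (w \<bullet> i) / real DIM('a) else 0))"
    by (intro sum.cong) (auto simp: off one)
  also have "\<dots> = (\<Sum>i\<in>Basis. (w \<bullet> i) * (w \<bullet> i)) / real DIM('a)"
    by (simp add: sum_divide_distrib)
  also have "(\<Sum>i\<in>Basis. (w \<bullet> i) * (w \<bullet> i)) = (norm w)\<^sup>2"
    by (simp add: euclidean_inner[symmetric] power2_norm_eq_inner)
  finally show ?thesis .
qed

lemma young_weighted:
  fixes a b n :: real
  assumes "n > 0"
  shows "a * b \<le> a\<^sup>2 / (2 * n) + n / 2 * b\<^sup>2"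
proof -
  have "2 * (a * (n * b)) \<le> a\<^sup>2 + (n * b)\<^sup>2" by (rule two_mult_le_squares)
  then show ?thesis using assms by (simp add: field_simps power2_eq_square)
qed

lemma displacement_square_le: "(\<theta> \<bullet> x - q)\<^sup>2 \<le> 2 * ((norm x)\<^sup>2 + q\<^sup>2)" if "norm \<theta> = 1" for \<theta> x :: "'a::euclidean_space"
proof -
  have "(\<theta> \<bullet> x - q)\<^sup>2 \<le> 2 * ((\<theta> \<bullet> x)\<^sup>2 + q\<^sup>2)"
    using two_mult_le_squares[of "\<theta> \<bullet> x" "- q"] by (simp add: power2_diff)
  moreover have "(\<theta> \<bullet> x)\<^sup>2 \<le> (norm x)\<^sup>2"
    using abs_inner_unit_le[OF that, of x] by (simp add: abs_le_square_iff[symmetric])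
  ultimately show ?thesis by simp
qed

lemma displacement_velocity_le:
  fixes \<theta> :: "'a::euclidean_space"
  assumes \<theta>: "norm \<theta> = 1"
  shows "\<bar>2 * (\<theta> \<bullet> x - q) * (\<theta> \<bullet> w)\<bar> \<le> 2 * (1 + ((norm x)\<^sup>2 + q\<^sup>2) + (norm w)\<^sup>2)"
proof -
  have "\<bar>2 * (\<theta> \<bullet> x - q) * (\<theta> \<bullet> w)\<bar> = 2 * (\<bar>\<theta> \<bullet> x - q\<bar> * \<bar>\<theta> \<bullet> w\<bar>)"
    by (simp only: abs_mult abs_numeral mult.assoc)
  also have "\<dots> \<le> \<bar>\<theta> \<bullet> x - q\<bar>\<^sup>2 + \<bar>\<theta> \<bullet> w\<bar>\<^sup>2" by (rule two_mult_le_squares)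
  also have "\<dots> \<le> 2 * ((norm x)\<^sup>2 + q\<^sup>2) + (norm w)\<^sup>2"
  proof -
    have "(\<theta> \<bullet> w)\<^sup>2 \<le> (norm w)\<^sup>2"
      using abs_inner_unit_le[OF \<theta>, of w] by (simp add: abs_le_square_iff[symmetric])
    then show ?thesis using displacement_square_le[OF \<theta>, of x q] by simp
  qed
  also have "\<dots> \<le> 2 * (1 + ((norm x)\<^sup>2 + q\<^sup>2) + (norm w)\<^sup>2)" by simp
  finally show ?thesis .
qed

section \<open>Removal of the clipping\<close>

context averaged_flow
begin

abbreviation disp :: "'a \<Rightarrow> real \<Rightarrow> 'a \<Rightarrow> real" where
  "disp \<theta> t x \<equiv> (\<theta> \<bullet> x - Tjoint \<theta> t (\<theta> \<bullet> x))"

lemma velocity_measurable_compose [measurable (raw)]: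
  assumes "g \<in> borel_measurable N" "h \<in> borel_measurable N"
  shows "(\<lambda>p. v (g p) (h p)) \<in> borel_measurable N"
  using measurable_compose[OF measurable_Pair[OF assms] velocity_measurable] by simp

definition cost :: "'a \<Rightarrow> real \<Rightarrow> real" where
  "cost \<theta> t = (LINT x|\<rho> t. (disp \<theta> t x)\<^sup>2)"

definition cost_rate :: "'a \<Rightarrow> real \<Rightarrow> real" where
  "cost_rate \<theta> t = (LINT x|\<rho> t. 2 * (disp \<theta> t x) * (\<theta> \<bullet> v t x))"

definition target_moment :: real where
  "target_moment = (LINT x|\<rho>1. (norm x)\<^sup>2)"

lemma target_square_integrable: "integrable \<rho>1 (\<lambda>x. (norm x)\<^sup>2)"
  using target by (auto simp: P2_def integrable_iff_bounded)

lemma target_moment_nonneg: "target_moment \<ge> 0"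
  unfolding target_moment_def by (rule Bochner_Integration.integral_nonneg) simp

text \<open>The map carries the projected curve to the projected target, whose second moment is at
  most that of \<open>\<rho>1\<close>. What matters is that the bound is uniform in direction and
  time.\<close>

lemma Tjoint_second_moment:
  assumes \<theta>: "norm \<theta> = 1" and t: "t \<in> {0..<1}"
  shows "(\<integral>\<^sup>+x. ennreal ((Tjoint \<theta> t (\<theta> \<bullet> x))\<^sup>2) \<partial>\<rho> t) \<le> ennreal target_moment"
proof -
  have [measurable]: "T t \<theta> \<in> borel_measurable borel"
    and push: "distr (proj_measure \<theta> (\<rho> t)) borel (T t \<theta>) = proj_measure \<theta> \<rho>1"
    using map_properties[OF \<theta> t] by (auto simp: monotone_ot_map_def)
  have "(\<integral>\<^sup>+x. ennreal ((Tjoint \<theta> t (\<theta> \<bullet> x))\<^sup>2) \<partial>\<rho> t) = (\<integral>\<^sup>+x. ennreal ((T t \<theta> (\<theta> \<bullet> x))\<^sup>2) \<partial>\<rho> t)"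
    by (rule nn_integral_cong_AE) (use AE_Tjoint[OF \<theta> t] in eventually_elim, simp)
  also have "\<dots> = (\<integral>\<^sup>+s. ennreal (s\<^sup>2) \<partial>distr (proj_measure \<theta> (\<rho> t)) borel (T t \<theta>))"
    by (simp add: proj_measure_def nn_integral_distr)
  also have "\<dots> = (\<integral>\<^sup>+x. ennreal ((\<theta> \<bullet> x)\<^sup>2) \<partial>\<rho>1)"
    unfolding push by (simp add: proj_measure_def nn_integral_distr)
  also have "\<dots> \<le> (\<integral>\<^sup>+x. ennreal ((norm x)\<^sup>2) \<partial>\<rho>1)"
    using abs_inner_unit_le[OF \<theta>] by (intro nn_integral_mono ennreal_leI) (simp add: abs_le_square_iff[symmetric])
  also have "\<dots> = ennreal target_moment"
    unfolding target_moment_def by (rule nn_integral_eq_integral[OF target_square_integrable]) simp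
  finally show ?thesis .
qed

lemma displacement_integrable:
  assumes \<theta>: "norm \<theta> = 1" and t: "t \<in> {0..<1}"
  shows "integrable (\<rho> t) (\<lambda>x. 2 * ((norm x)\<^sup>2 + (Tjoint \<theta> t (\<theta> \<bullet> x))\<^sup>2))"
    "integrable (\<rho> t) (\<lambda>x. (disp \<theta> t x)\<^sup>2)"
proof -
  have "integrable (\<rho> t) (\<lambda>x. (Tjoint \<theta> t (\<theta> \<bullet> x))\<^sup>2)"
    using Tjoint_second_moment[OF assms] by (auto simp: integrable_iff_bounded elim!: order.strict_trans1)
  then show i: "integrable (\<rho> t) (\<lambda>x. 2 * ((norm x)\<^sup>2 + (Tjoint \<theta> t (\<theta> \<bullet> x))\<^sup>2))"
    using square_integrable_rho[OF t] by simp
  show "integrable (\<rho> t) (\<lambda>x. (disp \<theta> t x)\<^sup>2)"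
    by (rule Bochner_Integration.integrable_bound[OF i])
      (use displacement_square_le[OF \<theta>] in \<open>auto intro: order_trans[OF _ abs_ge_self]\<close>)
qed

lemma joint_moment_le:
  assumes \<theta>: "norm \<theta> = 1" and t: "t \<in> {0..<1}" and S: "S \<ge> 0" "(\<integral>\<^sup>+x. ennreal ((norm x)\<^sup>2) \<partial>\<rho> t) \<le> ennreal S"
  shows "(\<integral>\<^sup>+x. ennreal ((norm x)\<^sup>2 + (Tjoint \<theta> t (\<theta> \<bullet> x))\<^sup>2) \<partial>\<rho> t) \<le> ennreal (S + target_moment)"
proof -
  have "(\<integral>\<^sup>+x. ennreal ((norm x)\<^sup>2 + (Tjoint \<theta> t (\<theta> \<bullet> x))\<^sup>2) \<partial>\<rho> t) =
      (\<integral>\<^sup>+x. ennreal ((norm x)\<^sup>2) \<partial>\<rho> t) + (\<integral>\<^sup>+x. ennreal ((Tjoint \<theta> t (\<theta> \<bullet> x))\<^sup>2) \<partial>\<rho> t)"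
    by (subst nn_integral_add[symmetric]) simp_all
  also have "\<dots> \<le> ennreal S + ennreal target_moment"
    using S(2) Tjoint_second_moment[OF \<theta> t] by (rule add_mono)
  finally show ?thesis using S(1) target_moment_nonneg by simp
qed

text \<open>Position and unclipped map both have second moments bounded on [a, b], so the majorant
  needed for letting the clipping level grow is integrable.\<close>

lemma joint_energy_finite:
  assumes \<theta>: "norm \<theta> = 1" and ab: "0 \<le> a" "a \<le> b" "b < 1"
  shows "(\<integral>\<^sup>+t\<in>{a..b}. (\<integral>\<^sup>+x. ennreal (2 * (1 + ((norm x)\<^sup>2 + (Tjoint \<theta> t (\<theta> \<bullet> x))\<^sup>2) + (norm (v t x))\<^sup>2)) \<partial>\<rho> t) \<partial>lborel) < \<infinity>"
proof -
  obtain S where S: "S \<ge> 0" "\<And>t. t \<in> {0..b} \<Longrightarrow> (\<integral>\<^sup>+x. ennreal ((norm x)\<^sup>2) \<partial>\<rho> t) \<le> ennreal S"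
    using second_moment_bounded[of b] ab by auto
  show ?thesis
  proof (rule affine_energy_finite[where h = "\<lambda>t x. (norm x)\<^sup>2 + (Tjoint \<theta> t (\<theta> \<bullet> x))\<^sup>2"])
    show "(\<integral>\<^sup>+x. ennreal ((norm x)\<^sup>2 + (Tjoint \<theta> t (\<theta> \<bullet> x))\<^sup>2) \<partial>\<rho> t) \<le> ennreal (S + target_moment)"
      if "t \<in> {a..b}" for t
      using that ab by (intro joint_moment_le[OF \<theta> _ S]) auto
  qed (use ab in auto)
qed

text \<open>Clipping does not increase the modulus, so the unclipped map provides the
  majorant.\<close>

lemma cost_clip_tendsto:
  assumes \<theta>: "norm \<theta> = 1" and t: "t \<in> {0..<1}"
  shows "(\<lambda>n. cost_clip \<theta> (real n) t) \<longlonglongrightarrow> cost \<theta> t"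
  unfolding cost_clip_def[OF \<theta>] cost_def
proof (rule integral_dominated_convergence[OF _ _ displacement_integrable(1)[OF assms]])
  show "AE x in \<rho> t. (\<lambda>n. (\<theta> \<bullet> x - Tclip (real n) \<theta> t (\<theta> \<bullet> x))\<^sup>2) \<longlonglongrightarrow> (disp \<theta> t x)\<^sup>2"
    using AE_Tjoint[OF assms] by eventually_elim (auto intro!: tendsto_intros clip_tendsto)
  show "AE x in \<rho> t. norm ((\<theta> \<bullet> x - Tclip (real n) \<theta> t (\<theta> \<bullet> x))\<^sup>2) \<le> 2 * ((norm x)\<^sup>2 + (Tjoint \<theta> t (\<theta> \<bullet> x))\<^sup>2)" for n
    using AE_Tjoint[OF assms]
  proof eventually_elim
    case (elim x)
    then have "(Tclip (real n) \<theta> t (\<theta> \<bullet> x))\<^sup>2 \<le> (Tjoint \<theta> t (\<theta> \<bullet> x))\<^sup>2"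
      using abs_clip_le[of "real n" "T t \<theta> (\<theta> \<bullet> x)"] by (simp add: abs_le_square_iff[symmetric])
    then show ?case
      using displacement_square_le[OF \<theta>, of x "Tclip (real n) \<theta> t (\<theta> \<bullet> x)"] by simp
  qed
qed measurable

lemma cost_increment:
  assumes \<theta>: "norm \<theta> = 1" and ab: "0 \<le> a" "a \<le> b" "b < 1"
  shows "cost \<theta> b - cost \<theta> a = (LINT t:{a..b}|lborel. cost_rate \<theta> t)"
proof -
  have "(\<lambda>n. cost_clip \<theta> (real n) b - cost_clip \<theta> (real n) a) \<longlonglongrightarrow> cost \<theta> b - cost \<theta> a"
    using ab by (intro tendsto_intros cost_clip_tendsto[OF \<theta>]) auto
  moreover have "(\<lambda>n. LINT t:{a..b}|lborel. LINT x|\<rho> t. 2 * (\<theta> \<bullet> x - Tclip (real n) \<theta> t (\<theta> \<bullet> x)) * (\<theta> \<bullet> v t x))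
      \<longlonglongrightarrow> (LINT t:{a..b}|lborel. cost_rate \<theta> t)"
    unfolding cost_rate_def
  proof (rule kernel_dominated_convergence[OF kernel_lborel _ _ joint_energy_finite[OF \<theta> ab]])
    show "AE t in lborel. t \<in> {a..b} \<longrightarrow> (AE x in \<rho> t. \<bar>2 * (\<theta> \<bullet> x - Tclip (real n) \<theta> t (\<theta> \<bullet> x)) * (\<theta> \<bullet> v t x)\<bar>
        \<le> 2 * (1 + ((norm x)\<^sup>2 + (Tjoint \<theta> t (\<theta> \<bullet> x))\<^sup>2) + (norm (v t x))\<^sup>2))" for n
    proof (rule AE_I2, rule impI)
      fix t assume "t \<in> {a..b}"
      then have t: "t \<in> {0..<1}" using ab by auto
      show "AE x in \<rho> t. \<bar>2 * (\<theta> \<bullet> x - Tclip (real n) \<theta> t (\<theta> \<bullet> x)) * (\<theta> \<bullet> v t x)\<bar>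
          \<le> 2 * (1 + ((norm x)\<^sup>2 + (Tjoint \<theta> t (\<theta> \<bullet> x))\<^sup>2) + (norm (v t x))\<^sup>2)"
        using AE_Tjoint[OF \<theta> t]
      proof eventually_elim
        case (elim x)
        then have "(Tclip (real n) \<theta> t (\<theta> \<bullet> x))\<^sup>2 \<le> (Tjoint \<theta> t (\<theta> \<bullet> x))\<^sup>2"
          using abs_clip_le[of "real n" "T t \<theta> (\<theta> \<bullet> x)"] by (simp add: abs_le_square_iff[symmetric])
        then show ?case
          using displacement_velocity_le[OF \<theta>, of x "Tclip (real n) \<theta> t (\<theta> \<bullet> x)" "v t x"] by simp
      qed
    qed
    show "AE t in lborel. t \<in> {a..b} \<longrightarrow> (AE x in \<rho> t. (\<lambda>n. 2 * (\<theta> \<bullet> x - Tclip (real n) \<theta> t (\<theta> \<bullet> x)) * (\<theta> \<bullet> v t x))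
        \<longlonglongrightarrow> 2 * (disp \<theta> t x) * (\<theta> \<bullet> v t x))"
    proof (rule AE_I2, rule impI)
      fix t assume "t \<in> {a..b}"
      then have t: "t \<in> {0..<1}" using ab by auto
      show "AE x in \<rho> t. (\<lambda>n. 2 * (\<theta> \<bullet> x - Tclip (real n) \<theta> t (\<theta> \<bullet> x)) * (\<theta> \<bullet> v t x))
        \<longlonglongrightarrow> 2 * (disp \<theta> t x) * (\<theta> \<bullet> v t x)"
        using AE_Tjoint[OF \<theta> t] by eventually_elim (auto intro!: tendsto_intros clip_tendsto)
    qed
  qed (simp_all add: measurable_prod_borel)
  ultimately show ?thesis
    using cost_clip_increment[OF \<theta> ab] LIMSEQ_unique by simp
qed

section \<open>Averaging over the directions\<close>

definition mean_cost :: "real \<Rightarrow> real" where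
  "mean_cost t = (LINT \<theta>|sphere_measure. cost \<theta> t)"

lemma cost_nonneg: "cost \<theta> t \<ge> 0"
  unfolding cost_def by (rule Bochner_Integration.integral_nonneg) simp

lemma mean_cost_nonneg: "mean_cost t \<ge> 0"
  unfolding mean_cost_def by (rule Bochner_Integration.integral_nonneg) (rule cost_nonneg)

lemma cost_measurable: "(\<lambda>\<theta>. cost \<theta> t) \<in> borel_measurable borel"
proof -
  have "(\<lambda>\<theta>::'a. \<rho> t) \<in> borel \<rightarrow>\<^sub>M subprob_algebra borel" by measurable
  then show ?thesis unfolding cost_def by (rule integral_measurable_kernel) measurable
qed

lemma cost_rate_measurable:
  "(\<lambda>z. cost_rate (fst z) (snd z)) \<in> borel_measurable (borel \<Otimes>\<^sub>M borel)"
proof -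
  have "(\<lambda>z::'a \<times> real. \<rho> (snd z)) \<in> borel \<Otimes>\<^sub>M borel \<rightarrow>\<^sub>M subprob_algebra borel" by measurable
  then show ?thesis unfolding cost_rate_def by (rule integral_measurable_kernel) measurable
qed

lemma square_moment_obtain:
  assumes "t \<in> {0..<1}"
  obtains S where "S \<ge> 0" "(\<integral>\<^sup>+x. ennreal ((norm x)\<^sup>2) \<partial>\<rho> t) \<le> ennreal S"
proof (rule that[of "LINT x|\<rho> t. (norm x)\<^sup>2"])
  show "(\<integral>\<^sup>+x. ennreal ((norm x)\<^sup>2) \<partial>\<rho> t) \<le> ennreal (LINT x|\<rho> t. (norm x)\<^sup>2)"
    by (subst nn_integral_eq_integral[OF square_integrable_rho[OF assms]]) auto
qed (rule Bochner_Integration.integral_nonneg, simp)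

lemma displacement_integral_bound:
  assumes t: "t \<in> {0..<1}"
  obtains C where "\<And>\<theta>. norm \<theta> = 1 \<Longrightarrow> (\<integral>\<^sup>+x. ennreal ((disp \<theta> t x)\<^sup>2) \<partial>\<rho> t) \<le> ennreal C" "C \<ge> 0"
proof -
  obtain S where S: "S \<ge> 0" "(\<integral>\<^sup>+x. ennreal ((norm x)\<^sup>2) \<partial>\<rho> t) \<le> ennreal S"
    using square_moment_obtain[OF t] .
  show ?thesis
  proof (rule that[of "2 * (S + target_moment)"])
    fix \<theta> :: 'a assume \<theta>: "norm \<theta> = 1"
    have "(\<integral>\<^sup>+x. ennreal ((disp \<theta> t x)\<^sup>2) \<partial>\<rho> t) \<le>
        (\<integral>\<^sup>+x. ennreal (2 * ((norm x)\<^sup>2 + (Tjoint \<theta> t (\<theta> \<bullet> x))\<^sup>2)) \<partial>\<rho> t)"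
      by (intro nn_integral_mono ennreal_leI displacement_square_le[OF \<theta>])
    also have "\<dots> = (\<integral>\<^sup>+x. ennreal 2 * ennreal ((norm x)\<^sup>2 + (Tjoint \<theta> t (\<theta> \<bullet> x))\<^sup>2) \<partial>\<rho> t)"
      by (intro nn_integral_cong ennreal_mult) auto
    also have "\<dots> = ennreal 2 * (\<integral>\<^sup>+x. ennreal ((norm x)\<^sup>2 + (Tjoint \<theta> t (\<theta> \<bullet> x))\<^sup>2) \<partial>\<rho> t)"
      by (rule nn_integral_cmult) simp
    also have "\<dots> \<le> ennreal 2 * ennreal (S + target_moment)"
      by (intro mult_left_mono joint_moment_le[OF \<theta> t S]) simp
    also have "\<dots> = ennreal (2 * (S + target_moment))"
      using S(1) target_moment_nonneg by (intro ennreal_mult[symmetric]) auto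
    finally show "(\<integral>\<^sup>+x. ennreal ((disp \<theta> t x)\<^sup>2) \<partial>\<rho> t) \<le> ennreal (2 * (S + target_moment))" .
  qed (use S(1) target_moment_nonneg in simp)
qed

lemma integrable_cost:
  assumes t: "t \<in> {0..<1}"
  shows "integrable sphere_measure (\<lambda>\<theta>. cost \<theta> t)"
proof -
  interpret S: prob_space "sphere_measure :: 'a measure" by (rule prob_space_sphere_measure)
  obtain C where C: "\<And>\<theta>. norm \<theta> = 1 \<Longrightarrow> (\<integral>\<^sup>+x. ennreal ((disp \<theta> t x)\<^sup>2) \<partial>\<rho> t) \<le> ennreal C" "C \<ge> 0"
    using displacement_integral_bound[OF t] by blast
  show ?thesis
  proof (rule S.integrable_const_bound[of _ C])
    show "AE \<theta> in sphere_measure. norm (cost \<theta> t) \<le> C"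
      using AE_sphere_measure
    proof eventually_elim
      case (elim \<theta>)
      then have \<theta>: "norm \<theta> = 1" by simp
      have "ennreal (cost \<theta> t) = (\<integral>\<^sup>+x. ennreal ((disp \<theta> t x)\<^sup>2) \<partial>\<rho> t)"
        unfolding cost_def by (rule nn_integral_eq_integral[symmetric, OF displacement_integrable(2)[OF \<theta> t]]) simp
      then have "ennreal (cost \<theta> t) \<le> ennreal C" using C(1)[OF \<theta>] by simp
      then show ?case using C(2) cost_nonneg[of \<theta> t] by simp
    qed
  qed (use cost_measurable in \<open>simp cong: measurable_cong_sets\<close>)
qed

text \<open>Here the optimality clause of \<open>monotone_ot_map\<close> enters: the cost of the
  monotone map is \<open>W2_sq\<close> of the projections.\<close>

lemma SW2_sq_eq_mean_cost:
  assumes t: "t \<in> {0..<1}"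
  shows "SW2_sq (\<rho> t) \<rho>1 = ennreal (mean_cost t)"
proof -
  have "SW2_sq (\<rho> t) \<rho>1 = (\<integral>\<^sup>+\<theta>. ennreal (cost \<theta> t) \<partial>sphere_measure)"
    unfolding SW2_sq_def
  proof (rule nn_integral_cong_AE)
    show "AE \<theta> in sphere_measure. W2_sq (proj_measure \<theta> (\<rho> t)) (proj_measure \<theta> \<rho>1) = ennreal (cost \<theta> t)"
      using AE_sphere_measure
    proof eventually_elim
      case (elim \<theta>)
      then have \<theta>: "norm \<theta> = 1" by simp
      have [measurable]: "T t \<theta> \<in> borel_measurable borel"
        and W: "W2_sq (proj_measure \<theta> (\<rho> t)) (proj_measure \<theta> \<rho>1) = (\<integral>\<^sup>+s. ennreal ((s - T t \<theta> s)\<^sup>2) \<partial>proj_measure \<theta> (\<rho> t))"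
        using map_properties[OF \<theta> t] by (auto simp: monotone_ot_map_def)
      have "W2_sq (proj_measure \<theta> (\<rho> t)) (proj_measure \<theta> \<rho>1) = (\<integral>\<^sup>+x. ennreal ((\<theta> \<bullet> x - T t \<theta> (\<theta> \<bullet> x))\<^sup>2) \<partial>\<rho> t)"
        unfolding W by (simp add: proj_measure_def nn_integral_distr)
      also have "\<dots> = (\<integral>\<^sup>+x. ennreal ((disp \<theta> t x)\<^sup>2) \<partial>\<rho> t)"
        by (rule nn_integral_cong_AE) (use AE_Tjoint[OF \<theta> t] in eventually_elim, simp)
      also have "\<dots> = ennreal (cost \<theta> t)"
        unfolding cost_def by (rule nn_integral_eq_integral[OF displacement_integrable(2)[OF \<theta> t]]) simp
      finally show ?case .
    qed
  qed
  also have "\<dots> = ennreal (mean_cost t)"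
    unfolding mean_cost_def by (rule nn_integral_eq_integral[OF integrable_cost[OF t]]) (simp add: cost_nonneg)
  finally show ?thesis .
qed

lemma SW2_eq: "t \<in> {0..<1} \<Longrightarrow> SW2 (\<rho> t) \<rho>1 = sqrt (mean_cost t)"
  by (simp add: SW2_def SW2_sq_eq_mean_cost mean_cost_nonneg)

text \<open>The bound is free of the direction, which makes it a majorant on the product of sphere
  and time interval.\<close>

lemma cost_rate_bound:
  assumes \<theta>: "norm \<theta> = 1" and t: "t \<in> {0..<1}" and S: "S \<ge> 0" "(\<integral>\<^sup>+x. ennreal ((norm x)\<^sup>2) \<partial>\<rho> t) \<le> ennreal S"
    and fin: "(\<integral>\<^sup>+x. ennreal ((norm (v t x))\<^sup>2) \<partial>\<rho> t) < \<infinity>"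
  shows "\<bar>cost_rate \<theta> t\<bar> \<le> 2 * (1 + (S + target_moment) + enn2real (\<integral>\<^sup>+x. ennreal ((norm (v t x))\<^sup>2) \<partial>\<rho> t))"
    (is "_ \<le> 2 * (1 + _ + ?E)")
proof -
  interpret P: prob_space "\<rho> t" by (rule prob_rho)
  let ?w = "\<lambda>x. 2 * (1 + ((norm x)\<^sup>2 + (Tjoint \<theta> t (\<theta> \<bullet> x))\<^sup>2) + (norm (v t x))\<^sup>2)"
  have vi: "integrable (\<rho> t) (\<lambda>x. (norm (v t x))\<^sup>2)" using fin by (auto simp: integrable_iff_bounded)
  have hi: "integrable (\<rho> t) (\<lambda>x. (norm x)\<^sup>2 + (Tjoint \<theta> t (\<theta> \<bullet> x))\<^sup>2)"
    using integrable_mult_right[OF displacement_integrable(1)[OF \<theta> t], of "1 / 2"] by (simp add: add_divide_distrib)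
  have E: "?E = (LINT x|\<rho> t. (norm (v t x))\<^sup>2)"
    by (subst nn_integral_eq_integral[OF vi]) auto
  have "ennreal (LINT x|\<rho> t. (norm x)\<^sup>2 + (Tjoint \<theta> t (\<theta> \<bullet> x))\<^sup>2) \<le> ennreal (S + target_moment)"
    using joint_moment_le[OF \<theta> t S] by (subst (asm) nn_integral_eq_integral[OF hi]) auto
  then have h: "(LINT x|\<rho> t. (norm x)\<^sup>2 + (Tjoint \<theta> t (\<theta> \<bullet> x))\<^sup>2) \<le> S + target_moment"
    using S(1) target_moment_nonneg by (subst (asm) ennreal_le_iff) auto
  have hi1: "integrable (\<rho> t) (\<lambda>x. 1 + ((norm x)\<^sup>2 + (Tjoint \<theta> t (\<theta> \<bullet> x))\<^sup>2))"
    by (rule Bochner_Integration.integrable_add[OF _ hi]) simp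
  have wi: "integrable (\<rho> t) ?w"
    by (rule integrable_mult_right[OF Bochner_Integration.integrable_add[OF hi1 vi]])
  have "norm (cost_rate \<theta> t) \<le> (LINT x|\<rho> t. ?w x)"
    unfolding cost_rate_def
    by (rule Bochner_Integration.integral_norm_bound_integral[OF Bochner_Integration.integrable_bound[OF wi] wi])
      (use displacement_velocity_le[OF \<theta>] in \<open>auto intro: order_trans[OF _ abs_ge_self]\<close>)
  also have "\<dots> = 2 * (1 + (LINT x|\<rho> t. (norm x)\<^sup>2 + (Tjoint \<theta> t (\<theta> \<bullet> x))\<^sup>2) + (LINT x|\<rho> t. (norm (v t x))\<^sup>2))"
  proof -
    have "(LINT x|\<rho> t. ?w x) = 2 * (LINT x|\<rho> t. 1 + ((norm x)\<^sup>2 + (Tjoint \<theta> t (\<theta> \<bullet> x))\<^sup>2) + (norm (v t x))\<^sup>2)"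
      by (rule integral_mult_right_zero)
    also have "(LINT x|\<rho> t. 1 + ((norm x)\<^sup>2 + (Tjoint \<theta> t (\<theta> \<bullet> x))\<^sup>2) + (norm (v t x))\<^sup>2) =
        (LINT x|\<rho> t. 1 + ((norm x)\<^sup>2 + (Tjoint \<theta> t (\<theta> \<bullet> x))\<^sup>2)) + (LINT x|\<rho> t. (norm (v t x))\<^sup>2)"
      by (rule Bochner_Integration.integral_add[OF hi1 vi])
    also have "(LINT x|\<rho> t. 1 + ((norm x)\<^sup>2 + (Tjoint \<theta> t (\<theta> \<bullet> x))\<^sup>2)) =
        (LINT x|\<rho> t. 1) + (LINT x|\<rho> t. (norm x)\<^sup>2 + (Tjoint \<theta> t (\<theta> \<bullet> x))\<^sup>2)"
      by (rule Bochner_Integration.integral_add[OF _ hi]) simp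
    finally show ?thesis using P.prob_space by simp
  qed
  finally show ?thesis using h unfolding E by simp
qed

lemma mean_cost_increment:
  assumes ab: "0 \<le> a" "a \<le> b" "b < 1"
  shows "mean_cost b - mean_cost a = (LINT t:{a..b}|lborel. LINT \<theta>|sphere_measure. cost_rate \<theta> t)"
    "set_integrable lborel {a..b} (\<lambda>t. LINT \<theta>|sphere_measure. cost_rate \<theta> t)"
proof -
  interpret S: prob_space "sphere_measure :: 'a measure" by (rule prob_space_sphere_measure)
  interpret P: pair_sigma_finite "sphere_measure :: 'a measure" "lborel :: real measure" ..
  obtain S where S: "S \<ge> 0" "\<And>t. t \<in> {0..b} \<Longrightarrow> (\<integral>\<^sup>+x. ennreal ((norm x)\<^sup>2) \<partial>\<rho> t) \<le> ennreal S"
    using second_moment_bounded[of b] ab by auto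
  define E where "E t = enn2real (\<integral>\<^sup>+x. ennreal ((norm (v t x))\<^sup>2) \<partial>\<rho> t)" for t
  define B where "B t = 2 * (1 + (S + target_moment) + E t)" for t
  have B0: "B t \<ge> 0" for t using S(1) target_moment_nonneg by (simp add: B_def E_def)
  have vm: "(\<lambda>z. (norm (v (fst z) (snd z)))\<^sup>2) \<in> borel_measurable (lborel \<Otimes>\<^sub>M borel)"
    by (simp add: measurable_prod_borel)
  have Am: "{a..b} \<in> sets lborel" by simp
  note fin = kinetic_energy'[OF ab(3,1)]
  have "set_integrable lborel {a..b} E"
    unfolding E_def by (rule integrable_kernel_bound[OF kernel_lborel Am vm fin])
  then have Bi: "set_integrable lborel {a..b} B"
    unfolding B_def
    by (intro set_integrable_mult_right set_integral_add) (auto simp: set_integrable_def emeasure_lborel_Icc_eq)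
  \<comment> \<open>The indicator turns integrals over [a, b] into integrals over the line, so that
    Fubini's theorem applies to the product with \<open>lborel\<close>; the majorant
    \<open>B\<close> depends on time only.\<close>
  let ?F = "\<lambda>z :: 'a \<times> real. indicator {a..b} (snd z) * cost_rate (fst z) (snd z)"
  have Fm [measurable]: "?F \<in> borel_measurable (sphere_measure \<Otimes>\<^sub>M lborel)"
  proof -
    have "cost_rate' \<in> borel_measurable (sphere_measure \<Otimes>\<^sub>M lborel)" if "cost_rate' \<in> borel_measurable (borel \<Otimes>\<^sub>M borel)"
      for cost_rate' :: "'a \<times> real \<Rightarrow> real"
      using that by (subst measurable_cong_sets[OF sets_pair_measure_cong refl]) auto
    from this[OF cost_rate_measurable] show ?thesis by measurable
  qed
  have bound: "AE t in lborel. norm (?F (\<theta>, t)) \<le> indicator {a..b} t * B t" if \<theta>: "norm \<theta> = 1" for \<theta>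
    using AE_kernel_finite[OF kernel_lborel Am vm fin]
  proof eventually_elim
    case (elim t)
    show ?case
    proof (cases "t \<in> {a..b}")
      case True
      then have "t \<in> {0..<1}" "t \<in> {0..b}" using ab by auto
      from cost_rate_bound[OF \<theta> this(1) S(1) S(2)[OF this(2)]] elim True show ?thesis by (simp add: B_def E_def)
    qed simp
  qed
  have Bint: "integrable lborel (\<lambda>t. indicator {a..b} t * B t)" using Bi by (simp add: set_integrable_def)
  have Fi: "integrable (sphere_measure \<Otimes>\<^sub>M lborel) ?F"
    unfolding integrable_iff_bounded
  proof
    have "(\<integral>\<^sup>+z. ennreal (norm (?F z)) \<partial>(sphere_measure \<Otimes>\<^sub>M lborel)) =
        (\<integral>\<^sup>+\<theta>. (\<integral>\<^sup>+t. ennreal (norm (?F (\<theta>, t))) \<partial>lborel) \<partial>sphere_measure)"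
      by (rule lborel.nn_integral_fst[symmetric]) measurable
    also have "\<dots> \<le> (\<integral>\<^sup>+\<theta>. ennreal (LINT t|lborel. indicator {a..b} t * B t) \<partial>(sphere_measure :: 'a measure))"
    proof (rule nn_integral_mono_AE)
      show "AE \<theta> in sphere_measure. (\<integral>\<^sup>+t. ennreal (norm (?F (\<theta>, t))) \<partial>lborel) \<le> ennreal (LINT t|lborel. indicator {a..b} t * B t)"
        using AE_sphere_measure
      proof eventually_elim
        case (elim \<theta>)
        then have \<theta>: "norm \<theta> = 1" by simp
        have "(\<integral>\<^sup>+t. ennreal (norm (?F (\<theta>, t))) \<partial>lborel) \<le> (\<integral>\<^sup>+t. ennreal (indicator {a..b} t * B t) \<partial>lborel)"
          by (rule nn_integral_mono_AE) (use bound[OF \<theta>] in eventually_elim, rule ennreal_leI)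
        also have "\<dots> = ennreal (LINT t|lborel. indicator {a..b} t * B t)"
          by (rule nn_integral_eq_integral[OF Bint]) (auto simp: B0)
        finally show ?case .
      qed
    qed
    also have "\<dots> < \<infinity>" using S.emeasure_space_1 by simp
    finally show "(\<integral>\<^sup>+z. ennreal (norm (?F z)) \<partial>(sphere_measure \<Otimes>\<^sub>M lborel)) < \<infinity>" .
  qed measurable
  have "mean_cost b - mean_cost a = (LINT \<theta>|sphere_measure. cost \<theta> b - cost \<theta> a)"
    unfolding mean_cost_def using ab by (intro Bochner_Integration.integral_diff[symmetric] integrable_cost) auto
  also have "\<dots> = (LINT \<theta>|sphere_measure. LINT t|lborel. ?F (\<theta>, t))"
  proof (rule integral_cong_AE)
    show "(\<lambda>\<theta>. cost \<theta> b - cost \<theta> a) \<in> borel_measurable sphere_measure"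
      using cost_measurable by measurable
    show "(\<lambda>\<theta>. LINT t|lborel. ?F (\<theta>, t)) \<in> borel_measurable sphere_measure"
      by (rule borel_measurable_integrable[OF P.integrable_fst'[OF Fi]])
    show "AE \<theta> in sphere_measure. cost \<theta> b - cost \<theta> a = (LINT t|lborel. ?F (\<theta>, t))"
      using AE_sphere_measure
      by eventually_elim (simp add: cost_increment[OF _ ab] set_lebesgue_integral_def)
  qed
  also have "\<dots> = (LINT t|lborel. LINT \<theta>|sphere_measure. ?F (\<theta>, t))"
    using P.Fubini_integral[of "\<lambda>\<theta> t. ?F (\<theta>, t)"] Fi by (simp add: case_prod_beta')
  also have "\<dots> = (LINT t:{a..b}|lborel. LINT \<theta>|sphere_measure. cost_rate \<theta> t)"
    by (simp add: set_lebesgue_integral_def)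
  finally show "mean_cost b - mean_cost a = (LINT t:{a..b}|lborel. LINT \<theta>|sphere_measure. cost_rate \<theta> t)" .
  have "integrable lborel (\<lambda>t. LINT \<theta>|sphere_measure. ?F (\<theta>, t))"
    using P.integrable_snd[of "\<lambda>\<theta> t. ?F (\<theta>, t)"] Fi by (simp add: case_prod_beta')
  then show "set_integrable lborel {a..b} (\<lambda>t. LINT \<theta>|sphere_measure. cost_rate \<theta> t)"
    by (simp add: set_integrable_def)
qed

section \<open>The sliced field and its dissipation\<close>

lemma displacement_joint_integrable:
  assumes t: "t \<in> {0..<1}"
  shows "integrable (sphere_measure \<Otimes>\<^sub>M \<rho> t) (\<lambda>z. (disp (fst z) t (snd z))\<^sup>2)"
proof -
  interpret S: prob_space "sphere_measure :: 'a measure" by (rule prob_space_sphere_measure)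
  interpret R: prob_space "\<rho> t" by (rule prob_rho)
  obtain C where C: "\<And>\<theta>. norm \<theta> = 1 \<Longrightarrow> (\<integral>\<^sup>+x. ennreal ((disp \<theta> t x)\<^sup>2) \<partial>\<rho> t) \<le> ennreal C" "C \<ge> 0"
    using displacement_integral_bound[OF t] by blast
  show ?thesis
    unfolding integrable_iff_bounded
  proof
    have "(\<integral>\<^sup>+z. ennreal (norm ((disp (fst z) t (snd z))\<^sup>2)) \<partial>(sphere_measure \<Otimes>\<^sub>M \<rho> t)) =
        (\<integral>\<^sup>+\<theta>. \<integral>\<^sup>+x. ennreal ((disp \<theta> t x)\<^sup>2) \<partial>\<rho> t \<partial>sphere_measure)"
      by (subst R.nn_integral_fst[symmetric]) simp_all
    also have "\<dots> \<le> (\<integral>\<^sup>+\<theta>. ennreal C \<partial>(sphere_measure :: 'a measure))"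
      by (rule nn_integral_mono_AE) (use AE_sphere_measure in eventually_elim, use C(1) in simp)
    also have "\<dots> < \<infinity>" using S.emeasure_space_1 by simp
    finally show "(\<integral>\<^sup>+z. ennreal (norm ((disp (fst z) t (snd z))\<^sup>2)) \<partial>(sphere_measure \<Otimes>\<^sub>M \<rho> t)) < \<infinity>" .
  qed simp
qed

text \<open>For each unit direction \<open>T t\<close> and \<open>Tjoint\<close> agree at almost
  every position. Joint measurability of \<open>T t\<close> at the fixed time turns this into
  agreement, at almost every position, for almost every direction, so both give the same
  average.\<close>

lemma AE_sliced_field:
  assumes t: "t \<in> {0..<1}"
  shows "AE x in \<rho> t. integrable sphere_measure (\<lambda>\<theta>. (disp \<theta> t x)\<^sup>2) \<and>
    integrable sphere_measure (\<lambda>\<theta>. (disp \<theta> t x) *\<^sub>R \<theta>) \<and>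
    sliced_field (T t) x = (LINT \<theta>|sphere_measure. (disp \<theta> t x) *\<^sub>R \<theta>)"
proof -
  interpret S: prob_space "sphere_measure :: 'a measure" by (rule prob_space_sphere_measure)
  interpret R: prob_space "\<rho> t" by (rule prob_rho)
  interpret P: pair_sigma_finite "sphere_measure :: 'a measure" "\<rho> t" ..
  have "(\<lambda>z. T t (fst z) (snd z)) \<in> borel_measurable borel"
    using maps[OF t] by (auto simp: sliced_ot_maps_def case_prod_beta')
  then have Tm [measurable]: "(\<lambda>z. T t (fst z) (snd z)) \<in> borel_measurable (borel \<Otimes>\<^sub>M borel)"
    by (simp add: borel_prod)
  have T2: "(\<lambda>x. T t (f x) (g x)) \<in> borel_measurable N"
    if "f \<in> borel_measurable N" "g \<in> borel_measurable N" for f g and N :: "'c measure"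
    using measurable_compose[OF measurable_Pair[OF that] Tm] by simp
  have set: "{z \<in> space (sphere_measure \<Otimes>\<^sub>M \<rho> t). T t (fst z) (fst z \<bullet> snd z) = Tjoint (fst z) t (fst z \<bullet> snd z)}
      \<in> sets (sphere_measure \<Otimes>\<^sub>M \<rho> t)"
    by (rule borel_measurable_eq[OF T2]) measurable
  have "AE \<theta> in sphere_measure. AE x in \<rho> t. T t \<theta> (\<theta> \<bullet> x) = Tjoint \<theta> t (\<theta> \<bullet> x)"
    using AE_sphere_measure
  proof eventually_elim
    case (elim \<theta>)
    then have "norm \<theta> = 1" by simp
    from AE_Tjoint[OF this t] show ?case by eventually_elim simp
  qed
  then have eq: "AE x in \<rho> t. AE \<theta> in sphere_measure. T t \<theta> (\<theta> \<bullet> x) = Tjoint \<theta> t (\<theta> \<bullet> x)"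
    using P.AE_commute[of "\<lambda>\<theta> x. T t \<theta> (\<theta> \<bullet> x) = Tjoint \<theta> t (\<theta> \<bullet> x)"] set by simp
  have "AE x in \<rho> t. integrable sphere_measure (\<lambda>\<theta>. (disp \<theta> t x)\<^sup>2)"
    using P.AE_integrable_snd[of "\<lambda>\<theta> x. (disp \<theta> t x)\<^sup>2"] displacement_joint_integrable[OF t]
    by (simp add: case_prod_beta')
  then show ?thesis
    using eq
  proof eventually_elim
    case (elim x)
    have "integrable sphere_measure (\<lambda>\<theta>. disp \<theta> t x)"
      by (rule S.square_integrable_imp_integrable[OF _ elim(1)]) measurable
    then have i: "integrable sphere_measure (\<lambda>\<theta>. (disp \<theta> t x) *\<^sub>R \<theta>)"
    proof (rule Bochner_Integration.integrable_bound)
      show "AE \<theta> in sphere_measure. norm ((disp \<theta> t x) *\<^sub>R \<theta>) \<le> norm (disp \<theta> t x)"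
        using AE_sphere_measure by eventually_elim simp
    qed measurable
    have "sliced_field (T t) x = (LINT \<theta>|sphere_measure. (disp \<theta> t x) *\<^sub>R \<theta>)"
      unfolding sliced_field_def
    proof (rule integral_cong_AE)
      have [measurable]: "(\<lambda>\<theta>. T t \<theta> (\<theta> \<bullet> x)) \<in> borel_measurable sphere_measure" by (rule T2) measurable
      show "(\<lambda>\<theta>. (\<theta> \<bullet> x - T t \<theta> (\<theta> \<bullet> x)) *\<^sub>R \<theta>) \<in> borel_measurable sphere_measure" by measurable
      show "AE \<theta> in sphere_measure. (\<theta> \<bullet> x - T t \<theta> (\<theta> \<bullet> x)) *\<^sub>R \<theta> = (disp \<theta> t x) *\<^sub>R \<theta>"
        using elim(2) by eventually_elim simp
    qed measurable
    with elim(1) i show ?case by simp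
  qed
qed

lemma sliced_field_measurable: "t \<in> {0..<1} \<Longrightarrow> sliced_field (T t) \<in> borel_measurable borel"
proof -
  interpret S: prob_space "sphere_measure :: 'a measure" by (rule prob_space_sphere_measure)
  assume t: "t \<in> {0..<1}"
  have "(\<lambda>z. T t (fst z) (snd z)) \<in> borel_measurable borel"
    using maps[OF t] by (auto simp: sliced_ot_maps_def case_prod_beta')
  then have Tm [measurable]: "(\<lambda>z. T t (fst z) (snd z)) \<in> borel_measurable (borel \<Otimes>\<^sub>M borel)"
    by (simp add: borel_prod)
  have [measurable]: "(\<lambda>z. T t (snd z) (snd z \<bullet> fst z)) \<in> borel_measurable (borel \<Otimes>\<^sub>M sphere_measure)"
    using measurable_compose[OF measurable_Pair[of snd _ borel "\<lambda>z. snd z \<bullet> fst z" borel] Tm] by simp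
  show ?thesis
    unfolding sliced_field_def[abs_def]
    by (rule S.borel_measurable_lebesgue_integral) (simp add: case_prod_beta')
qed

text \<open>Young's inequality with weight \<open>n\<close>: the isotropy of the sphere measure turns the second
  term into half of the left-hand side.\<close>

lemma sliced_field_norm_le:
  assumes t: "t \<in> {0..<1}"
  shows "AE x in \<rho> t. (norm (sliced_field (T t) x))\<^sup>2 \<le>
    (LINT \<theta>|sphere_measure. (disp \<theta> t x)\<^sup>2) / real DIM('a)"
  using AE_sliced_field[OF t]
proof eventually_elim
  case (elim x)
  let ?n = "real DIM('a)"
  let ?a = "\<lambda>\<theta>. disp \<theta> t x"
  define g where "g = sliced_field (T t) x"
  interpret S: prob_space "sphere_measure :: 'a measure" by (rule prob_space_sphere_measure)
  have n: "?n > 0" by simp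
  have gi: "integrable sphere_measure (\<lambda>\<theta>. (\<theta> \<bullet> g)\<^sup>2)"
  proof (rule S.integrable_const_bound[of _ "(norm g)\<^sup>2"])
    show "AE \<theta> in sphere_measure. norm ((\<theta> \<bullet> g)\<^sup>2) \<le> (norm g)\<^sup>2"
      using AE_sphere_measure
    proof eventually_elim
      case (elim \<theta>)
      then show ?case using abs_inner_unit_le[of \<theta> g] by (simp add: abs_le_square_iff[symmetric])
    qed
  qed measurable
  have "(norm g)\<^sup>2 = (LINT \<theta>|sphere_measure. ?a \<theta> *\<^sub>R \<theta>) \<bullet> g"
    using elim by (simp add: g_def power2_norm_eq_inner)
  also have "\<dots> = (LINT \<theta>|sphere_measure. (?a \<theta> *\<^sub>R \<theta>) \<bullet> g)"
    using elim by (intro integral_inner_left[symmetric]) simp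
  also have "\<dots> \<le> (LINT \<theta>|sphere_measure. (?a \<theta>)\<^sup>2 / (2 * ?n) + ?n / 2 * (\<theta> \<bullet> g)\<^sup>2)"
  proof (rule integral_mono)
    show "integrable sphere_measure (\<lambda>\<theta>. (?a \<theta> *\<^sub>R \<theta>) \<bullet> g)" using elim by (intro integrable_inner_left) simp
    show "integrable sphere_measure (\<lambda>\<theta>. (?a \<theta>)\<^sup>2 / (2 * ?n) + ?n / 2 * (\<theta> \<bullet> g)\<^sup>2)" using elim gi by simp
    show "(?a \<theta> *\<^sub>R \<theta>) \<bullet> g \<le> (?a \<theta>)\<^sup>2 / (2 * ?n) + ?n / 2 * (\<theta> \<bullet> g)\<^sup>2" for \<theta>
      unfolding inner_scaleR_left by (rule young_weighted[OF n])
  qed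
  also have "\<dots> = (LINT \<theta>|sphere_measure. (?a \<theta>)\<^sup>2) / (2 * ?n) + ?n / 2 * ((norm g)\<^sup>2 / ?n)"
    using elim gi by (simp add: sphere_measure_isotropic)
  finally show ?case unfolding g_def[symmetric] using n by (simp add: field_simps)
qed

lemma mean_displacement_integrable:
  assumes t: "t \<in> {0..<1}"
  shows "integrable (\<rho> t) (\<lambda>x. LINT \<theta>|sphere_measure. (disp \<theta> t x)\<^sup>2)"
    and "(LINT x|\<rho> t. LINT \<theta>|sphere_measure. (disp \<theta> t x)\<^sup>2) = mean_cost t"
proof -
  interpret S: prob_space "sphere_measure :: 'a measure" by (rule prob_space_sphere_measure)
  interpret R: prob_space "\<rho> t" by (rule prob_rho)
  interpret P: pair_sigma_finite "sphere_measure :: 'a measure" "\<rho> t" ..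
  have i: "integrable (sphere_measure \<Otimes>\<^sub>M \<rho> t) (\<lambda>(\<theta>, x). (disp \<theta> t x)\<^sup>2)"
    using displacement_joint_integrable[OF t] by (simp add: case_prod_beta')
  show "integrable (\<rho> t) (\<lambda>x. LINT \<theta>|sphere_measure. (disp \<theta> t x)\<^sup>2)"
    by (rule P.integrable_snd[OF i])
  show "(LINT x|\<rho> t. LINT \<theta>|sphere_measure. (disp \<theta> t x)\<^sup>2) = mean_cost t"
    unfolding mean_cost_def cost_def by (rule P.Fubini_integral[OF i])
qed

lemma sliced_field_square_integrable:
  assumes t: "t \<in> {0..<1}"
  shows "integrable (\<rho> t) (\<lambda>x. (norm (sliced_field (T t) x))\<^sup>2)"
proof (rule Bochner_Integration.integrable_bound)
  note [measurable] = sliced_field_measurable[OF t]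
  show "integrable (\<rho> t) (\<lambda>x. (LINT \<theta>|sphere_measure. (disp \<theta> t x)\<^sup>2) / real DIM('a))"
    using mean_displacement_integrable(1)[OF t] by simp
  show "AE x in \<rho> t. norm ((norm (sliced_field (T t) x))\<^sup>2) \<le>
      norm ((LINT \<theta>|sphere_measure. (disp \<theta> t x)\<^sup>2) / real DIM('a))"
    using sliced_field_norm_le[OF t] by eventually_elim (auto intro: order_trans[OF _ abs_ge_self])
  show "(\<lambda>x. (norm (sliced_field (T t) x))\<^sup>2) \<in> borel_measurable (\<rho> t)" by simp
qed

lemma dissipation_le: "t \<in> {0..<1} \<Longrightarrow> real DIM('a) * dissipation (T t) (\<rho> t) \<le> mean_cost t"
proof -
  assume t: "t \<in> {0..<1}"
  have "dissipation (T t) (\<rho> t) \<le> (LINT x|\<rho> t. (LINT \<theta>|sphere_measure. (disp \<theta> t x)\<^sup>2) / real DIM('a))"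
    unfolding dissipation_def
    using mean_displacement_integrable(1)[OF t]
    by (intro integral_mono_AE sliced_field_square_integrable[OF t] sliced_field_norm_le[OF t]) simp
  also have "\<dots> = mean_cost t / real DIM('a)"
    using mean_displacement_integrable[OF t] by simp
  finally show ?thesis by (simp add: field_simps)
qed

text \<open>The velocity does not depend on the direction, so after Fubini's theorem the inner
  average of displacement times direction is the sliced field itself, paired with twice its multiple
  by \<open>- \<gamma>\<close>.\<close>

lemma mean_cost_rate:
  assumes t: "t \<in> {0..<1}" and v: "AE x in \<rho> t. v t x = - \<gamma> *\<^sub>R sliced_field (T t) x"
  shows "(LINT \<theta>|sphere_measure. cost_rate \<theta> t) = - 2 * \<gamma> * dissipation (T t) (\<rho> t)"
proof -
  interpret S: prob_space "sphere_measure :: 'a measure" by (rule prob_space_sphere_measure)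
  interpret R: prob_space "\<rho> t" by (rule prob_rho)
  interpret P: pair_sigma_finite "sphere_measure :: 'a measure" "\<rho> t" ..

  let ?a = "\<lambda>\<theta> x. disp \<theta> t x"
  note [measurable] = sliced_field_measurable[OF t]
  have vi: "integrable (\<rho> t) (\<lambda>x. (norm (v t x))\<^sup>2)"
  proof (subst integrable_cong_AE)
    show "AE x in \<rho> t. (norm (v t x))\<^sup>2 = \<gamma>\<^sup>2 * (norm (sliced_field (T t) x))\<^sup>2"
      using v by eventually_elim (simp add: power_mult_distrib)
    show "integrable (\<rho> t) (\<lambda>x. \<gamma>\<^sup>2 * (norm (sliced_field (T t) x))\<^sup>2)"
      using sliced_field_square_integrable[OF t] by simp
  qed simp_all
  have vi2: "integrable ((sphere_measure :: 'a measure) \<Otimes>\<^sub>M \<rho> t) (\<lambda>z. (norm (v t (snd z)))\<^sup>2)"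
    unfolding integrable_iff_bounded
  proof
    have "(\<integral>\<^sup>+z. ennreal (norm ((norm (v t (snd z)))\<^sup>2)) \<partial>((sphere_measure :: 'a measure) \<Otimes>\<^sub>M \<rho> t)) =
        (\<integral>\<^sup>+x. ennreal (norm ((norm (v t x))\<^sup>2)) \<partial>\<rho> t)"
      using S.emeasure_space_1 by (subst R.nn_integral_fst[symmetric]) simp_all
    also have "\<dots> < \<infinity>" using vi by (simp add: integrable_iff_bounded)
    finally show "(\<integral>\<^sup>+z. ennreal (norm ((norm (v t (snd z)))\<^sup>2)) \<partial>((sphere_measure :: 'a measure) \<Otimes>\<^sub>M \<rho> t)) < \<infinity>" .
  qed simp
  have i: "integrable (sphere_measure \<Otimes>\<^sub>M \<rho> t) (\<lambda>(\<theta>, x). 2 * ?a \<theta> x * (\<theta> \<bullet> v t x))"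
  proof (rule Bochner_Integration.integrable_bound)
    show "integrable (sphere_measure \<Otimes>\<^sub>M \<rho> t) (\<lambda>z. (?a (fst z) (snd z))\<^sup>2 + (norm (v t (snd z)))\<^sup>2)"
      by (intro Bochner_Integration.integrable_add displacement_joint_integrable[OF t] vi2)
    have "AE z in (sphere_measure :: 'a measure) \<Otimes>\<^sub>M \<rho> t. norm (fst z) = 1"
    proof (rule P.AE_pair_measure)
      show "{z \<in> space ((sphere_measure :: 'a measure) \<Otimes>\<^sub>M \<rho> t). norm (fst z) = 1} \<in> sets (sphere_measure \<Otimes>\<^sub>M \<rho> t)"
        by measurable
      show "AE \<theta> in (sphere_measure :: 'a measure). AE x in \<rho> t. norm (fst (\<theta>, x)) = 1"
        using AE_sphere_measure by eventually_elim simp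
    qed
    then show "AE z in sphere_measure \<Otimes>\<^sub>M \<rho> t. norm (case z of (\<theta>, x) \<Rightarrow> 2 * ?a \<theta> x * (\<theta> \<bullet> v t x))
        \<le> norm ((?a (fst z) (snd z))\<^sup>2 + (norm (v t (snd z)))\<^sup>2)"
    proof eventually_elim
      case (elim z)
      let ?b = "fst z \<bullet> v t (snd z)"
      have "\<bar>2 * ?a (fst z) (snd z) * ?b\<bar> = 2 * (\<bar>?a (fst z) (snd z)\<bar> * \<bar>?b\<bar>)" by (simp only: abs_mult abs_numeral mult.assoc)
      also have "\<dots> \<le> \<bar>?a (fst z) (snd z)\<bar>\<^sup>2 + \<bar>?b\<bar>\<^sup>2" by (rule two_mult_le_squares)
      also have "\<dots> \<le> (?a (fst z) (snd z))\<^sup>2 + (norm (v t (snd z)))\<^sup>2"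
        using abs_inner_unit_le[OF elim, of "v t (snd z)"] by (simp add: abs_le_square_iff[symmetric])
      finally show ?case by (simp add: case_prod_beta')
    qed
  qed (simp add: case_prod_beta')
  have "(LINT \<theta>|sphere_measure. cost_rate \<theta> t) = (LINT x|\<rho> t. LINT \<theta>|sphere_measure. 2 * ?a \<theta> x * (\<theta> \<bullet> v t x))"
    unfolding cost_rate_def by (rule P.Fubini_integral[OF i, symmetric])
  also have "\<dots> = (LINT x|\<rho> t. - 2 * \<gamma> * (norm (sliced_field (T t) x))\<^sup>2)"
  proof (rule integral_cong_AE)
    show "AE x in \<rho> t. (LINT \<theta>|sphere_measure. 2 * ?a \<theta> x * (\<theta> \<bullet> v t x)) = - 2 * \<gamma> * (norm (sliced_field (T t) x))\<^sup>2"
      using AE_sliced_field[OF t] v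
    proof eventually_elim
      case (elim x)
      have "(LINT \<theta>|sphere_measure. 2 * ?a \<theta> x * (\<theta> \<bullet> v t x)) = (LINT \<theta>|sphere_measure. (?a \<theta> x *\<^sub>R \<theta>) \<bullet> (2 *\<^sub>R v t x))"
        by (rule Bochner_Integration.integral_cong) auto
      also have "\<dots> = sliced_field (T t) x \<bullet> (2 *\<^sub>R v t x)"
        using elim(1) by (subst integral_inner_left) auto
      also have "\<dots> = - 2 * \<gamma> * (norm (sliced_field (T t) x))\<^sup>2"
        unfolding elim(2) by (simp add: power2_norm_eq_inner)
      finally show ?case .
    qed
    show "(\<lambda>x. LINT \<theta>|sphere_measure. 2 * ?a \<theta> x * (\<theta> \<bullet> v t x)) \<in> borel_measurable (\<rho> t)"
      by (rule borel_measurable_integrable[OF P.integrable_snd[OF i]])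
  qed simp
  also have "\<dots> = - 2 * \<gamma> * dissipation (T t) (\<rho> t)"
    by (simp add: dissipation_def)
  finally show ?thesis .
qed

end

section \<open>Linear decay and control energy\<close>

text \<open>A bootstrap: the integral formula makes \<open>m\<close> continuous, hence
  \<open>f\<close> by its pointwise equation, hence \<open>m\<close> differentiable; then
  \<open>m s / (1 - s)\<^sup>2\<close> has derivative zero.\<close>

lemma quadratic_decay:
  fixes m f :: "real \<Rightarrow> real"
  assumes inc: "\<And>b. 0 \<le> b \<Longrightarrow> b < 1 \<Longrightarrow> m b - m 0 = (LINT t:{0..b}|lborel. f t)"
    and int: "\<And>b. 0 \<le> b \<Longrightarrow> b < 1 \<Longrightarrow> set_integrable lborel {0..b} f"
    and f: "\<And>t. 0 \<le> t \<Longrightarrow> t < 1 \<Longrightarrow> f t = - 2 * m t / (1 - t)"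
    and t: "0 \<le> t" "t < 1"
  shows "m t = (1 - t)\<^sup>2 * m 0"
proof -
  have io: "f integrable_on {0..t}"
    by (rule set_borel_integral_eq_integral(1)[OF int[OF t]])
  have m: "m s = m 0 + integral {0..s} f" if "s \<in> {0..t}" for s
  proof -
    have s: "0 \<le> s" "s < 1" using that t by auto
    show ?thesis using inc[OF s] set_borel_integral_eq_integral(2)[OF int[OF s]] by simp
  qed
  have "continuous_on {0..t} (\<lambda>s. m 0 + integral {0..s} f)"
    by (intro continuous_intros indefinite_integral_continuous_1 io)
  then have cm: "continuous_on {0..t} m" by (rule continuous_on_eq) (rule m[symmetric])
  have "continuous_on {0..t} (\<lambda>s. - 2 * m s / (1 - s))"
    using t by (intro continuous_intros cm) auto
  then have cf: "continuous_on {0..t} f" by (rule continuous_on_eq) (use f t in auto)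
  have dm: "(m has_real_derivative f s) (at s within {0..t})" if s: "s \<in> {0..t}" for s
  proof -
    have "((\<lambda>s. m 0 + integral {0..s} f) has_real_derivative f s) (at s within {0..t})"
      using integral_has_real_derivative[OF cf s] by (auto intro!: derivative_eq_intros)
    then show ?thesis
      unfolding has_field_derivative_def by (rule has_derivative_transform[OF s m, rotated])
  qed
  have "((\<lambda>s. m s / (1 - s)\<^sup>2) has_real_derivative 0) (at s within {0..t})" if s: "s \<in> {0..t}" for s
  proof -
    have s1: "1 - s \<noteq> 0" "f s = - 2 * m s / (1 - s)" using s t f by auto
    have "((\<lambda>s. m s / (1 - s)\<^sup>2) has_real_derivative
        ((f s * (1 - s)\<^sup>2 - m s * (- 2 * (1 - s))) / ((1 - s)\<^sup>2 * (1 - s)\<^sup>2))) (at s within {0..t})"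
      using s1(1) by (auto intro!: derivative_eq_intros dm[OF s])
    moreover have "f s * (1 - s)\<^sup>2 - m s * (- 2 * (1 - s)) = 0"
      using s1 by (simp add: power2_eq_square, simp add: algebra_simps)
    ultimately show ?thesis by simp
  qed
  then obtain c where "\<And>s. s \<in> {0..t} \<Longrightarrow> m s / (1 - s)\<^sup>2 = c"
    using has_field_derivative_zero_constant[of "{0..t}" "\<lambda>s. m s / (1 - s)\<^sup>2"] by auto
  from this[of t] this[of 0] have "m t / (1 - t)\<^sup>2 = m 0" using t by simp
  then show ?thesis using t by (simp add: field_simps)
qed

text \<open>Outside \<open>[0, 1)\<close> the curve and the velocity are unspecified; they are extended there so that
  the measurability statements hold on the whole time axis.\<close>

lemma averaged_sliced_flow_extension:
  fixes \<rho> :: "real \<Rightarrow> 'a::euclidean_space measure"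
  assumes target: "\<rho>1 \<in> P2" and flow: "averaged_sliced_flow \<rho> \<rho>1 T gain v"
  shows "averaged_flow (\<lambda>t. if t \<in> {0..<1} then \<rho> t else \<rho> 0) (\<lambda>t x. if t \<in> {0..<1} then v t x else 0) \<rho>1 T"
proof -
  let ?\<rho> = "\<lambda>t. if t \<in> {0..<1} then \<rho> t else \<rho> 0"
  let ?v = "\<lambda>t x. if t \<in> {0..<1} then v t x else 0"
  have P2: "\<And>t. t \<in> {0..<1} \<Longrightarrow> \<rho> t \<in> P2" and ac: "\<And>t. t \<in> {0..<1} \<Longrightarrow> absolutely_continuous lborel (\<rho> t)"
    and nc: "narrowly_continuous_on {0..<1} \<rho>" and maps: "\<And>t. t \<in> {0..<1} \<Longrightarrow> sliced_ot_maps (\<rho> t) \<rho>1 (T t)"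
    and vm: "(\<lambda>(t, x). v t x) \<in> borel_measurable (restrict_space borel ({0..<1} \<times> UNIV))"
    and weak: "weak_continuity_equation \<rho> v"
    and energy: "\<And>\<tau>. \<tau> \<in> {0<..<1} \<Longrightarrow> (\<integral>\<^sup>+t\<in>{0..\<tau>}. (\<integral>\<^sup>+x. ennreal ((norm (v t x))\<^sup>2) \<partial>\<rho> t) \<partial>lborel) < \<infinity>"
    using flow unfolding averaged_sliced_flow_def by blast+
  show ?thesis
  proof
    show "?\<rho> \<in> borel \<rightarrow>\<^sub>M prob_algebra borel"
      by (rule narrowly_continuous_kernel[OF nc]) (simp_all add: P2[THEN P2_prob_space] P2[THEN P2_sets])
    show "narrowly_continuous_on {0..<1} ?\<rho>"
      unfolding narrowly_continuous_on_def
    proof (intro allI impI)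
      fix f :: "'a \<Rightarrow> real" assume "continuous_on UNIV f \<and> bounded (range f)"
      then have "continuous_on {0..<1} (\<lambda>t. LINT x|\<rho> t. f x)" using nc unfolding narrowly_continuous_on_def by blast
      then show "continuous_on {0..<1} (\<lambda>t. LINT x|?\<rho> t. f x)" by (rule continuous_on_eq) simp
    qed
    show "(\<integral>\<^sup>+x. ennreal ((norm x)\<^sup>2) \<partial>?\<rho> t) < \<infinity>" if "t \<in> {0..<1}" for t
      using P2[OF that] that by (simp add: P2_def)
    show "absolutely_continuous lborel (?\<rho> t)" if "t \<in> {0..<1}" for t using ac[OF that] that by simp
    have open_strip: "({0..<1} \<times> UNIV :: (real \<times> 'a) set) \<in> sets borel"
      unfolding borel_prod[symmetric] by (intro pair_measureI) auto
    have "(\<lambda>z. indicat_real ({0..<1} \<times> UNIV) z *\<^sub>R (case z of (t, x) \<Rightarrow> v t x)) \<in> borel_measurable borel"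
      using vm open_strip by (subst (asm) borel_measurable_restrict_space_iff) auto
    also have "(\<lambda>z. indicat_real ({0..<1} \<times> UNIV) z *\<^sub>R (case z of (t, x) \<Rightarrow> v t x)) = (\<lambda>z. ?v (fst z) (snd z))"
      by (auto simp: fun_eq_iff split: split_indicator)
    finally show "(\<lambda>z. ?v (fst z) (snd z)) \<in> borel_measurable (borel \<Otimes>\<^sub>M borel)" by (simp add: borel_prod)
    show "weak_continuity_equation ?\<rho> ?v"
      unfolding weak_continuity_equation_def
    proof
      fix \<phi> :: "real \<times> 'a \<Rightarrow> real" assume "\<phi> \<in> test_functions"
      then have "(LINT t:{0<..<1}|lborel. LINT x|\<rho> t. frechet_derivative \<phi> (at (t, x)) (1, 0) +
           frechet_derivative \<phi> (at (t, x)) (0, v t x)) = 0"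
        using weak unfolding weak_continuity_equation_def by blast
      also have "(LINT t:{0<..<1}|lborel. LINT x|\<rho> t. frechet_derivative \<phi> (at (t, x)) (1, 0) +
           frechet_derivative \<phi> (at (t, x)) (0, v t x)) =
          (LINT t:{0<..<1}|lborel. LINT x|?\<rho> t. frechet_derivative \<phi> (at (t, x)) (1, 0) +
           frechet_derivative \<phi> (at (t, x)) (0, ?v t x))"
        by (rule set_lebesgue_integral_cong) auto
      finally show "(LINT t:{0<..<1}|lborel. LINT x|?\<rho> t. frechet_derivative \<phi> (at (t, x)) (1, 0) +
           frechet_derivative \<phi> (at (t, x)) (0, ?v t x)) = 0" .
    qed
    show "(\<integral>\<^sup>+t\<in>{0..\<tau>}. (\<integral>\<^sup>+x. ennreal ((norm (?v t x))\<^sup>2) \<partial>?\<rho> t) \<partial>lborel) < \<infinity>" if "\<tau> \<in> {0<..<1}" for \<tau>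
    proof -
      have "(\<integral>\<^sup>+t\<in>{0..\<tau>}. (\<integral>\<^sup>+x. ennreal ((norm (?v t x))\<^sup>2) \<partial>?\<rho> t) \<partial>lborel) =
          (\<integral>\<^sup>+t\<in>{0..\<tau>}. (\<integral>\<^sup>+x. ennreal ((norm (v t x))\<^sup>2) \<partial>\<rho> t) \<partial>lborel)"
        by (rule nn_integral_cong) (use that in \<open>auto split: split_indicator\<close>)
      then show ?thesis using energy[OF that] by simp
    qed
    show "\<rho>1 \<in> P2" by (rule target)
    show "sliced_ot_maps (?\<rho> t) \<rho>1 (T t)" if "t \<in> {0..<1}" for t using maps[OF that] that by simp
  qed
qed

theorem theorem2:
  fixes \<rho> :: "real \<Rightarrow> (real ^ 'n) measure"
    and \<rho>1 :: "(real ^ 'n) measure"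
    and T :: "real \<Rightarrow> real ^ 'n \<Rightarrow> real \<Rightarrow> real"
    and gain :: "real \<Rightarrow> real"
    and v :: "real \<Rightarrow> real ^ 'n \<Rightarrow> real ^ 'n"
    and M :: "'w measure"
    and X :: "real \<Rightarrow> 'w \<Rightarrow> real ^ 'n"
  assumes "\<rho>1 \<in> P2"
    and "averaged_sliced_flow \<rho> \<rho>1 T gain v"
    and "\<And>t. t \<in> {0..<1} \<Longrightarrow> SW2 (\<rho> t) \<rho>1 > 0 \<Longrightarrow> gain t = lambda_SW (T t) (\<rho> t) \<rho>1 t"
    and "\<And>t. t \<in> {0..<1} \<Longrightarrow> SW2 (\<rho> t) \<rho>1 > 0 \<Longrightarrow> dissipation (T t) (\<rho> t) > 0"
    and "SW2 (\<rho> 0) \<rho>1 > 0"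
    and "prob_space M"
    and "\<And>t. t \<in> {0..<1} \<Longrightarrow> X t \<in> borel_measurable M \<and> distr M borel (X t) = \<rho> t"
  defines "u \<equiv> \<lambda>t \<omega>. v t (X t \<omega>)"
  shows "(\<forall>t\<in>{0..<1}. SW2 (\<rho> t) \<rho>1 = (1 - t) * SW2 (\<rho> 0) \<rho>1) \<and>
    total_energy M u =
      ennreal (real CARD('n) * (SW2 (\<rho> 0) \<rho>1)\<^sup>2) *
        (\<integral>\<^sup>+t\<in>{0<..<1}. ennreal (1 / chi (T t) (\<rho> t) \<rho>1) \<partial>lborel) \<and>
    (\<forall>c>0. (AE t in lborel. t \<in> {0<..<1} \<longrightarrow> c \<le> chi (T t) (\<rho> t) \<rho>1) \<longrightarrow>
      ennreal (real CARD('n) * (SW2 (\<rho> 0) \<rho>1)\<^sup>2) \<le> total_energy M u \<and>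
      total_energy M u \<le> ennreal (real CARD('n) / c * (SW2 (\<rho> 0) \<rho>1)\<^sup>2))"
proof -
  let ?\<rho> = "\<lambda>t. if t \<in> {0..<1} then \<rho> t else \<rho> 0"
  let ?v = "\<lambda>t x. if t \<in> {0..<1} then v t x else 0"
  let ?n = "real CARD('n)"
  interpret F: averaged_flow ?\<rho> ?v \<rho>1 T
    by (rule averaged_sliced_flow_extension[OF assms(1,2)])
  let ?m = F.mean_cost
  define r where "r t = SW2 (\<rho> t) \<rho>1" for t
  define D where "D t = dissipation (T t) (\<rho> t)" for t
  have r: "r t = sqrt (?m t)" if "t \<in> {0..<1}" for t
    using F.SW2_eq[OF that] that by (simp add: r_def)
  have D0: "D t \<ge> 0" for t
    unfolding D_def dissipation_def by (rule Bochner_Integration.integral_nonneg) simp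
  have nD: "?n * D t \<le> ?m t" if "t \<in> {0..<1}" for t
    using F.dissipation_le[OF that] that by (simp add: D_def)
  have v: "AE x in \<rho> t. v t x = - gain t *\<^sub>R sliced_field (T t) x" if "t \<in> {0..<1}" for t
    using assms(2) that unfolding averaged_sliced_flow_def by blast
  have gain: "gain t = (r t)\<^sup>2 / (D t * (1 - t))" if "t \<in> {0..<1}" "r t > 0" for t
    using assms(3)[OF that(1)] that(2) by (simp add: r_def D_def lambda_SW_def)
  have Dpos: "D t > 0" if "t \<in> {0..<1}" "r t > 0" for t
    using assms(4)[OF that(1)] that(2) by (simp add: r_def D_def)
  \<comment> \<open>The gain is chosen such that the dissipation cancels:
    \<open>gain t * D t\<close> is \<open>(r t)\<^sup>2 / (1 - t)\<close> as long as
    \<open>r t\<close> is positive.\<close>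
  have rate: "(LINT \<theta>|sphere_measure. F.cost_rate \<theta> t) = - 2 * ?m t / (1 - t)" if t: "0 \<le> t" "t < 1" for t
  proof -
    have t': "t \<in> {0..<1}" using t by simp
    have e: "(LINT \<theta>|sphere_measure. F.cost_rate \<theta> t) = - 2 * gain t * D t"
      using F.mean_cost_rate[of t "gain t"] v[OF t'] t' by (simp add: D_def)
    show ?thesis
    proof (cases "r t > 0")
      case True
      have "(r t)\<^sup>2 = ?m t" using r[OF t'] F.mean_cost_nonneg[of t] by simp
      then show ?thesis unfolding e gain[OF t' True] using Dpos[OF t' True] t by simp
    next
      case False
      then have m0: "?m t = 0" using r[OF t'] F.mean_cost_nonneg[of t] by (simp add: not_less)
      have "?n > 0" by simp
      \<comment> \<open>Where \<open>r t\<close> is 0 the gain is arbitrary, but there the isotropy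
        bound forces the dissipation to vanish.\<close>
      then have "D t = 0" using nD[OF t'] D0[of t] m0 by (simp add: mult_le_0_iff not_le)
      then show ?thesis unfolding e m0 by simp
    qed
  qed
  have decay: "?m t = (1 - t)\<^sup>2 * ?m 0" if t: "0 \<le> t" "t < 1" for t
    by (rule quadratic_decay[OF F.mean_cost_increment(1) F.mean_cost_increment(2) rate t]) auto
  have rt: "r t = (1 - t) * r 0" if "t \<in> {0..<1}" for t
    using r[OF that] r[of 0] decay[of t] that by (simp add: real_sqrt_mult)
  have r0: "r 0 > 0" using assms(5) by (simp add: r_def)
  \<comment> \<open>By the decay law the flow cannot reach the target before time 1, so the default
    value 1 of \<open>chi\<close> does not occur on [0, 1).\<close>
  have rpos: "r t > 0" if "t \<in> {0..<1}" for t
    using rt[OF that] r0 that by simp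
  define \<xi> where "\<xi> t = chi (T t) (\<rho> t) \<rho>1" for t
  have \<xi>: "\<xi> t = ?n / (r t)\<^sup>2 * D t" if "t \<in> {0..<1}" for t
    using rpos[OF that] by (simp add: \<xi>_def chi_def r_def D_def)
  have n0: "?n > 0" by simp
  have \<xi>pos: "\<xi> t > 0" if "t \<in> {0..<1}" for t
    using \<xi>[OF that] rpos[OF that] Dpos[OF that rpos[OF that]] n0 by simp
  have \<xi>1: "\<xi> t \<le> 1" if "t \<in> {0..<1}" for t
  proof -
    have "?n * D t \<le> (r t)\<^sup>2" using nD[OF that] r[OF that] F.mean_cost_nonneg[of t] by simp
    then show ?thesis using \<xi>[OF that] rpos[OF that] by (simp add: divide_le_eq)
  qed
  define c0 where "c0 = ?n * (r 0)\<^sup>2"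
  have c0: "c0 > 0" using n0 r0 by (simp add: c0_def)
  \<comment> \<open>The energy density is taken along the extended curve and velocity, for which
    measurability in time is available.\<close>
  define E where "E t = (\<integral>\<^sup>+x. ennreal ((norm (?v t x))\<^sup>2) \<partial>?\<rho> t)" for t
  have [measurable]: "E \<in> borel_measurable borel"
    unfolding E_def by (rule nn_integral_measurable_kernel[OF F.kernel])
      (rule measurable_compose[OF F.velocity_measurable, of "\<lambda>y. ennreal ((norm y)\<^sup>2)"], measurable)
  have E: "E t = ennreal c0 * ennreal (1 / \<xi> t)" if t: "t \<in> {0..<1}" for t
  proof -
    have int: "integrable (\<rho> t) (\<lambda>x. (norm (sliced_field (T t) x))\<^sup>2)"
      using F.sliced_field_square_integrable[OF t] t by simp
    have "E t = (\<integral>\<^sup>+x. ennreal ((gain t)\<^sup>2 * (norm (sliced_field (T t) x))\<^sup>2) \<partial>\<rho> t)"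
      unfolding E_def using t
      by (simp, intro nn_integral_cong_AE) (use v[OF t] in eventually_elim, simp add: power_mult_distrib)
    also have "\<dots> = ennreal ((gain t)\<^sup>2 * D t)"
      using int by (subst nn_integral_eq_integral) (auto simp: D_def dissipation_def)
    \<comment> \<open>Inserting the gain gives the square of \<open>r t\<close> times the square of
      \<open>r t / (1 - t)\<close>, divided by \<open>D t\<close>; the decay law turns the quotient
      \<open>r t / (1 - t)\<close> into the constant \<open>r 0\<close>.\<close>
    also have "(gain t)\<^sup>2 * D t = c0 * (1 / \<xi> t)"
    proof -
      have p: "D t > 0" "r t > 0" "1 - t > 0" using Dpos rpos t by auto
      define d where "d = 1 - t"
      have "(gain t)\<^sup>2 * D t = (r t)\<^sup>2 * ((r t / (1 - t))\<^sup>2) / D t"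
        unfolding gain[OF t p(2)] d_def[symmetric] using p(1) p(3)[folded d_def]
        by (simp add: power2_eq_square field_simps)
      also have "r t / (1 - t) = r 0" using rt[OF t] p by (simp add: field_simps)
      finally show ?thesis unfolding \<xi>[OF t] c0_def using p n0 by (simp add: field_simps)
    qed
    also have "ennreal (c0 * (1 / \<xi> t)) = ennreal c0 * ennreal (1 / \<xi> t)"
      using c0 \<xi>pos[OF t] by (intro ennreal_mult) auto
    finally show ?thesis .
  qed
  \<comment> \<open>The expectation depends on \<open>X t\<close> only through its law
    \<open>\<rho> t\<close>.\<close>
  have energy: "energy M u \<tau> = (\<integral>\<^sup>+t. E t * indicator {0..\<tau>} t \<partial>lborel)" if "\<tau> < 1" for \<tau>
    unfolding energy_def
  proof (rule nn_integral_cong)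
    fix t
    show "(\<integral>\<^sup>+\<omega>. ennreal ((norm (u t \<omega>))\<^sup>2) \<partial>M) * indicator {0..\<tau>} t = E t * indicator {0..\<tau>} t"
    proof (cases "t \<in> {0..\<tau>}")
      case True
      then have t: "t \<in> {0..<1}" using that by auto
      have [measurable]: "X t \<in> borel_measurable M" and X: "distr M borel (X t) = \<rho> t" using assms(7)[OF t] by auto
      have [measurable]: "v t \<in> borel_measurable borel" using F.v_section_measurable[of t] t by simp
      have "(\<integral>\<^sup>+\<omega>. ennreal ((norm (u t \<omega>))\<^sup>2) \<partial>M) = (\<integral>\<^sup>+x. ennreal ((norm (v t x))\<^sup>2) \<partial>distr M borel (X t))"
        by (subst nn_integral_distr) (auto simp: u_def)
      then show ?thesis using t by (simp add: X E_def)
    qed simp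
  qed
  \<comment> \<open>One sequence approaching 1 from the left identifies \<open>total_energy\<close>;
    monotone convergence computes the limit along it, infinite values included.\<close>
  define \<tau> where "\<tau> n = 1 - 1 / real (Suc n)" for n
  have \<tau>1: "\<tau> n < 1" for n by (simp add: \<tau>_def)
  have \<tau>lim: "\<tau> \<longlonglongrightarrow> 1"
  proof -
    from tendsto_diff[OF tendsto_const divide_Suc_tendsto_0, of 1 1] show ?thesis by (simp add: \<tau>_def[abs_def])
  qed
  have \<tau>left: "filterlim \<tau> (at_left 1) sequentially"
    using \<tau>lim \<tau>1 by (auto simp: filterlim_at intro!: always_eventually less_imp_neq)
  have "(\<lambda>n. energy M u (\<tau> n)) \<longlonglongrightarrow> total_energy M u"
    by (rule filterlim_compose[OF energy_tendsto_total_energy \<tau>left])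
  moreover have "(\<lambda>n. energy M u (\<tau> n)) \<longlonglongrightarrow> (\<integral>\<^sup>+t. E t * indicator {0..<1} t \<partial>lborel)"
    unfolding energy[OF \<tau>1]
  proof (rule nn_integral_LIMSEQ)
    have "\<tau> m \<le> \<tau> n" if "m \<le> n" for m n using that by (simp add: \<tau>_def frac_le)
    then show "incseq (\<lambda>n t. E t * indicator {0..\<tau> n} t)"
      by (auto simp: incseq_def le_fun_def split: split_indicator intro: order_trans)
    show "(\<lambda>n. E t * indicator {0..\<tau> n} t) \<longlonglongrightarrow> E t * indicator {0..<1} t" for t
    proof (cases "t < 1")
      case True
      have "\<forall>\<^sub>F n in sequentially. t < \<tau> n" using order_tendstoD(1)[OF \<tau>lim True] .
      then have "\<forall>\<^sub>F n in sequentially. E t * indicator {0..<1} t = E t * indicator {0..\<tau> n} t"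
        by eventually_elim (use True in \<open>auto split: split_indicator\<close>)
      then show ?thesis by (rule Lim_transform_eventually[OF tendsto_const])
    next
      case False
      then have "t \<notin> {0..\<tau> n}" for n using \<tau>1[of n] by auto
      then show ?thesis using False by simp
    qed
  qed measurable
  ultimately have "total_energy M u = (\<integral>\<^sup>+t. E t * indicator {0..<1} t \<partial>lborel)"
    by (rule LIMSEQ_unique)
  also have "\<dots> = (\<integral>\<^sup>+t. E t * indicator {0<..<1} t \<partial>lborel)"
    by (rule nn_integral_cong_AE) (use AE_lborel_singleton[of 0] in eventually_elim, auto split: split_indicator)
  also have "\<dots> = (\<integral>\<^sup>+t. ennreal c0 * (ennreal (1 / \<xi> t) * indicator {0<..<1} t) \<partial>lborel)"
    by (rule nn_integral_cong) (auto simp: E mult.assoc split: split_indicator)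
  also have "\<dots> = ennreal c0 * (\<integral>\<^sup>+t. ennreal (1 / \<xi> t) * indicator {0<..<1} t \<partial>lborel)"
  proof (rule nn_integral_cmult)
    \<comment> \<open>Measurability of the reciprocal of \<open>\<xi>\<close> in time is inherited
      from \<open>E\<close>, since \<open>T\<close> comes without measurability in time.\<close>
    have "(\<lambda>t. ennreal (1 / \<xi> t) * indicator {0<..<1} t) = (\<lambda>t. ennreal (1 / c0) * E t * indicator {0<..<1} t)"
    proof
      fix t
      have "ennreal (1 / c0) * (ennreal c0 * ennreal (1 / \<xi> t)) = ennreal (1 / \<xi> t)"
        using c0 by (simp add: mult.assoc[symmetric] ennreal_mult[symmetric])
      then show "ennreal (1 / \<xi> t) * indicator {0<..<1} t = ennreal (1 / c0) * E t * indicator {0<..<1} t"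
        by (auto simp: E split: split_indicator)
    qed
    then show "(\<lambda>t. ennreal (1 / \<xi> t) * indicator {0<..<1} t) \<in> borel_measurable lborel" by simp
  qed
  finally have total: "total_energy M u = ennreal c0 * (\<integral>\<^sup>+t. ennreal (1 / \<xi> t) * indicator {0<..<1} t \<partial>lborel)" .
  have one: "(\<integral>\<^sup>+t. k * indicator {0<..<1::real} t \<partial>lborel) = k" for k :: ennreal
    by (simp add: nn_integral_cmult)
  have lower: "ennreal c0 \<le> total_energy M u"
  proof -
    have "(\<integral>\<^sup>+t. 1 * indicator {0<..<1::real} t \<partial>lborel) \<le> (\<integral>\<^sup>+t. ennreal (1 / \<xi> t) * indicator {0<..<1} t \<partial>lborel)"
    proof (rule nn_integral_mono)
      show "1 * indicator {0<..<1} t \<le> ennreal (1 / \<xi> t) * indicator {0<..<1} t" for t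
        using \<xi>1[of t] \<xi>pos[of t] by (auto split: split_indicator)
    qed
    then have "1 \<le> (\<integral>\<^sup>+t. ennreal (1 / \<xi> t) * indicator {0<..<1} t \<partial>lborel)" unfolding one .
    then show ?thesis unfolding total using mult_left_mono[of 1 _ "ennreal c0"] by simp
  qed
  have upper: "total_energy M u \<le> ennreal (?n / c * (r 0)\<^sup>2)"
    if c: "c > 0" "AE t in lborel. t \<in> {0<..<1} \<longrightarrow> c \<le> \<xi> t" for c
  proof -
    have "(\<integral>\<^sup>+t. ennreal (1 / \<xi> t) * indicator {0<..<1} t \<partial>lborel) \<le> (\<integral>\<^sup>+t. ennreal (1 / c) * indicator {0<..<1::real} t \<partial>lborel)"
    proof (rule nn_integral_mono_AE)
      show "AE t in lborel. ennreal (1 / \<xi> t) * indicator {0<..<1} t \<le> ennreal (1 / c) * indicator {0<..<1} t"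
        using c(2) by eventually_elim (use c(1) in \<open>auto split: split_indicator intro!: ennreal_leI frac_le\<close>)
    qed
    then have "total_energy M u \<le> ennreal c0 * ennreal (1 / c)"
      unfolding total one by (rule mult_left_mono) simp
    also have "\<dots> = ennreal (?n / c * (r 0)\<^sup>2)"
      using c0 c(1) by (simp add: ennreal_mult[symmetric] c0_def)
    finally show ?thesis .
  qed
  show ?thesis
    unfolding r_def[symmetric] \<xi>_def[symmetric] c0_def[symmetric]
  proof (intro conjI ballI allI impI)
    show "r t = (1 - t) * r 0" if "t \<in> {0..<1}" for t by (rule rt[OF that])
    show "total_energy M u = ennreal c0 * (\<integral>\<^sup>+t\<in>{0<..<1}. ennreal (1 / \<xi> t) \<partial>lborel)" by (rule total)
    show "ennreal c0 \<le> total_energy M u" by (rule lower)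
    show "total_energy M u \<le> ennreal (?n / c * (r 0)\<^sup>2)"
      if "c > 0" "AE t in lborel. t \<in> {0<..<1} \<longrightarrow> c \<le> \<xi> t" for c
      by (rule upper[OF that])
  qed
qed

end
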